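(* (a) The cosine families $\{\mathrm{Cos}_{\alpha,\beta}(t),\,t\in\mathbb R\}$ generated by $A_{\alpha,\beta}$ are equibounded: $$\|\mathrm{Cos}_{\alpha,\beta}(t)\|\le5\qquad\text{for all }\alpha,\beta\ge0\text{ with }\alpha+\beta>0\text{ and all }t\in\mathbb R.$$ Moreover, for any fixed $\alpha,\beta\ge0$ with $\alpha+\beta>0$: (b) We have $$\lim_{n\to\infty}\sup_{t\ge0}\|\mathrm{Cos}_{n\alpha,n\beta}(t)f-\mathrm{Cos}^{\mathrm{skew}}_{\alpha,\beta}(t)f\|=0,\qquad f\in\mathfrak C[-\infty,\infty],$$ where $\{\mathrm{Cos}^{\mathrm{skew}}_{\alpha,\beta}(t),\,t\in\mathbb R\}$ is the cosine family generated by $A^{\mathrm{skew}}_{\alpha,\beta}$. If $f\in\mathfrak C(\mathbb R_\sharp)$ does not belong to $\mathfrak C[-\infty,\infty]$, then the limit $\lim_{n\to\infty}\mathrm{Cos}_{n\alpha,n\beta}(t)f$ does not exist for at least one $t\in\mathbb R\setminus\{0\}$. (c) The limit $\lim_{n\to\infty}e^{tA_{n\alpha,n\beta}}f$ exists for all $t>0$ and $f\in\mathfrak C(\mathbb R_\sharp)$, and for $f\notin\mathfrak C[-\infty,\infty]$ it is uniform with respect to $t$ in compact subintervals of $(0,\infty)$.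
   Context: $\mathfrak C(\mathbb R_\sharp)$ is the Banach space (supremum norm) of real continuous functions on $(-\infty,0)\cup(0,\infty)$ with finite limits at $\pm\infty$ and finite one-sided limits $f(0-),f(0+)$ at $0$. $\mathfrak C[-\infty,\infty]$, the space of real continuous functions on $\mathbb R$ with finite limits at $\pm\infty$, is identified with the subspace of $f\in\mathfrak C(\mathbb R_\sharp)$ with $f(0-)=f(0+)$. All limits of vectors are in the norm of $\mathfrak C(\mathbb R_\sharp)$. $A_{\alpha,\beta}f=f''$ in $\mathfrak C(\mathbb R_\sharp)$, with domain consisting of twice continuously differentiable $f\in\mathfrak C(\mathbb R_\sharp)$ such that $f',f''\in\mathfrak C(\mathbb R_\sharp)$, $f'(0-)=\alpha(f(0+)-f(0-))$ and $f'(0+)=\beta(f(0+)-f(0-))$. It generates a strongly continuous cosine family $\{\mathrm{Cos}_{\alpha,\beta}(t)\}_{t\in\mathbb R}$ and a strongly continuous semigroup $\{e^{tA_{\alpha,\beta}}\}_{t\ge0}$ in $\mathfrak C(\mathbb R_\sharp)$. Explicitly, with $C(t)g(x)=\frac12[g(x+t)+g(x-t)]$, one has $\mathrm{Cos}_{\alpha,\beta}(t)f(x)=C(t)\widetilde{f_\ell}(x)$ for $x<0$ and $\mathrm{Cos}_{\alpha,\beta}(t)f(x)=C(t)\widetilde{f_{\mathrm r}}(x)$ for $x>0$, where, for $x>0$, $\widetilde{f_\ell}(-x)=f(-x)$, $\widetilde{f_{\mathrm r}}(x)=f(x)$, $$\widetilde{f_\ell}(x)=f(-x)+2\alpha\int_0^xe^{-(\alpha+\beta)(x-y)}[f(y)-f(-y)]\,dy,$$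 $$\widetilde{f_{\mathrm r}}(-x)=f(x)-2\beta\int_0^xe^{-(\alpha+\beta)(x-y)}[f(y)-f(-y)]\,dy,$$ and $\widetilde{f_\ell}(0)=f(0-)$, $\widetilde{f_{\mathrm r}}(0)=f(0+)$. $A^{\mathrm{skew}}_{\alpha,\beta}f=f''$ in $\mathfrak C[-\infty,\infty]$, with domain consisting of $f\in\mathfrak C[-\infty,\infty]$ such that: $f$ is twice continuously differentiable in both $(-\infty,0]$ and $[0,\infty)$, separately, with left-hand and right-hand derivatives at $0$, respectively; the limits $\lim_{x\to\pm\infty}f''(x)$ exist and are finite; $\alpha f'(0+)=\beta f'(0-)$ and $f''(0+)=f''(0-)$. It generates a strongly continuous cosine family in $\mathfrak C[-\infty,\infty]$. A strongly continuous cosine family in a Banach space is a strongly continuous family of bounded operators with $\mathrm{Cos}(0)=I$ and $2\,\mathrm{Cos}(t)\mathrm{Cos}(s)=\mathrm{Cos}(t+s)+\mathrm{Cos}(t-s)$; its generator is $Gf=\lim_{t\to0}2t^{-2}(\mathrm{Cos}(t)f-f)$, with domain the set of $f$ for which the limit exists. *)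

theory Defs
  imports "HOL-Analysis.Analysis"
begin

section \<open>The Banach space of continuous functions on the line punctured at 0\<close>

text \<open>The filters \<open>at_bot\<close>, \<open>at_left 0\<close>, \<open>at_right 0\<close>, \<open>at_top\<close> are the four ends of
  \<open>(-\<infinity>,0) \<union> (0,\<infinity>)\<close>. The value at \<open>0\<close>, where the functions are undefined, is normalised to \<open>0\<close>,
  so that equality in the type is equality of functions on the punctured line.\<close>

definition sharp_ends :: "real filter set" where
  "sharp_ends = {at_bot, at_left 0, at_right 0, at_top}"

lemma sharp_ends_not_bot: "F \<in> sharp_ends \<Longrightarrow> F \<noteq> bot"
  unfolding sharp_ends_def by (elim insertE emptyE) (simp_all only:, simp_all)

typedef csharp = "{f :: real \<Rightarrow> real. continuous_on (- {0}) f \<and>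
    (\<forall>F\<in>sharp_ends. \<exists>l. (f \<longlongrightarrow> l) F) \<and> f 0 = 0}"
  morphisms csharp_fun Csharp
  by (rule exI[of _ "\<lambda>_. 0"]) auto

lemma csharp_fun_continuous: "continuous_on (- {0}) (csharp_fun f)"
  and csharp_fun_limits: "F \<in> sharp_ends \<Longrightarrow> \<exists>l. (csharp_fun f \<longlongrightarrow> l) F"
  and csharp_fun_0 [simp]: "csharp_fun f 0 = 0"
  using csharp_fun[of f] by auto

lemma csharp_eqI: "(\<And>x. x \<noteq> 0 \<Longrightarrow> csharp_fun f x = csharp_fun g x) \<Longrightarrow> f = g"
  by (metis csharp_fun_0 csharp_fun_inject ext)

lemma csharp_fun_Csharp:
  assumes "continuous_on (- {0}) f" "\<And>F. F \<in> sharp_ends \<Longrightarrow> \<exists>l. (f \<longlongrightarrow> l) F" "f 0 = 0"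
  shows "csharp_fun (Csharp f) = f"
  using assms by (intro Csharp_inverse) auto

lemma csharp_fun_Csharp_linear:
  "csharp_fun (Csharp (\<lambda>x. a * csharp_fun f x + b * csharp_fun g x)) =
     (\<lambda>x. a * csharp_fun f x + b * csharp_fun g x)"
proof (rule csharp_fun_Csharp)
  show "continuous_on (- {0}) (\<lambda>x. a * csharp_fun f x + b * csharp_fun g x)"
    by (intro continuous_intros csharp_fun_continuous)
next
  fix F assume F: "F \<in> sharp_ends"
  obtain l where l: "(csharp_fun f \<longlongrightarrow> l) F" using csharp_fun_limits[OF F] by blast
  obtain m where m: "(csharp_fun g \<longlongrightarrow> m) F" using csharp_fun_limits[OF F] by blast
  have "((\<lambda>x. a * csharp_fun f x + b * csharp_fun g x) \<longlongrightarrow> a * l + b * m) F"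
    by (intro tendsto_intros l m)
  then show "\<exists>l. ((\<lambda>x. a * csharp_fun f x + b * csharp_fun g x) \<longlongrightarrow> l) F" ..
qed simp

lemma csharp_fun_bounded: "\<exists>M. \<forall>x. \<bar>csharp_fun f x\<bar> \<le> M"
proof -
  define u where "u = csharp_fun f"
  have ev: "\<exists>M. \<forall>\<^sub>F x in F. \<bar>u x\<bar> \<le> M" if F: "F \<in> sharp_ends" for F
  proof -
    obtain l where "(u \<longlongrightarrow> l) F"
      using csharp_fun_limits[OF F] unfolding u_def by blast
    then have "\<forall>\<^sub>F x in F. dist (u x) l < 1"
      by (rule tendstoD) simp
    then have "\<forall>\<^sub>F x in F. \<bar>u x\<bar> \<le> \<bar>l\<bar> + 1"
      by eventually_elim (simp add: dist_real_def)
    then show ?thesis ..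
  qed
  obtain M1 where "\<forall>\<^sub>F x in at_bot. \<bar>u x\<bar> \<le> M1"
    using ev[of at_bot] by (auto simp: sharp_ends_def)
  then obtain a where a: "\<And>x. x \<le> a \<Longrightarrow> \<bar>u x\<bar> \<le> M1"
    by (auto simp: eventually_at_bot_linorder)
  obtain M2 where "\<forall>\<^sub>F x in at_left 0. \<bar>u x\<bar> \<le> M2"
    using ev[of "at_left 0"] by (auto simp: sharp_ends_def)
  then obtain b where b: "b < 0" "\<And>x. b < x \<Longrightarrow> x < 0 \<Longrightarrow> \<bar>u x\<bar> \<le> M2"
    by (auto simp: eventually_at_left[of "-1"])
  obtain M3 where "\<forall>\<^sub>F x in at_right 0. \<bar>u x\<bar> \<le> M3"
    using ev[of "at_right 0"] by (auto simp: sharp_ends_def)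
  then obtain c where c: "c > 0" "\<And>x. 0 < x \<Longrightarrow> x < c \<Longrightarrow> \<bar>u x\<bar> \<le> M3"
    by (auto simp: eventually_at_right[of _ 1])
  obtain M4 where "\<forall>\<^sub>F x in at_top. \<bar>u x\<bar> \<le> M4"
    using ev[of at_top] by (auto simp: sharp_ends_def)
  then obtain d where d: "\<And>x. d \<le> x \<Longrightarrow> \<bar>u x\<bar> \<le> M4"
    by (auto simp: eventually_at_top_linorder)
  have "compact (u ` ({a..b} \<union> {c..d}))"
    using b(1) c(1) unfolding u_def
    by (intro compact_continuous_image compact_Un compact_Icc
          continuous_on_subset[OF csharp_fun_continuous]) auto
  then obtain M5 where M5: "\<And>x. x \<in> {a..b} \<union> {c..d} \<Longrightarrow> \<bar>u x\<bar> \<le> M5"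
    by (metis bounded_iff compact_imp_bounded image_eqI real_norm_def)
  define M where "M = \<bar>M1\<bar> + \<bar>M2\<bar> + \<bar>M3\<bar> + \<bar>M4\<bar> + \<bar>M5\<bar>"
  have "\<bar>u x\<bar> \<le> M" for x
  proof -
    consider "x \<le> a" | "a \<le> x" "x \<le> b" | "b < x" "x < 0" | "x = 0" | "0 < x" "x < c"
      | "c \<le> x" "x \<le> d" | "d \<le> x" by linarith
    then show ?thesis
    proof cases
      case 1 then show ?thesis using a[of x] by (simp add: M_def)
    next
      case 2 then show ?thesis using M5[of x] by (simp add: M_def)
    next
      case 3 then show ?thesis using b(2)[of x] by (simp add: M_def)
    next
      case 4 then show ?thesis by (simp add: M_def u_def)
    next
      case 5 then show ?thesis using c(2)[of x] by (simp add: M_def)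
    next
      case 6 then show ?thesis using M5[of x] by (simp add: M_def)
    next
      case 7 then show ?thesis using d[of x] by (simp add: M_def)
    qed
  qed
  then show ?thesis unfolding u_def by blast
qed

instantiation csharp :: real_normed_vector
begin

definition "0 = Csharp (\<lambda>_. 0)"
definition "f + g = Csharp (\<lambda>x. csharp_fun f x + csharp_fun g x)"
definition "- f = Csharp (\<lambda>x. - csharp_fun f x)"
definition "f - g = Csharp (\<lambda>x. csharp_fun f x - csharp_fun g x)"
definition "c *\<^sub>R f = Csharp (\<lambda>x. c * csharp_fun f x)"
definition norm_csharp :: "csharp \<Rightarrow> real" where
  "norm f = (SUP x\<in>- {0}. \<bar>csharp_fun f x\<bar>)"
definition dist_csharp :: "csharp \<Rightarrow> csharp \<Rightarrow> real" where
  "dist (f :: csharp) g = norm (f - g)"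
definition sgn_csharp :: "csharp \<Rightarrow> csharp" where
  "sgn (f :: csharp) = inverse (norm f) *\<^sub>R f"
definition uniformity_csharp :: "(csharp \<times> csharp) filter" where
  "uniformity_csharp = (INF e\<in>{0<..}. principal {(f, g). dist f g < e})"
definition open_csharp :: "csharp set \<Rightarrow> bool" where
  "open_csharp S = (\<forall>f\<in>S. \<forall>\<^sub>F (f', g) in uniformity. f' = f \<longrightarrow> g \<in> S)"

lemma csharp_fun_zero [simp]: "csharp_fun 0 x = 0"
  unfolding zero_csharp_def by (subst csharp_fun_Csharp) auto

lemma csharp_fun_add [simp]: "csharp_fun (f + g) x = csharp_fun f x + csharp_fun g x"
  using csharp_fun_Csharp_linear[of 1 f 1 g] by (simp add: plus_csharp_def)

lemma csharp_fun_uminus [simp]: "csharp_fun (- f) x = - csharp_fun f x"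
  using csharp_fun_Csharp_linear[of "-1" f 0 f] by (simp add: uminus_csharp_def)

lemma csharp_fun_diff [simp]: "csharp_fun (f - g) x = csharp_fun f x - csharp_fun g x"
  using csharp_fun_Csharp_linear[of 1 f "-1" g] by (simp add: minus_csharp_def)

lemma csharp_fun_scaleR [simp]: "csharp_fun (c *\<^sub>R f) x = c * csharp_fun f x"
  using csharp_fun_Csharp_linear[of c f 0 f] by (simp add: scaleR_csharp_def)

lemma abs_csharp_fun_le_norm: "\<bar>csharp_fun f x\<bar> \<le> norm f"
proof -
  obtain M where M: "\<And>x. \<bar>csharp_fun f x\<bar> \<le> M"
    using csharp_fun_bounded by blast
  have *: "\<bar>csharp_fun f y\<bar> \<le> norm f" if "y \<noteq> 0" for y
    unfolding norm_csharp_def using that M by (intro cSUP_upper bdd_aboveI2[where M = M]) auto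
  show ?thesis
  proof (cases "x = 0")
    case True
    then show ?thesis using *[of 1] by simp
  qed (rule *)
qed

lemma norm_csharp_le: "(\<And>x. x \<noteq> 0 \<Longrightarrow> \<bar>csharp_fun f x\<bar> \<le> b) \<Longrightarrow> norm f \<le> b"
  unfolding norm_csharp_def by (rule cSUP_least) (auto intro: exI[of _ 1])

instance
proof
  fix f g h :: csharp and a b :: real
  show "f + g + h = f + (g + h)" "f + g = g + f" "0 + f = f" "- f + f = 0" "f - g = f + - g"
    "a *\<^sub>R (f + g) = a *\<^sub>R f + a *\<^sub>R g" "(a + b) *\<^sub>R f = a *\<^sub>R f + b *\<^sub>R f"
    "a *\<^sub>R b *\<^sub>R f = (a * b) *\<^sub>R f" "1 *\<^sub>R f = f"
    by (auto intro!: csharp_eqI simp: algebra_simps)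
  show "norm f = 0 \<longleftrightarrow> f = 0"
  proof
    assume "norm f = 0"
    then show "f = 0"
      using abs_csharp_fun_le_norm[of f] by (intro csharp_eqI) simp
  next
    assume "f = 0"
    then show "norm f = 0"
      using norm_csharp_le[of f 0] abs_csharp_fun_le_norm[of f 1] by simp
  qed
  show "norm (f + g) \<le> norm f + norm g"
  proof (rule norm_csharp_le)
    fix x
    show "\<bar>csharp_fun (f + g) x\<bar> \<le> norm f + norm g"
      using abs_csharp_fun_le_norm[of f x] abs_csharp_fun_le_norm[of g x] by simp
  qed
  have le: "norm (c *\<^sub>R u) \<le> \<bar>c\<bar> * norm u" for c :: real and u :: csharp
    by (rule norm_csharp_le) (simp add: abs_mult mult_left_mono abs_csharp_fun_le_norm)
  show "norm (a *\<^sub>R f) = \<bar>a\<bar> * norm f"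
  proof (cases "a = 0")
    case True
    then show ?thesis using le[of a f] abs_csharp_fun_le_norm[of "a *\<^sub>R f" 1] by simp
  next
    case False
    have "f = inverse a *\<^sub>R (a *\<^sub>R f)"
      using False by (intro csharp_eqI) simp
    then have "norm f \<le> \<bar>inverse a\<bar> * norm (a *\<^sub>R f)"
      by (metis le)
    then have "\<bar>a\<bar> * norm f \<le> norm (a *\<^sub>R f)"
      using False by (simp add: field_simps)
    with le[of a f] show ?thesis by simp
  qed
qed (rule dist_csharp_def sgn_csharp_def uniformity_csharp_def open_csharp_def)+

end

lemma dist_csharp_fun_le: "dist (csharp_fun f x) (csharp_fun g x) \<le> dist f g"
  using abs_csharp_fun_le_norm[of "f - g" x] by (simp add: dist_norm)

lemma dist_csharp_limit_le:
  assumes "F \<in> sharp_ends" "(csharp_fun f \<longlongrightarrow> l) F" "(csharp_fun g \<longlongrightarrow> m) F"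
  shows "dist l m \<le> dist f g"
proof (rule tendsto_upperbound[OF tendsto_dist[OF assms(2,3)]])
  show "F \<noteq> bot" using assms(1) by (rule sharp_ends_not_bot)
qed (simp add: dist_csharp_fun_le)

instance csharp :: banach
proof
  fix X :: "nat \<Rightarrow> csharp"
  assume X: "Cauchy X"
  define u where "u n = csharp_fun (X n)" for n
  have "uniformly_Cauchy_on UNIV u"
    unfolding uniformly_Cauchy_on_def u_def
    using X dist_csharp_fun_le unfolding Cauchy_def by (meson le_less_trans)
  then obtain v where v: "uniform_limit UNIV u v sequentially"
    using Cauchy_uniformly_convergent unfolding uniformly_convergent_on_def by blast
  have lim: "\<exists>l. (v \<longlongrightarrow> l) F" if F: "F \<in> sharp_ends" for F
  proof -
    have "\<forall>n. \<exists>l. (u n \<longlongrightarrow> l) F"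
      using csharp_fun_limits[OF F] unfolding u_def by blast
    then obtain l where l: "\<And>n. (u n \<longlongrightarrow> l n) F"
      by metis
    have "dist (l m) (l n) \<le> dist (X m) (X n)" for m n
      using l F unfolding u_def by (intro dist_csharp_limit_le) auto
    then have "Cauchy l"
      using X unfolding Cauchy_def by (meson le_less_trans)
    then obtain L where "l \<longlonglongrightarrow> L"
      using Cauchy_convergent convergent_def by blast
    then have "(v \<longlongrightarrow> L) F"
      using l v by (intro swap_uniform_limit'[of u l F sequentially L UNIV]) auto
    then show ?thesis ..
  qed
  have cont: "continuous_on (- {0}) v"
    by (rule uniform_limit_theorem[where F = sequentially and f = u])
      (auto simp: u_def csharp_fun_continuous intro: uniform_limit_on_subset[OF v])
  have "(\<lambda>n. u n 0) \<longlonglongrightarrow> v 0"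
    using v by (rule tendsto_uniform_limitI) simp
  then have "v 0 = 0"
    by (simp add: u_def LIMSEQ_const_iff)
  with cont lim have v_eq: "csharp_fun (Csharp v) = v"
    by (intro csharp_fun_Csharp) auto
  have "X \<longlonglongrightarrow> Csharp v"
  proof (rule tendstoI)
    fix e :: real assume "e > 0"
    then have "\<forall>\<^sub>F n in sequentially. \<forall>x\<in>UNIV. dist (u n x) (v x) < e / 2"
      using v by (intro uniform_limitD) auto
    then show "\<forall>\<^sub>F n in sequentially. dist (X n) (Csharp v) < e"
    proof eventually_elim
      case (elim n)
      have "norm (X n - Csharp v) \<le> e / 2"
        using elim by (intro norm_csharp_le) (simp add: u_def v_eq dist_real_def less_imp_le)
      then show ?case using \<open>e > 0\<close> by (simp add: dist_norm)
    qed
  qed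
  then show "convergent X" by (rule convergentI)
qed

definition at0_minus :: "csharp \<Rightarrow> real" where
  "at0_minus f = Lim (at_left 0) (csharp_fun f)"

definition at0_plus :: "csharp \<Rightarrow> real" where
  "at0_plus f = Lim (at_right 0) (csharp_fun f)"

lemma tendsto_at0_minus: "(csharp_fun f \<longlongrightarrow> at0_minus f) (at_left 0)"
  using csharp_fun_limits[of "at_left 0" f] unfolding at0_minus_def
  by (auto simp: sharp_ends_def tendsto_Lim)

lemma tendsto_at0_plus: "(csharp_fun f \<longlongrightarrow> at0_plus f) (at_right 0)"
  using csharp_fun_limits[of "at_right 0" f] unfolding at0_plus_def
  by (auto simp: sharp_ends_def tendsto_Lim)

text \<open>The copy of \<open>C[-\<infinity>,\<infinity>]\<close> in \<open>csharp\<close>, and the continuous function on the whole line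
  represented by one of its elements.\<close>

definition cline :: "csharp set" where
  "cline = {f. at0_minus f = at0_plus f}"

definition cline_fun :: "csharp \<Rightarrow> real \<Rightarrow> real" where
  "cline_fun f x = (if x = 0 then at0_plus f else csharp_fun f x)"

lemma continuous_on_cline_fun:
  assumes "f \<in> cline"
  shows "continuous_on UNIV (cline_fun f)"
proof -
  have "isCont (cline_fun f) x" for x
  proof (cases "x = 0")
    case True
    have "(csharp_fun f \<longlongrightarrow> at0_plus f) (at 0)"
      using assms tendsto_at0_minus[of f] tendsto_at0_plus[of f]
      by (simp add: cline_def filterlim_split_at)
    then have "(cline_fun f \<longlongrightarrow> at0_plus f) (at 0)"
      by (rule Lim_transform_eventually) (auto simp: eventually_at_filter cline_fun_def)
    then show ?thesis
      using True by (simp add: isCont_def cline_fun_def)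
  next
    case False
    then have "isCont (csharp_fun f) x"
      using csharp_fun_continuous[of f] continuous_on_eq_continuous_at[of "- {0}" "csharp_fun f"]
      by (simp add: open_Compl)
    moreover have "\<forall>\<^sub>F y in nhds x. y \<in> - {0}"
      using False by (intro eventually_nhds_in_open) auto
    then have "\<forall>\<^sub>F y in nhds x. cline_fun f y = csharp_fun f y"
      by eventually_elim (simp add: cline_fun_def)
    ultimately show ?thesis by (simp add: isCont_cong)
  qed
  then show ?thesis by (simp add: continuous_at_imp_continuous_on)
qed

lemma bounded_linear_at0: "bounded_linear at0_minus" "bounded_linear at0_plus"
proof -
  have *: "bounded_linear L" if F: "F \<in> sharp_ends" and L: "\<And>f. (csharp_fun f \<longlongrightarrow> L f) F"
    for L F
  proof (rule bounded_linear_intro[where K = 1])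
    have F': "F \<noteq> bot" using F by (rule sharp_ends_not_bot)
    have fun_zero: "csharp_fun 0 = (\<lambda>x. 0)"
      by auto
    have fun_add: "csharp_fun (f + g) = (\<lambda>x. csharp_fun f x + csharp_fun g x)"
      and fun_scale: "csharp_fun (c *\<^sub>R f) = (\<lambda>x. c * csharp_fun f x)" for f g c
      by auto
    show "L (f + g) = L f + L g" for f g
      using tendsto_add[OF L[of f] L[of g]] L[of "f + g"]
      by (intro tendsto_unique[OF F', of "csharp_fun (f + g)"]) (simp_all only: fun_add)
    show "L (c *\<^sub>R f) = c *\<^sub>R L f" for c f
      using tendsto_mult_left[OF L[of f], of c] L[of "c *\<^sub>R f"]
      by (intro tendsto_unique[OF F', of "csharp_fun (c *\<^sub>R f)"]) (simp_all add: fun_scale)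
    show "norm (L f) \<le> norm f * 1" for f
      using dist_csharp_limit_le[OF F L[of f], of 0 0] fun_zero by (simp add: dist_norm)
  qed
  show "bounded_linear at0_minus"
    by (rule *[of "at_left 0"]) (auto simp: sharp_ends_def tendsto_at0_minus)
  show "bounded_linear at0_plus"
    by (rule *[of "at_right 0"]) (auto simp: sharp_ends_def tendsto_at0_plus)
qed

lemma subspace_cline: "subspace cline"
  using bounded_linear_at0
  by (simp add: subspace_def cline_def bounded_linear_def linear_add linear_scale linear_0)

lemma closed_cline: "closed cline"
  unfolding cline_def
  by (intro closed_Collect_eq linear_continuous_on bounded_linear_at0)

section \<open>Cosine families, semigroups and their generators\<close>

text \<open>Families of operators act in a closed subspace \<open>X\<close> of a Banach space (possibly \<open>UNIV\<close>);
  their values off \<open>X\<close> are irrelevant. Unbounded operators are represented by their graphs.\<close>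

definition bounded_linear_in :: "'a::real_normed_vector set \<Rightarrow> ('a \<Rightarrow> 'a) \<Rightarrow> bool" where
  "bounded_linear_in X T \<longleftrightarrow>
     (\<forall>f\<in>X. T f \<in> X) \<and>
     (\<forall>f\<in>X. \<forall>g\<in>X. T (f + g) = T f + T g) \<and>
     (\<forall>c. \<forall>f\<in>X. T (c *\<^sub>R f) = c *\<^sub>R T f) \<and>
     (\<exists>K. \<forall>f\<in>X. norm (T f) \<le> K * norm f)"

lemma bounded_linear_in_UNIV: "bounded_linear_in UNIV T \<longleftrightarrow> bounded_linear T"
proof
  assume "bounded_linear_in UNIV T"
  then obtain K where "\<And>f g. T (f + g) = T f + T g" "\<And>c f. T (c *\<^sub>R f) = c *\<^sub>R T f"
      "\<And>f. norm (T f) \<le> K * norm f"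
    unfolding bounded_linear_in_def by auto
  then show "bounded_linear T"
    by (intro bounded_linear_intro[where K = K]) (simp_all add: mult.commute)
next
  assume T: "bounded_linear T"
  then have "linear T" by (rule bounded_linear.linear)
  moreover from T obtain K where "\<And>f. norm (T f) \<le> norm f * K"
    using bounded_linear.bounded by blast
  ultimately show "bounded_linear_in UNIV T"
    unfolding bounded_linear_in_def
    by (auto simp: linear_add linear_scale mult.commute intro!: exI[of _ K])
qed

definition cosine_family :: "'a::real_normed_vector set \<Rightarrow> (real \<Rightarrow> 'a \<Rightarrow> 'a) \<Rightarrow> bool" where
  "cosine_family X C \<longleftrightarrow>
     (\<forall>t. bounded_linear_in X (C t)) \<and>
     (\<forall>f\<in>X. C 0 f = f) \<and>
     (\<forall>t s. \<forall>f\<in>X. 2 *\<^sub>R C t (C s f) = C (t + s) f + C (t - s) f) \<and>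
     (\<forall>f\<in>X. continuous_on UNIV (\<lambda>t. C t f))"

definition cosine_generator ::
    "'a::real_normed_vector set \<Rightarrow> (real \<Rightarrow> 'a \<Rightarrow> 'a) \<Rightarrow> ('a \<times> 'a) set" where
  "cosine_generator X C =
     {(f, g). f \<in> X \<and> g \<in> X \<and> ((\<lambda>t. (2 / t\<^sup>2) *\<^sub>R (C t f - f)) \<longlongrightarrow> g) (at 0)}"

definition generates_cosine_family ::
    "'a::real_normed_vector set \<Rightarrow> ('a \<times> 'a) set \<Rightarrow> (real \<Rightarrow> 'a \<Rightarrow> 'a) \<Rightarrow> bool" where
  "generates_cosine_family X A C \<longleftrightarrow> cosine_family X C \<and> cosine_generator X C = A"

text \<open>For semigroups only the operators \<open>T t\<close> with \<open>t \<ge> 0\<close> are relevant.\<close>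

definition strongly_continuous_semigroup ::
    "'a::real_normed_vector set \<Rightarrow> (real \<Rightarrow> 'a \<Rightarrow> 'a) \<Rightarrow> bool" where
  "strongly_continuous_semigroup X T \<longleftrightarrow>
     (\<forall>t\<ge>0. bounded_linear_in X (T t)) \<and>
     (\<forall>f\<in>X. T 0 f = f) \<and>
     (\<forall>t\<ge>0. \<forall>s\<ge>0. \<forall>f\<in>X. T (t + s) f = T t (T s f)) \<and>
     (\<forall>f\<in>X. continuous_on {0..} (\<lambda>t. T t f))"

definition semigroup_generator ::
    "'a::real_normed_vector set \<Rightarrow> (real \<Rightarrow> 'a \<Rightarrow> 'a) \<Rightarrow> ('a \<times> 'a) set" where
  "semigroup_generator X T =
     {(f, g). f \<in> X \<and> g \<in> X \<and> ((\<lambda>t. (1 / t) *\<^sub>R (T t f - f)) \<longlongrightarrow> g) (at_right 0)}"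

definition generates_semigroup ::
    "'a::real_normed_vector set \<Rightarrow> ('a \<times> 'a) set \<Rightarrow> (real \<Rightarrow> 'a \<Rightarrow> 'a) \<Rightarrow> bool" where
  "generates_semigroup X A T \<longleftrightarrow>
     strongly_continuous_semigroup X T \<and> semigroup_generator X T = A"

section \<open>The two operators\<close>

text \<open>Below \<open>f\<close>, \<open>g\<close>, \<open>h\<close> are \<open>f\<close>, \<open>f'\<close>, \<open>f''\<close>; continuity of the derivatives and existence of
  their limits are part of membership in \<open>csharp\<close>.\<close>

definition A_op :: "real \<Rightarrow> real \<Rightarrow> (csharp \<times> csharp) set" where
  "A_op \<alpha> \<beta> = {(f, h). \<exists>g.
     (\<forall>x. x \<noteq> 0 \<longrightarrow> (csharp_fun f has_real_derivative csharp_fun g x) (at x)) \<and>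
     (\<forall>x. x \<noteq> 0 \<longrightarrow> (csharp_fun g has_real_derivative csharp_fun h x) (at x)) \<and>
     at0_minus g = \<alpha> * (at0_plus f - at0_minus f) \<and>
     at0_plus g = \<beta> * (at0_plus f - at0_minus f)}"

text \<open>Here \<open>g\<^sub>1\<close> and \<open>g\<^sub>2\<close> are \<open>f'\<close> on \<open>(-\<infinity>,0]\<close> and \<open>[0,\<infinity>)\<close>, one-sided at \<open>0\<close>. Since both one-sided
  second derivatives of \<open>f\<close> at \<open>0\<close> equal \<open>cline_fun h 0\<close> with \<open>h \<in> cline\<close>, we have
  \<open>f''(0-) = f''(0+)\<close>; the limits of \<open>f''\<close> at \<open>\<plusminus>\<infinity>\<close> exist because \<open>h\<close> is in \<open>csharp\<close>.\<close>

definition A_skew :: "real \<Rightarrow> real \<Rightarrow> (csharp \<times> csharp) set" where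
  "A_skew \<alpha> \<beta> = {(f, h). f \<in> cline \<and> h \<in> cline \<and> (\<exists>g\<^sub>1 g\<^sub>2.
     (\<forall>x\<le>0. (cline_fun f has_real_derivative g\<^sub>1 x) (at x within {..0})) \<and>
     (\<forall>x\<le>0. (g\<^sub>1 has_real_derivative cline_fun h x) (at x within {..0})) \<and>
     (\<forall>x\<ge>0. (cline_fun f has_real_derivative g\<^sub>2 x) (at x within {0..})) \<and>
     (\<forall>x\<ge>0. (g\<^sub>2 has_real_derivative cline_fun h x) (at x within {0..})) \<and>
     \<alpha> * g\<^sub>2 0 = \<beta> * g\<^sub>1 0)}"

end

theory Submission
  imports Defs
begin

text \<open>On each half-line the orbits of the cosine families are solutions of the wave equation; d'Alembert's
  formula, together with the transmission conditions, turns them into the explicit formula in terms of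
  \<open>\<integral>\<^sub>0\<^sup>x exp (- (\<alpha> + \<beta>) (x - y)) (f y - f (- y)) dy\<close>, which gives the bound. For \<open>A_op (n\<alpha>) (n\<beta>)\<close> the kernel is an
  approximate identity as \<open>n \<rightarrow> \<infinity>\<close>: the limit is the formula for \<open>A_skew \<alpha> \<beta>\<close> if \<open>f\<close> is continuous at \<open>0\<close>, with
  error \<open>O(1/n)\<close> on its domain, and it has a jump otherwise.

  The semigroups are treated without the cosine families. By the maximum principle \<open>A_op \<alpha> \<beta>\<close> is dissipative,
  so the semigroups are contractions. For smooth \<open>g\<close> satisfying all the transmission conditions at once, the jump of
  \<open>T n t g\<close> at \<open>0\<close> is \<open>O(1/n)\<close>, uniformly in \<open>t\<close>, and the maximum principle shows that the orbits form a Cauchy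
  sequence. Such \<open>g\<close> are dense in \<open>cline\<close>. Any other \<open>f\<close> differs from an element of \<open>cline\<close> by a function dominated by
  a multiple of a narrow Gaussian, whose orbit is explicit, independent of \<open>n\<close>, and small for \<open>t \<ge> a > 0\<close>.\<close>

section \<open>Functions on the punctured line\<close>

text \<open>The theorem supposes only that the families have the given generators, so no formula for
  an orbit may be assumed: density of the domains, smoothness in time and uniqueness of orbits are
  extracted from the functional equations. For cosine families the obstacle is that the generator
  controls symmetric second differences alone, not derivatives; comparison with a second
  antiderivative removes it. On each half-line the single datum not fixed by the initial value is
  the time integral of the boundary slope. For \<open>A_op\<close> the half-lines are coupled by a
  linear first-order equation for the integrated jump, solved by the exponential integral; for
  \<open>A_skew\<close>, by two linear equations. The number 5 is the bound 1 + 2 * 2 for the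
  extended functions; d'Alembert's formula takes only half of a corrected value. The cosine formula
  does not directly give the semigroup limit off \<open>cline\<close>, where the cosine families
  diverge; what helps is the decay of a concentrated bump under the heat flow, an effect that is
  lost as \<open>t\<close> tends to 0.\<close>

lemma csharp_fun_isCont: "x \<noteq> 0 \<Longrightarrow> isCont (csharp_fun f) x"
  using csharp_fun_continuous[of f] continuous_on_eq_continuous_at[of "- {0}" "csharp_fun f"]
  by (simp add: open_Compl)

lemma eventually_at_right_0_ex: "\<forall>\<^sub>F x in at_right (0::real). P x \<Longrightarrow> \<exists>x. P x"
  using eventually_happens trivial_limit_at_right_real by blast

lemma csharp_limitE:
  assumes "F \<in> {at_bot, at_left 0, at_right 0, at_top}"
  obtains l where "(csharp_fun f \<longlongrightarrow> l) F"
  using csharp_fun_limits[of F f] assms unfolding sharp_ends_def by blast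

lemma csharp_fun_CsharpI:
  assumes "\<And>x. x \<noteq> 0 \<Longrightarrow> isCont f x" "(f \<longlongrightarrow> a) at_bot" "(f \<longlongrightarrow> b) (at_left 0)"
    "(f \<longlongrightarrow> c) (at_right 0)" "(f \<longlongrightarrow> d) at_top" "f 0 = 0"
  shows "csharp_fun (Csharp f) = f"
proof (rule csharp_fun_Csharp)
  show "continuous_on (- {0}) f"
    using assms(1) by (intro continuous_at_imp_continuous_on) auto
  show "\<exists>l. (f \<longlongrightarrow> l) F" if "F \<in> sharp_ends" for F
    using that assms(2-5) unfolding sharp_ends_def by blast
qed (fact assms(6))

text \<open>The analysis is carried out on the positive half-line only; this operator transports it
  to the negative one.\<close>

definition reflect :: "csharp \<Rightarrow> csharp" where
  "reflect f = Csharp (\<lambda>x. csharp_fun f (- x))"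

lemma csharp_fun_reflect [simp]: "csharp_fun (reflect f) x = csharp_fun f (- x)"
proof -
  obtain a b c d where l: "(csharp_fun f \<longlongrightarrow> a) at_top" "(csharp_fun f \<longlongrightarrow> b) (at_right 0)"
      "(csharp_fun f \<longlongrightarrow> c) (at_left 0)" "(csharp_fun f \<longlongrightarrow> d) at_bot"
    using csharp_limitE by (metis insertCI)
  have "csharp_fun (Csharp (\<lambda>x. csharp_fun f (- x))) = (\<lambda>x. csharp_fun f (- x))"
  proof (rule csharp_fun_CsharpI)
    show "isCont (\<lambda>x. csharp_fun f (- x)) x" if "x \<noteq> 0" for x
      using that by (intro isCont_o2[OF _ csharp_fun_isCont]) auto
    show "((\<lambda>x. csharp_fun f (- x)) \<longlongrightarrow> a) at_bot"
      by (rule filterlim_compose[OF l(1) filterlim_uminus_at_top_at_bot])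
    show "((\<lambda>x. csharp_fun f (- x)) \<longlongrightarrow> d) at_top"
      by (rule filterlim_compose[OF l(4) filterlim_uminus_at_bot_at_top])
    show "((\<lambda>x. csharp_fun f (- x)) \<longlongrightarrow> b) (at_left 0)"
      using l(2) by (simp add: filterlim_at_left_to_right)
    show "((\<lambda>x. csharp_fun f (- x)) \<longlongrightarrow> c) (at_right 0)"
      using l(3) by (simp add: filterlim_at_left_to_right)
  qed simp
  then show ?thesis by (simp add: reflect_def)
qed

lemma at0_eqI:
  "(csharp_fun f \<longlongrightarrow> l) (at_right 0) \<Longrightarrow> at0_plus f = l"
  "(csharp_fun f \<longlongrightarrow> l) (at_left 0) \<Longrightarrow> at0_minus f = l"
  using tendsto_unique[OF _ tendsto_at0_plus] tendsto_unique[OF _ tendsto_at0_minus] by auto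

lemma at0_reflect [simp]: "at0_plus (reflect f) = at0_minus f"
proof (rule at0_eqI)
  show "(csharp_fun (reflect f) \<longlongrightarrow> at0_minus f) (at_right 0)"
    using tendsto_at0_minus[of f] by (simp add: filterlim_at_left_to_right csharp_fun_reflect[abs_def])
qed

lemma abs_at0_le: "\<bar>at0_plus f\<bar> \<le> norm f" "\<bar>at0_minus f\<bar> \<le> norm f"
proof -
  have "\<bar>at0_plus f\<bar> \<le> norm f" for f
    using tendsto_at0_plus[of f] abs_csharp_fun_le_norm[of f]
    by (intro tendsto_upperbound[OF tendsto_rabs]) auto
  from this[of f] this[of "reflect f"] show "\<bar>at0_plus f\<bar> \<le> norm f" "\<bar>at0_minus f\<bar> \<le> norm f"
    using norm_csharp_le[of "reflect f" "norm f"] abs_csharp_fun_le_norm[of f] by force+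
qed

lemma bounded_linear_csharpI:
  assumes "\<And>f x. x \<noteq> 0 \<Longrightarrow> csharp_fun (L f) x = csharp_fun f (s x)"
  shows "bounded_linear L"
proof (rule bounded_linear_intro[where K = 1])
  show "L (f + g) = L f + L g" "L (c *\<^sub>R f) = c *\<^sub>R L f" for f g c
    by (auto intro!: csharp_eqI simp: assms)
  show "norm (L f) \<le> norm f * 1" for f
    by (auto intro!: norm_csharp_le simp: assms abs_csharp_fun_le_norm)
qed

lemma bounded_linear_reflect: "bounded_linear reflect"
  by (rule bounded_linear_csharpI[where s = uminus]) simp

lemma norm_reflect [simp]: "norm (reflect f) = norm f"
proof (rule antisym)
  have le: "norm (reflect f) \<le> norm f" for f
    by (rule norm_csharp_le) (simp add: abs_csharp_fun_le_norm)
  have "reflect (reflect f) = f" by (rule csharp_eqI) simp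
  with le[of f] le[of "reflect f"] show "norm (reflect f) \<le> norm f" "norm f \<le> norm (reflect f)"
    by simp_all
qed

text \<open>Encodes a function on the positive half-line as an element of the Banach space, so that
  norm estimates for vector-valued curves apply to combinations of the values at \<open>x\<close>
  and \<open>- x\<close>.\<close>

definition even_ext :: "csharp \<Rightarrow> csharp" where
  "even_ext f = Csharp (\<lambda>x. csharp_fun f \<bar>x\<bar>)"

lemma csharp_fun_even_ext [simp]: "csharp_fun (even_ext f) x = csharp_fun f \<bar>x\<bar>"
proof -
  obtain a b where l: "(csharp_fun f \<longlongrightarrow> a) at_top" "(csharp_fun f \<longlongrightarrow> b) (at_right 0)"
    using csharp_limitE by (metis insertCI)
  have "csharp_fun (Csharp (\<lambda>x. csharp_fun f \<bar>x\<bar>)) = (\<lambda>x. csharp_fun f \<bar>x\<bar>)"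
  proof (rule csharp_fun_CsharpI)
    show "isCont (\<lambda>x. csharp_fun f \<bar>x\<bar>) x" if "x \<noteq> 0" for x
      using that by (intro isCont_o2[OF _ csharp_fun_isCont]) auto
    show "((\<lambda>x. csharp_fun f \<bar>x\<bar>) \<longlongrightarrow> a) at_bot"
      by (rule filterlim_compose[OF l(1)]) (simp add: filterlim_at_bot_mirror filterlim_abs_real)
    show "((\<lambda>x. csharp_fun f \<bar>x\<bar>) \<longlongrightarrow> a) at_top"
      by (rule filterlim_compose[OF l(1) filterlim_abs_real])
    show r: "((\<lambda>x. csharp_fun f \<bar>x\<bar>) \<longlongrightarrow> b) (at_right 0)"
      by (rule Lim_transform_eventually[OF l(2)]) (simp add: eventually_at_filter)
    then show "((\<lambda>x. csharp_fun f \<bar>x\<bar>) \<longlongrightarrow> b) (at_left 0)"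
      by (simp add: filterlim_at_left_to_right)
  qed simp
  then show ?thesis by (simp add: even_ext_def)
qed

lemma bounded_linear_even_ext: "bounded_linear even_ext"
  by (rule bounded_linear_csharpI[where s = abs]) simp

text \<open>Formulas of d'Alembert type are available off the front
  \<open>\<bar>x\<bar> = t\<close>; continuity supplies the remaining points.\<close>

lemma norm_csharp_le_off:
  assumes "\<And>x. x \<noteq> 0 \<Longrightarrow> \<bar>x\<bar> \<noteq> t \<Longrightarrow> \<bar>csharp_fun f x\<bar> \<le> b"
  shows "norm f \<le> b"
proof (rule norm_csharp_le)
  fix x :: real assume x: "x \<noteq> 0"
  have "((\<lambda>y. \<bar>csharp_fun f y\<bar>) \<longlongrightarrow> \<bar>csharp_fun f x\<bar>) (at x)"
    using csharp_fun_isCont[OF x, of f] by (intro tendsto_rabs) (simp add: isCont_def)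
  moreover have "\<forall>\<^sub>F y in at x. y \<notin> {0, t, - t}"
    unfolding eventually_at_topological
    by (intro exI[of _ "- ({0, t, - t} - {x})"] conjI open_Compl finite_imp_closed) auto
  then have "\<forall>\<^sub>F y in at x. \<bar>csharp_fun f y\<bar> \<le> b"
    by eventually_elim (intro assms, auto simp: abs_if split: if_splits)
  ultimately show "\<bar>csharp_fun f x\<bar> \<le> b"
    by (rule tendsto_upperbound) simp
qed

section \<open>Evaluation of vector-valued curves at moving points\<close>

lemma bounded_linear_csharp_fun: "bounded_linear (\<lambda>f. csharp_fun f x)"
  by (rule bounded_linear_intro[where K = 1]) (simp_all add: abs_csharp_fun_le_norm)

lemma tendsto_csharp_fun:
  assumes "(U \<longlongrightarrow> f) F" "(s \<longlongrightarrow> x) F" "x \<noteq> 0"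
  shows "((\<lambda>t. csharp_fun (U t) (s t)) \<longlongrightarrow> csharp_fun f x) F"
proof -
  have "((\<lambda>t. csharp_fun (U t) (s t) - csharp_fun f (s t)) \<longlongrightarrow> 0) F"
  proof (rule Lim_null_comparison)
    show "\<forall>\<^sub>F t in F. norm (csharp_fun (U t) (s t) - csharp_fun f (s t)) \<le> norm (U t - f)"
      using abs_csharp_fun_le_norm[of "U _ - f"] by (intro always_eventually) simp
    show "((\<lambda>t. norm (U t - f)) \<longlongrightarrow> 0) F"
      using assms(1) by (simp add: LIM_zero_iff tendsto_norm_zero_iff)
  qed
  moreover have "((\<lambda>t. csharp_fun f (s t)) \<longlongrightarrow> csharp_fun f x) F"
    by (rule isCont_tendsto_compose[OF csharp_fun_isCont assms(2)]) fact
  ultimately show ?thesis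
    using tendsto_add by fastforce
qed

lemma tendsto_csharp_fun_at0:
  assumes "(U \<longlongrightarrow> f) F" "filterlim s (at_right 0) F"
  shows "((\<lambda>t. csharp_fun (U t) (s t)) \<longlongrightarrow> at0_plus f) F"
proof -
  have "((\<lambda>t. csharp_fun (U t) (s t) - csharp_fun f (s t)) \<longlongrightarrow> 0) F"
  proof (rule Lim_null_comparison)
    show "\<forall>\<^sub>F t in F. norm (csharp_fun (U t) (s t) - csharp_fun f (s t)) \<le> norm (U t - f)"
      using abs_csharp_fun_le_norm[of "U _ - f"] by (intro always_eventually) simp
    show "((\<lambda>t. norm (U t - f)) \<longlongrightarrow> 0) F"
      using assms(1) by (simp add: LIM_zero_iff tendsto_norm_zero_iff)
  qed
  moreover have "((\<lambda>t. csharp_fun f (s t)) \<longlongrightarrow> at0_plus f) F"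
    by (rule filterlim_compose[OF tendsto_at0_plus assms(2)])
  ultimately show ?thesis
    using tendsto_add by fastforce
qed

section \<open>Second antiderivatives and second differences\<close>

text \<open>The second integral makes this the signed integral from 0 also for negative
  \<open>t\<close>, since an integral over an empty interval vanishes; the primitive is therefore
  differentiable across 0.\<close>

definition antideriv :: "(real \<Rightarrow> 'a::banach) \<Rightarrow> real \<Rightarrow> 'a" where
  "antideriv f t = integral {0..t} f - integral {t..0} f"

lemma antideriv_0 [simp]: "antideriv f 0 = 0"
  by (simp add: antideriv_def)

lemma antideriv_cmult: "antideriv (\<lambda>s. c * f s) t = c * antideriv f t" for f :: "real \<Rightarrow> real"
  by (simp add: antideriv_def algebra_simps)

lemma has_vector_derivative_antideriv:
  fixes f :: "real \<Rightarrow> 'a::banach"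
  assumes "continuous_on UNIV f"
  shows "(antideriv f has_vector_derivative f t) (at t)"
proof -
  have int: "f integrable_on {a..b}" for a b
    by (intro integrable_continuous_real continuous_on_subset[OF assms]) simp
  define N where "N = \<bar>t\<bar> + 1"
  have eq: "antideriv f s = integral {-N..s} f - integral {-N..0} f" if "s \<in> {-N<..<N}" for s
  proof (cases "0 \<le> s")
    case True
    then have "integral {-N..0} f + integral {0..s} f = integral {-N..s} f"
      using that by (intro Henstock_Kurzweil_Integration.integral_combine int) auto
    moreover have "integral {s..0} f = 0"
      using True by (cases "s = 0") auto
    ultimately show ?thesis by (simp add: antideriv_def algebra_simps)
  next
    case False
    then have "integral {-N..s} f + integral {s..0} f = integral {-N..0} f"
      using that by (intro Henstock_Kurzweil_Integration.integral_combine int) auto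
    moreover have "integral {0..s} f = 0"
      using False by simp
    ultimately show ?thesis by (simp add: antideriv_def algebra_simps)
  qed
  have "((\<lambda>s. integral {-N..s} f) has_vector_derivative f t) (at t within {-N..N})"
    by (intro integral_has_vector_derivative continuous_on_subset[OF assms]) (auto simp: N_def)
  then have "((\<lambda>s. integral {-N..s} f) has_vector_derivative f t) (at t)"
    by (simp add: at_within_Icc_at N_def)
  then have "((\<lambda>s. integral {-N..s} f - integral {-N..0} f) has_vector_derivative f t) (at t)"
    by (auto intro!: derivative_eq_intros)
  then show ?thesis
    by (rule has_vector_derivative_transform_within_open[where S = "{-N<..<N}"])
      (auto simp: eq, auto simp: N_def)
qed

lemma zero_vector_derivative_imp_const:
  fixes X :: "real \<Rightarrow> 'a::real_normed_vector"
  assumes "\<And>t. (X has_vector_derivative 0) (at t)"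
  shows "X t = X 0"
proof -
  obtain c where "\<forall>t\<in>UNIV. X t = c"
    using has_vector_derivative_zero_constant[of UNIV X] assms by auto
  then show ?thesis by simp
qed

text \<open>Serves as the uniqueness principle for identities between second antiderivatives:
  differentiate the defect twice and check its data at 0.\<close>

lemma zero_second_derivative:
  fixes W V :: "real \<Rightarrow> 'a::real_normed_vector"
  assumes "\<And>t. (W has_vector_derivative V t) (at t)" "\<And>t. (V has_vector_derivative 0) (at t)"
    "W 0 = 0" "V 0 = 0"
  shows "W t = 0"
proof -
  have V: "V t = 0" for t
    using zero_vector_derivative_imp_const[of V t, OF assms(2)] assms(4) by simp
  have "\<And>t. (W has_vector_derivative 0) (at t)"
    using assms(1) unfolding V .
  from zero_vector_derivative_imp_const[of W, OF this] show ?thesis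
    using assms(3) by simp
qed

lemma has_vector_derivative_affine:
  assumes "\<And>t. (F has_vector_derivative Q t) (at t)"
  shows "((\<lambda>s. F (a + c * s)) has_vector_derivative c *\<^sub>R Q (a + c * s)) (at s)"
proof -
  have "((\<lambda>s. a + c * s) has_vector_derivative c) (at s)"
    by (auto intro!: derivative_eq_intros)
  from vector_diff_chain_at[OF this assms, unfolded o_def] show ?thesis .
qed

lemma has_vector_derivative_shift_reflect:
  assumes "\<And>t. (F has_vector_derivative Q t) (at t)"
  shows "((\<lambda>s. F (a + s)) has_vector_derivative Q (a + s)) (at s)"
    "((\<lambda>s. F (s + a)) has_vector_derivative Q (s + a)) (at s)"
    "((\<lambda>s. F (s - a)) has_vector_derivative Q (s - a)) (at s)"
    "((\<lambda>s. F (a - s)) has_vector_derivative - Q (a - s)) (at s)"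
    "((\<lambda>s. F (- s)) has_vector_derivative - Q (- s)) (at s)"
  using has_vector_derivative_affine[OF assms, of a 1 s]
    has_vector_derivative_affine[OF assms, of "- a" 1 s]
    has_vector_derivative_affine[OF assms, of a "-1" s]
    has_vector_derivative_affine[OF assms, of 0 "-1" s]
  by (simp_all add: add.commute)

lemma second_difference_tendsto:
  fixes F Q :: "real \<Rightarrow> 'a::real_normed_vector"
  assumes F: "\<And>t. (F has_vector_derivative Q t) (at t)" and Q: "(Q has_vector_derivative K) (at t)"
  shows "((\<lambda>h. (1 / h\<^sup>2) *\<^sub>R (F (t + h) + F (t - h) - 2 *\<^sub>R F t)) \<longlongrightarrow> K) (at 0)"
proof (rule LIM_I)
  fix e :: real assume e: "e > 0"
  have "(Q has_derivative (\<lambda>h. h *\<^sub>R K)) (at t)"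
    using Q by (simp add: has_vector_derivative_def)
  then have "\<forall>\<epsilon>>0. \<exists>d>0. \<forall>y. norm (y - t) < d \<longrightarrow>
      norm (Q y - Q t - (y - t) *\<^sub>R K) \<le> \<epsilon> * norm (y - t)"
    unfolding has_derivative_at_alt by (rule conjunct2)
  moreover have "e / 4 > 0" using e by simp
  ultimately obtain d where d: "d > 0"
    "\<And>y. norm (y - t) < d \<Longrightarrow> norm (Q y - Q t - (y - t) *\<^sub>R K) \<le> e / 4 * norm (y - t)"
    by meson
  have main: "norm ((1 / h\<^sup>2) *\<^sub>R (F (t + h) + F (t - h) - 2 *\<^sub>R F t) - K) < e"
    if h: "0 < h" "h < d" for h
  proof -
    \<comment> \<open>Only differentiability of \<open>Q\<close> at the single point
      \<open>t\<close> is available. The derivative of \<open>G\<close> is a difference of two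
      first-order remainders of \<open>Q\<close> at \<open>t\<close>, hence at most
      \<open>e / 2 * h\<close> on \<open>{0..h}\<close>; the mean value inequality gains the second
      factor \<open>h\<close>.\<close>
    define G where "G s = F (t + s) + F (t - s) - s\<^sup>2 *\<^sub>R K" for s
    have shift: "((\<lambda>s. F (t + s)) has_vector_derivative Q (t + s)) (at s)"
      "((\<lambda>s. F (t - s)) has_vector_derivative - Q (t - s)) (at s)" for s
      by (rule has_vector_derivative_shift_reflect[OF F])+
    have G': "(G has_vector_derivative (Q (t + s) - Q (t - s) - (2 * s) *\<^sub>R K)) (at s within {0..h})" for s
      unfolding G_def
      by (rule derivative_eq_intros has_vector_derivative_at_within[OF shift(1)]
        has_vector_derivative_at_within[OF shift(2)] refl | simp)+
    have G_le: "norm (G h - G 0) \<le> (e / 2 * h) * norm (h - 0)"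
    proof (rule differentiable_bound[of "{0..h}" _
          "\<lambda>s u. u *\<^sub>R (Q (t + s) - Q (t - s) - (2 * s) *\<^sub>R K)"])
      fix s assume s: "s \<in> {0..h}"
      show "(G has_derivative (\<lambda>u. u *\<^sub>R (Q (t + s) - Q (t - s) - (2 * s) *\<^sub>R K))) (at s within {0..h})"
        using G'[of s] by (simp add: has_vector_derivative_def)
      have "norm (Q (t + s) - Q (t - s) - (2 * s) *\<^sub>R K)
          = norm ((Q (t + s) - Q t - s *\<^sub>R K) - (Q (t - s) - Q t - (- s) *\<^sub>R K))"
        using scaleR_left_distrib[of s s K] by (simp add: mult_2 algebra_simps)
      also have "\<dots> \<le> e / 4 * s + e / 4 * s"
        using d(2)[of "t + s"] d(2)[of "t - s"] s h
          norm_triangle_ineq4[of "Q (t + s) - Q t - s *\<^sub>R K" "Q (t - s) - Q t - (- s) *\<^sub>R K"]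
        by simp
      also have "\<dots> \<le> e / 2 * h"
        using s e by (simp add: field_simps)
      finally show "onorm (\<lambda>u. u *\<^sub>R (Q (t + s) - Q (t - s) - (2 * s) *\<^sub>R K)) \<le> e / 2 * h"
        by (simp add: onorm_scaleR_left[OF bounded_linear_ident] onorm_id)
    qed (use h in auto)
    define X where "X = F (t + h) + F (t - h) - 2 *\<^sub>R F t - h\<^sup>2 *\<^sub>R K"
    have "G h - G 0 = X"
      by (simp add: G_def X_def scaleR_2)
    with G_le have "norm X \<le> e / 2 * h\<^sup>2"
      using h by (simp add: power2_eq_square mult.assoc)
    then have "norm ((1 / h\<^sup>2) *\<^sub>R X) \<le> e / 2"
      using h by (simp add: divide_simps mult.commute)
    moreover have "(1 / h\<^sup>2) *\<^sub>R (F (t + h) + F (t - h) - 2 *\<^sub>R F t) - K = (1 / h\<^sup>2) *\<^sub>R X"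
      using h by (simp add: X_def scaleR_right_diff_distrib)
    ultimately have "norm ((1 / h\<^sup>2) *\<^sub>R (F (t + h) + F (t - h) - 2 *\<^sub>R F t) - K) \<le> e / 2"
      by (simp only:)
    then show ?thesis using e by linarith
  qed
  show "\<exists>s>0. \<forall>h. h \<noteq> 0 \<and> norm (h - 0) < s \<longrightarrow>
      norm ((1 / h\<^sup>2) *\<^sub>R (F (t + h) + F (t - h) - 2 *\<^sub>R F t) - K) < e"
  proof (intro exI[of _ d] conjI allI impI d(1))
    fix h :: real assume h: "h \<noteq> 0 \<and> norm (h - 0) < d"
    show "norm ((1 / h\<^sup>2) *\<^sub>R (F (t + h) + F (t - h) - 2 *\<^sub>R F t) - K) < e"
      using main[of h] main[of "- h"] h by (cases "h > 0") (auto simp: add.commute)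
  qed
qed

text \<open>Schwarz's theorem on generalised second derivatives, in the only case needed: adding
  \<open>\<epsilon> s\<^sup>2\<close> makes the second difference strictly positive, which excludes an interior maximum.\<close>

lemma zero_second_difference_le:
  fixes D :: "real \<Rightarrow> real"
  assumes cont: "continuous_on UNIV D" and even: "\<And>t. D (- t) = D t"
    and lim: "\<And>t. ((\<lambda>h. (D (t + h) + D (t - h) - 2 * D t) / h\<^sup>2) \<longlongrightarrow> 0) (at 0)"
    and b: "b > 0"
  shows "D 0 \<le> D b"
proof (rule ccontr)
  assume "\<not> D 0 \<le> D b"
  define \<epsilon> where "\<epsilon> = (D 0 - D b) / (2 * b\<^sup>2)"
  have \<epsilon>: "\<epsilon> > 0" using \<open>\<not> D 0 \<le> D b\<close> b by (simp add: \<epsilon>_def)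
  define E where "E s = D s + \<epsilon> * s\<^sup>2" for s
  have "\<epsilon> * b\<^sup>2 = (D 0 - D b) / 2" using b by (simp add: \<epsilon>_def)
  then have E0: "E b < E 0" "E (- b) < E 0"
    using \<open>\<not> D 0 \<le> D b\<close> by (simp_all add: E_def even)
  have "continuous_on {-b..b} E"
    unfolding E_def by (intro continuous_intros continuous_on_subset[OF cont]) auto
  then obtain m where m: "m \<in> {-b..b}" "\<And>s. s \<in> {-b..b} \<Longrightarrow> E s \<le> E m"
    using continuous_attains_sup[of "{-b..b}" E] b by auto
  have "m \<noteq> b" "m \<noteq> - b"
    using m(2)[of 0] E0 b by auto
  with m(1) have m': "-b < m" "m < b" by auto
  have "((\<lambda>h. (D (m + h) + D (m - h) - 2 * D m) / h\<^sup>2 + 2 * \<epsilon>) \<longlongrightarrow> 0 + 2 * \<epsilon>) (at 0)"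
    by (intro tendsto_intros lim)
  moreover have "\<forall>\<^sub>F h in at 0. (D (m + h) + D (m - h) - 2 * D m) / h\<^sup>2 + 2 * \<epsilon> \<le> 0"
  proof -
    have "\<forall>\<^sub>F h in at 0. \<bar>h\<bar> < min (m + b) (b - m)"
      using m' by (intro eventually_at[THEN iffD2] exI[of _ "min (m + b) (b - m)"]) (auto simp: dist_real_def)
    moreover have "\<forall>\<^sub>F h in at 0. h \<noteq> (0::real)"
      by (simp add: eventually_at_filter)
    ultimately show ?thesis
    proof eventually_elim
      case (elim h)
      then have "E (m + h) \<le> E m" "E (m - h) \<le> E m"
        by (auto intro!: m(2) simp: abs_if split: if_splits)
      then have "(D (m + h) + D (m - h) - 2 * D m) + 2 * \<epsilon> * h\<^sup>2 \<le> 0"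
        by (simp add: E_def power2_eq_square algebra_simps)
      then have "((D (m + h) + D (m - h) - 2 * D m) + 2 * \<epsilon> * h\<^sup>2) / h\<^sup>2 \<le> 0"
        by (simp add: divide_le_0_iff)
      then show ?case using elim by (simp add: add_divide_distrib)
    qed
  qed
  ultimately have "0 + 2 * \<epsilon> \<le> 0"
    by (rule tendsto_upperbound) simp
  then show False using \<epsilon> by simp
qed

text \<open>Vanishing second differences force an affine function, and evenness removes the linear
  part. The one-sided inequality is applied to \<open>D\<close> and to \<open>- D\<close>.\<close>

lemma zero_second_difference:
  fixes D :: "real \<Rightarrow> real"
  assumes cont: "continuous_on UNIV D" and even: "\<And>t. D (- t) = D t"
    and lim: "\<And>t. ((\<lambda>h. (D (t + h) + D (t - h) - 2 * D t) / h\<^sup>2) \<longlongrightarrow> 0) (at 0)"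
  shows "D b = D 0"
proof -
  have "D b = D 0" if "b > 0" for b
  proof -
    have "((\<lambda>h. (- D (t + h) + - D (t - h) - 2 * (- D t)) / h\<^sup>2) \<longlongrightarrow> 0) (at 0)" for t
    proof -
      have "(- D (t + h) + - D (t - h) - 2 * (- D t)) / h\<^sup>2 = - ((D (t + h) + D (t - h) - 2 * D t) / h\<^sup>2)" for h
        by (simp add: divide_simps)
      then show ?thesis
        using tendsto_minus[OF lim[of t]] by simp
    qed
    then have "- D 0 \<le> - D b"
      by (intro zero_second_difference_le that continuous_on_minus cont) (simp_all add: even)
    with zero_second_difference_le[OF assms that] show ?thesis by simp
  qed
  from this[of b] this[of "- b"] show ?thesis
    by (cases b "0 :: real" rule: linorder_cases) (auto simp: even)
qed

lemma even_second_antiderivative: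
  fixes F Q K :: "real \<Rightarrow> 'a::real_normed_vector"
  assumes "\<And>t. (F has_vector_derivative Q t) (at t)" "\<And>t. (Q has_vector_derivative K t) (at t)"
    "F 0 = 0" "Q 0 = 0" "\<And>t. K (- t) = K t"
  shows "F (- t) = F t" "Q (- t) = - Q t"
proof -
  note d = has_vector_derivative_shift_reflect(5)[OF assms(1)] has_vector_derivative_shift_reflect(5)[OF assms(2)]
  have "F t - F (- t) = 0" for t
  proof (rule zero_second_derivative[of "\<lambda>t. F t - F (- t)" "\<lambda>t. Q t + Q (- t)"])
    show "((\<lambda>t. F t - F (- t)) has_vector_derivative (Q t + Q (- t))) (at t)" for t
      by (rule derivative_eq_intros assms(1) d refl | simp)+
    show "((\<lambda>t. Q t + Q (- t)) has_vector_derivative 0) (at t)" for t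
      by (rule derivative_eq_intros assms(2) d refl | simp add: assms(5))+
  qed (simp_all add: assms)
  then show "F (- t) = F t" by simp
  have "Q t + Q (- t) = Q 0 + Q (- 0)"
  proof (rule zero_vector_derivative_imp_const)
    show "((\<lambda>t. Q t + Q (- t)) has_vector_derivative 0) (at t)" for t
      by (rule derivative_eq_intros assms(2) d refl | simp add: assms(5))+
  qed
  then show "Q (- t) = - Q t" using assms(4) by (simp add: eq_neg_iff_add_eq_0 add.commute)
qed

section \<open>Dissipativity and the maximum principle\<close>

text \<open>The slack \<open>e * h\<close> allows continuation: the last point of
  \<open>{0..t}\<close> where \<open>N s - e * s \<le> N 0\<close> holds can be passed to the right
  unless it is \<open>t\<close> itself. Then \<open>e\<close> is made small.\<close>

lemma dini_decreasing:
  fixes N :: "real \<Rightarrow> real"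
  assumes cont: "continuous_on {0..} N" and t: "0 \<le> t"
    and dini: "\<And>t e. 0 \<le> t \<Longrightarrow> 0 < e \<Longrightarrow> \<forall>\<^sub>F h in at_right 0. N (t + h) \<le> N t + e * h"
  shows "N t \<le> N 0"
proof (rule field_le_epsilon)
  fix d :: real assume "d > 0"
  define e where "e = d / (t + 1)"
  have e: "e > 0" using \<open>d > 0\<close> t by (simp add: e_def)
  have "e * t \<le> d" using \<open>d > 0\<close> t by (simp add: e_def field_simps)
  define S where "S = {0..t} \<inter> {s. N s - e * s \<le> N 0}"
  have "continuous_on {0..t} (\<lambda>s. N s - e * s)"
    by (intro continuous_intros continuous_on_subset[OF cont]) auto
  then have "closed ({0..t} \<inter> (\<lambda>s. N s - e * s) -` {..N 0})"
    by (intro continuous_closed_preimage) auto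
  then have "compact S"
    unfolding S_def by (auto simp: vimage_def compact_eq_bounded_closed intro: bounded_subset[OF bounded_closed_interval[of 0 t]])
  moreover have "0 \<in> S" using t by (simp add: S_def)
  ultimately obtain s where s: "s \<in> S" "\<And>r. r \<in> S \<Longrightarrow> r \<le> s"
    using compact_attains_sup[of S] by auto
  have "s = t"
  proof (rule ccontr)
    assume "s \<noteq> t"
    then have st: "0 \<le> s" "s < t" using s(1) by (auto simp: S_def)
    have "\<forall>\<^sub>F h in at_right 0. 0 < h \<and> h < t - s"
      using st by (auto simp: eventually_at_right[of 0 "t - s"] intro!: exI[of _ "t - s"])
    then have "\<forall>\<^sub>F h in at_right 0. N (s + h) \<le> N s + e * h \<and> 0 < h \<and> h < t - s"
      using dini[OF st(1) e] by eventually_elim auto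
    then obtain h where h: "N (s + h) \<le> N s + e * h" "0 < h" "h < t - s"
      using eventually_at_right_0_ex by blast
    then have "s + h \<in> S" using s(1) st by (auto simp: S_def algebra_simps)
    with s(2)[of "s + h"] h(2) show False by simp
  qed
  with s(1) have "N t \<le> N 0 + e * t" by (simp add: S_def)
  with \<open>e * t \<le> d\<close> show "N t \<le> N 0 + d" by simp
qed

text \<open>Dissipativity is used at time \<open>t + h\<close>, so that \<open>u(t) = u(t+h) - h B(t+h) + o(h)\<close> already
  bounds the norm of \<open>u(t+h)\<close>; only right-hand derivatives are needed.\<close>

lemma dissipative_norm_bound:
  fixes u B :: "real \<Rightarrow> 'a::real_normed_vector"
  assumes u: "continuous_on {0..} u" and B: "continuous_on {0..} B"
    and deriv: "\<And>t. 0 \<le> t \<Longrightarrow> ((\<lambda>h. (1 / h) *\<^sub>R (u (t + h) - u t)) \<longlongrightarrow> B t) (at_right 0)"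
    and diss: "\<And>t s. 0 < t \<Longrightarrow> 0 < s \<Longrightarrow> norm (u t) > c \<Longrightarrow> norm (u t) \<le> norm (u t - s *\<^sub>R B t)"
    and t: "0 \<le> t"
  shows "norm (u t) \<le> max (norm (u 0)) c"
proof -
  \<comment> \<open>Truncation at \<open>c\<close> matches the hypothesis, which gives dissipativity
    only where the norm exceeds \<open>c\<close>; elsewhere \<open>N\<close> is at its
    floor.\<close>
  define N where "N t = max (norm (u t)) c" for t
  have "N t \<le> N 0"
  proof (rule dini_decreasing[OF _ t])
    show "continuous_on {0..} N"
      unfolding N_def by (intro continuous_intros u)
  next
    fix t e :: real assume t: "0 \<le> t" and e: "0 < e"
    have "\<forall>\<^sub>F h in at_right 0. dist ((1 / h) *\<^sub>R (u (t + h) - u t)) (B t) < e / 2"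
      using e by (intro tendstoD[OF deriv[OF t]]) auto
    moreover have "((\<lambda>h. B (t + h)) \<longlongrightarrow> B (t + 0)) (at_right 0)"
    proof (rule continuous_on_tendsto_compose[OF B])
      show "((\<lambda>h. t + h) \<longlongrightarrow> t + 0) (at_right 0)" by (intro tendsto_intros)
      show "\<forall>\<^sub>F h in at_right 0. t + h \<in> {0..}"
        using t by (auto simp: eventually_at_right[of 0 1] intro!: exI[of _ 1])
    qed (use t in auto)
    then have "\<forall>\<^sub>F h in at_right 0. dist (B (t + h)) (B t) < e / 2"
      using e by (intro tendstoD) auto
    moreover have "\<forall>\<^sub>F h::real in at_right 0. 0 < h"
      by (simp add: eventually_at_right_less)
    ultimately show "\<forall>\<^sub>F h in at_right 0. N (t + h) \<le> N t + e * h"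
    proof eventually_elim
      case (elim h)
      define X Y where "X = (1 / h) *\<^sub>R (u (t + h) - u t) - B t" and "Y = B (t + h) - B t"
      have "norm (u (t + h)) \<le> N t + e * h" if "norm (u (t + h)) > c"
      proof -
        have "norm (u (t + h)) \<le> norm (u (t + h) - h *\<^sub>R B (t + h))"
          using elim(3) t that by (intro diss) auto
        also have "u (t + h) - h *\<^sub>R B (t + h) = u t + h *\<^sub>R (X - Y)"
          using elim(3) by (simp add: X_def Y_def scaleR_right_diff_distrib)
        also have "norm \<dots> \<le> norm (u t) + norm (h *\<^sub>R (X - Y))"
          by (rule norm_triangle_ineq)
        also have "norm (h *\<^sub>R (X - Y)) \<le> h * e"
          using norm_triangle_ineq4[of X Y] elim by (simp add: X_def Y_def dist_norm)
        finally show ?thesis by (simp add: N_def max_def mult.commute split: if_splits)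
      qed
      moreover have "c \<le> N t + e * h"
        using elim(3) e by (simp add: N_def add_increasing2)
      ultimately show ?case unfolding N_def[of "t + h"] by linarith
    qed
  qed
  then show ?thesis by (simp add: N_def)
qed

text \<open>Where \<open>w > B\<close>, the function \<open>w\<close> is strictly convex, so it must decrease there (it is bounded),
  and hence it stays above \<open>B\<close> all the way down to \<open>0\<close>.\<close>

lemma half_line_maximum:
  fixes w p k :: "real \<Rightarrow> real"
  assumes w': "\<And>x. 0 < x \<Longrightarrow> (w has_real_derivative p x) (at x)"
    and p': "\<And>x. 0 < x \<Longrightarrow> (p has_real_derivative k x) (at x)"
    and w_le: "\<And>x. 0 < x \<Longrightarrow> w x \<le> M"
    and w0: "(w \<longlongrightarrow> w0) (at_right 0)" and p0: "(p \<longlongrightarrow> p0) (at_right 0)"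
    and s: "0 < s" and B: "\<And>x. 0 < x \<Longrightarrow> w x - s * k x \<le> B"
    and x: "0 < x" "B < w x"
  shows "p0 < 0" "w x \<le> w0"
proof -
  have k_pos: "k y \<ge> (w y - B) / s" if "0 < y" for y
    using B[OF that] s by (simp add: field_simps)
  have cw: "continuous_on {a..b} w" if "0 < a" for a b
    using that by (intro continuous_at_imp_continuous_on) (auto intro!: DERIV_isCont w')
  have p_neg: "p y < 0" if y: "0 < y" "B < w y" for y
  proof (rule ccontr)
    assume "\<not> p y < 0"
    \<comment> \<open>A level strictly between \<open>B\<close> and \<open>w y\<close> leaves the
      fixed gap \<open>B' - B\<close>, hence a lower bound \<open>c > 0\<close> for \<open>k\<close>
      everywhere to the right of \<open>y\<close>.\<close>
    define B' where "B' = (B + w y) / 2"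
    have B': "B < B'" "B' < w y" using y by (auto simp: B'_def)
    have above: "B' < w z" if z: "y \<le> z" for z
    proof (rule ccontr)
      assume "\<not> B' < w z"
      define S where "S = {y..z} \<inter> w -` {..B'}"
      have "compact S"
        using continuous_closed_preimage[OF cw[OF y(1), of z], of "{..B'}"]
        unfolding S_def compact_eq_bounded_closed
        by (auto intro: bounded_subset[OF bounded_closed_interval[of y z]])
      moreover have "z \<in> S" using \<open>\<not> B' < w z\<close> z by (simp add: S_def)
      ultimately obtain m where m: "m \<in> S" "\<And>r. r \<in> S \<Longrightarrow> m \<le> r"
        using compact_attains_inf[of S] by auto
      have ym: "y < m" using m(1) B'(2) by (auto simp: S_def less_le)
      have gt: "B' < w r" if "y \<le> r" "r < m" for r
        using m(2)[of r] that m(1) by (force simp: S_def)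
      have pr: "0 \<le> p r" if r: "y \<le> r" "r < m" for r
      proof -
        have "p y \<le> p r"
        proof (rule DERIV_nonneg_imp_nondecreasing[OF r(1)])
          fix q assume q: "y \<le> q" "q \<le> r"
          have "0 < (w q - B) / s" using gt[of q] q r B' s by simp
          then have "0 \<le> k q" using k_pos[of q] q y by linarith
          then show "\<exists>d. (p has_real_derivative d) (at q) \<and> 0 \<le> d"
            using p'[of q] q y by auto
        qed
        then show ?thesis using \<open>\<not> p y < 0\<close> by simp
      qed
      obtain r where r: "y < r" "r < m" "w m - w y = (m - y) * p r"
        using MVT2[OF ym, of w p] w' y by auto
      then have "w y \<le> w m"
        using pr[of r] by (smt (verit) mult_nonneg_nonneg)
      with m(1) B' show False by (auto simp: S_def)
    qed
    define c where "c = (B' - B) / s"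
    have c: "c > 0" using B' s by (simp add: c_def)
    have kc: "c \<le> k z" if "y \<le> z" for z
    proof -
      have "c \<le> (w z - B) / s" using above[OF that] s by (simp add: c_def divide_right_mono)
      then show ?thesis using k_pos[of z] that y by linarith
    qed
    have pc: "c \<le> p z" if z: "y + 1 \<le> z" for z
    proof -
      obtain r where r: "y < r" "r < z" "p z - p y = (z - y) * k r"
        using MVT2[of y z p k] p' y z by auto
      have "c * 1 \<le> k r * (z - y)"
        using kc[of r] r z c by (intro mult_mono) auto
      with r(3) \<open>\<not> p y < 0\<close> show ?thesis by (simp add: mult.commute)
    qed
    define z where "z = y + 2 + \<bar>M - w (y + 1)\<bar> / c"
    have z: "y + 1 < z" using c by (simp add: z_def add_pos_nonneg)
    obtain r where r: "y + 1 < r" "r < z" "w z - w (y + 1) = (z - (y + 1)) * p r"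
      using MVT2[OF z, of w p] w' y by auto
    have "(z - (y + 1)) * c \<le> (z - (y + 1)) * p r"
      using pc[of r] r z by (intro mult_left_mono) auto
    moreover have "(z - (y + 1)) * c = c + \<bar>M - w (y + 1)\<bar>"
      using c by (simp add: z_def field_simps)
    ultimately have "w z > M" using r(3) c by linarith
    with w_le[of z] z y show False by simp
  qed
  have ge: "w x \<le> w y" if y: "0 < y" "y < x" for y
  proof -
    obtain m where m: "m \<in> {y..x}" "\<And>r. r \<in> {y..x} \<Longrightarrow> w r \<le> w m"
      using continuous_attains_sup[of "{y..x}" w] cw[OF y(1), of x] y by auto
    have m_pos: "0 < m" and "B < w m"
      using m(1) m(2)[of x] y x by auto
    then obtain d where d: "d > 0" "\<And>h. 0 < h \<Longrightarrow> h < d \<Longrightarrow> w m < w (m - h)"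
      using DERIV_neg_dec_left[OF w'[OF m_pos] p_neg] by auto
    \<comment> \<open>At any maximum point other than the left end the negative slope would produce
      a larger value just to the left.\<close>
    have "m = y"
    proof (rule ccontr)
      assume "m \<noteq> y"
      define h where "h = min (d / 2) (m - y)"
      have "0 < h" "h < d" "m - h \<in> {y..x}"
        using d(1) m(1) \<open>m \<noteq> y\<close> by (auto simp: h_def)
      with d(2)[of h] m(2)[of "m - h"] show False by simp
    qed
    with m(2)[of x] y show ?thesis by simp
  qed
  have pp: "p y \<le> p x" if y: "0 < y" "y < x" for y
  proof (rule DERIV_nonneg_imp_nondecreasing[where f = p])
    fix q assume q: "y \<le> q" "q \<le> x"
    have "w x \<le> w q" using ge[of q] q y by (cases "q = x") auto
    then have "0 \<le> (w q - B) / s" using x s by simp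
    then have "0 \<le> k q" using k_pos[of q] q y by linarith
    then show "\<exists>d. (p has_real_derivative d) (at q) \<and> 0 \<le> d"
      using p'[of q] q y by auto
  qed (use y in auto)
  have near: "\<forall>\<^sub>F y in at_right 0. 0 < y \<and> y < x"
    using x by (auto simp: eventually_at_right[of 0 x] intro!: exI[of _ x])
  have "p0 \<le> p x"
    by (rule tendsto_upperbound[OF p0]) (auto intro: eventually_mono[OF near] pp)
  with p_neg[OF x] show "p0 < 0" by simp
  show "w x \<le> w0"
    by (rule tendsto_lowerbound[OF w0]) (auto intro: eventually_mono[OF near] ge)
qed

section \<open>Cosine families and their generators\<close>

lemma bounded_linear_in_diff:
  assumes "bounded_linear_in X T" "subspace X" "f \<in> X" "g \<in> X"
  shows "T (f - g) = T f - T g"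
proof -
  have "T (f + (- 1) *\<^sub>R g) = T f + T ((- 1) *\<^sub>R g)" "T ((- 1) *\<^sub>R g) = (- 1) *\<^sub>R T g"
    using assms unfolding bounded_linear_in_def subspace_def by blast+
  then show ?thesis by simp
qed

context
  fixes X :: "'a::real_normed_vector set" and C :: "real \<Rightarrow> 'a \<Rightarrow> 'a"
  assumes C: "cosine_family X C" and X: "subspace X"
begin

lemma cosine_family_in: "f \<in> X \<Longrightarrow> C t f \<in> X"
  using C by (simp add: cosine_family_def bounded_linear_in_def)

lemma cosine_family_0: "f \<in> X \<Longrightarrow> C 0 f = f"
  using C by (simp add: cosine_family_def)

lemma cosine_family_add: "f \<in> X \<Longrightarrow> C (t + s) f + C (t - s) f = 2 *\<^sub>R C t (C s f)"
  using C by (simp add: cosine_family_def)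

lemma cosine_family_minus:
  assumes "f \<in> X" shows "C (- t) f = C t f"
  using cosine_family_add[OF assms, of 0 t] cosine_family_0[OF cosine_family_in[OF assms, of t]]
  by (simp add: scaleR_2)

text \<open>By the functional equation, the second difference of the orbit at \<open>t\<close> is
  \<open>C t\<close> applied to the difference quotient at 0, and \<open>C t\<close> is
  bounded.\<close>

lemma cosine_generator_orbit:
  assumes gen: "(f, h) \<in> cosine_generator X C"
  shows "((\<lambda>s. (1 / s\<^sup>2) *\<^sub>R (C (t + s) f + C (t - s) f - 2 *\<^sub>R C t f)) \<longlongrightarrow> C t h) (at 0)"
proof -
  have fh: "f \<in> X" "h \<in> X" and lim: "((\<lambda>s. (2 / s\<^sup>2) *\<^sub>R (C s f - f)) \<longlongrightarrow> h) (at 0)"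
    using gen by (auto simp: cosine_generator_def)
  have bl: "bounded_linear_in X (C t)" using C by (simp add: cosine_family_def)
  then obtain M where M: "\<And>g. g \<in> X \<Longrightarrow> norm (C t g) \<le> M * norm g"
    unfolding bounded_linear_in_def by blast
  have mem: "(2 / s\<^sup>2) *\<^sub>R (C s f - f) \<in> X" for s
    using X fh cosine_family_in by (simp add: subspace_scale subspace_diff)
  have eq: "(1 / s\<^sup>2) *\<^sub>R (C (t + s) f + C (t - s) f - 2 *\<^sub>R C t f)
      = C t ((2 / s\<^sup>2) *\<^sub>R (C s f - f))" for s
  proof -
    have "C t ((2 / s\<^sup>2) *\<^sub>R (C s f - f)) = (2 / s\<^sup>2) *\<^sub>R (C t (C s f) - C t f)"
      using bl X fh cosine_family_in bounded_linear_in_diff[OF bl X, of "C s f" f]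
      unfolding bounded_linear_in_def by (simp add: subspace_diff)
    then show ?thesis
      using cosine_family_add[OF fh(1), of t s] by (simp add: scaleR_right_diff_distrib)
  qed
  have "((\<lambda>s. C t ((2 / s\<^sup>2) *\<^sub>R (C s f - f)) - C t h) \<longlongrightarrow> 0) (at 0)"
  proof (rule Lim_null_comparison)
    show "\<forall>\<^sub>F s in at 0. norm (C t ((2 / s\<^sup>2) *\<^sub>R (C s f - f)) - C t h)
        \<le> M * norm ((2 / s\<^sup>2) *\<^sub>R (C s f - f) - h)"
      using M mem fh X bounded_linear_in_diff[OF bl X mem fh(2)]
      by (intro always_eventually allI) (metis subspace_diff)
    show "((\<lambda>s. M * norm ((2 / s\<^sup>2) *\<^sub>R (C s f - f) - h)) \<longlongrightarrow> 0) (at 0)"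
      using tendsto_mult_right_zero[OF tendsto_norm_zero[OF LIM_zero[OF lim]], of M] by simp
  qed
  then show ?thesis
    unfolding eq by (rule LIM_zero_cancel)
qed

text \<open>The same second difference, read with \<open>s\<close> and \<open>t\<close>
  interchanged, is the difference quotient of \<open>C t f\<close> at 0.\<close>

lemma cosine_generator_invariant:
  assumes gen: "(f, h) \<in> cosine_generator X C"
  shows "(C t f, C t h) \<in> cosine_generator X C"
proof -
  have fh: "f \<in> X" "h \<in> X" using gen by (auto simp: cosine_generator_def)
  have "(1 / s\<^sup>2) *\<^sub>R (C (t + s) f + C (t - s) f - 2 *\<^sub>R C t f) = (2 / s\<^sup>2) *\<^sub>R (C s (C t f) - C t f)" for s
    using cosine_family_add[OF fh(1), of s t] cosine_family_minus[OF fh(1), of "t - s"]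
    by (simp add: add.commute scaleR_right_diff_distrib)
  with cosine_generator_orbit[OF gen, of t] show ?thesis
    using fh by (simp add: cosine_generator_def cosine_family_in)
qed

end

text \<open>The domain of the generator contains \<open>F r\<close>, where \<open>F\<close> is the second antiderivative of the orbit
  of \<open>f\<close>. The projection \<open>\<pi>\<close> extends the operators from \<open>X\<close> to the whole space.\<close>

lemma cosine_generator_dense:
  fixes X :: "'a::banach set"
  assumes C: "cosine_family X C" and X: "subspace X"
    and \<pi>: "bounded_linear \<pi>" "\<And>f. \<pi> f \<in> X" "\<And>f. f \<in> X \<Longrightarrow> \<pi> f = f"
    and f: "f \<in> X" and e: "e > 0"
  shows "\<exists>g h. (g, h) \<in> cosine_generator X C \<and> norm (g - f) < e"
proof -
  define c where "c t = C t f" for t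
  define Q where "Q = antideriv c"
  define F where "F = antideriv Q"
  have cc: "continuous_on UNIV c" using C f by (simp add: cosine_family_def c_def)
  have Q': "(Q has_vector_derivative c t) (at t)" for t
    unfolding Q_def by (rule has_vector_derivative_antideriv[OF cc])
  have "continuous_on UNIV Q"
    using has_vector_derivative_continuous[OF Q'] by (simp add: continuous_on_eq_continuous_at)
  then have F': "(F has_vector_derivative Q t) (at t)" for t
    unfolding F_def by (rule has_vector_derivative_antideriv)
  have 0: "F 0 = 0" "Q 0 = 0" by (simp_all add: F_def Q_def)
  have even: "F (- t) = F t" "Q (- t) = - Q t" for t
    using even_second_antiderivative[OF F' Q' 0] cosine_family_minus[OF C X f] by (simp_all add: c_def)
  have cX: "c t \<in> X" for t using cosine_family_in[OF C X f] by (simp add: c_def)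
  \<comment> \<open>The orbit lies in \<open>X\<close> and is fixed by \<open>\<pi>\<close>, so the
    defect of its second antiderivative has second derivative 0.\<close>
  have "\<pi> (F t) - F t = 0" for t
  proof (rule zero_second_derivative[of "\<lambda>t. \<pi> (F t) - F t" "\<lambda>t. \<pi> (Q t) - Q t"])
    show "((\<lambda>t. \<pi> (F t) - F t) has_vector_derivative \<pi> (Q t) - Q t) (at t)" for t
      by (intro has_vector_derivative_diff bounded_linear.has_vector_derivative[OF \<pi>(1)] F')
    have "((\<lambda>t. \<pi> (Q t) - Q t) has_vector_derivative \<pi> (c t) - c t) (at t)" for t
      by (intro has_vector_derivative_diff bounded_linear.has_vector_derivative[OF \<pi>(1)] Q')
    then show "((\<lambda>t. \<pi> (Q t) - Q t) has_vector_derivative 0) (at t)" for t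
      using \<pi>(3)[OF cX] by simp
  qed (simp_all add: 0 linear_0 bounded_linear.linear[OF \<pi>(1)])
  then have FX: "F t \<in> X" for t using \<pi>(2)[of "F t"] by simp
  \<comment> \<open>The identity \<open>2 C t (c r) = c (r + t) + c (r - t)\<close>, integrated
    twice in \<open>r\<close>; the term \<open>- F t\<close> restores the value 0 at
    \<open>r = 0\<close>.\<close>
  have shift: "C t (F r) = (1 / 2) *\<^sub>R (F (r + t) + F (r - t)) - F t" for t r
  proof -
    have bl: "bounded_linear_in X (C t)" using C by (simp add: cosine_family_def)
    then obtain M where M: "\<And>g. g \<in> X \<Longrightarrow> norm (C t g) \<le> M * norm g"
      unfolding bounded_linear_in_def by blast
    have L: "bounded_linear (\<lambda>g. C t (\<pi> g))"
    proof -
      obtain K where K: "\<And>g. norm (\<pi> g) \<le> norm g * K"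
        using bounded_linear.bounded[OF \<pi>(1)] by blast
      show ?thesis
      proof (rule bounded_linear_intro[where K = "\<bar>M\<bar> * K"])
        show "C t (\<pi> (x + y)) = C t (\<pi> x) + C t (\<pi> y)"
          "C t (\<pi> (a *\<^sub>R x)) = a *\<^sub>R C t (\<pi> x)" for x y a
          using bl \<pi>(2) linear_add[OF bounded_linear.linear[OF \<pi>(1)]]
            linear_scale[OF bounded_linear.linear[OF \<pi>(1)]]
          unfolding bounded_linear_in_def by auto
        show "norm (C t (\<pi> x)) \<le> norm x * (\<bar>M\<bar> * K)" for x
        proof -
          have "norm (C t (\<pi> x)) \<le> \<bar>M\<bar> * norm (\<pi> x)"
            using M[OF \<pi>(2)] by (meson abs_ge_self mult_right_mono norm_ge_zero order_trans)
          also have "\<dots> \<le> \<bar>M\<bar> * (norm x * K)"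
            by (intro mult_left_mono K) simp
          finally show ?thesis by (simp add: mult_ac)
        qed
      qed
    qed
    define W V where "W r = C t (\<pi> (F r)) - ((1 / 2) *\<^sub>R (F (r + t) + F (r - t)) - F t)"
      and "V r = C t (\<pi> (Q r)) - (1 / 2) *\<^sub>R (Q (r + t) + Q (r - t))" for r
    have "W r = 0"
    proof (rule zero_second_derivative[of W V])
      show "(W has_vector_derivative V r) (at r)" for r
        unfolding W_def V_def
        by (rule derivative_eq_intros bounded_linear.has_vector_derivative[OF L] F'
            has_vector_derivative_shift_reflect[OF F'] refl | simp)+
      have "(V has_vector_derivative C t (\<pi> (c r)) - (1 / 2) *\<^sub>R (c (r + t) + c (r - t))) (at r)" for r
        unfolding V_def
        by (rule derivative_eq_intros bounded_linear.has_vector_derivative[OF L] Q'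
            has_vector_derivative_shift_reflect[OF Q'] refl | simp)+
      moreover have "C t (\<pi> (c r)) - (1 / 2) *\<^sub>R (c (r + t) + c (r - t)) = 0" for r
        using cosine_family_add[OF C X f, of t r] cosine_family_minus[OF C X f, of "t - r"] \<pi>(3)[OF cX, of r]
        by (simp add: c_def add.commute)
      ultimately show "(V has_vector_derivative 0) (at r)" for r by simp
      have L0: "C t (\<pi> 0) = 0" using linear_0[OF bounded_linear.linear[OF L]] .
      show "W 0 = 0" "V 0 = 0"
        by (simp_all add: W_def V_def 0 L0 even flip: scaleR_2)
    qed
    then show ?thesis using \<pi>(3)[OF FX] by (simp add: W_def)
  qed
  \<comment> \<open>By \<open>shift\<close>, the quotient for \<open>F r\<close> is the second
    difference of \<open>F\<close> at \<open>r\<close> minus the one at 0, with limits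
    \<open>c r\<close> and \<open>c 0\<close>. The factor \<open>2 / r\<^sup>2\<close> makes these
    elements tend to \<open>f\<close>.\<close>
  have gen: "((2 / r\<^sup>2) *\<^sub>R F r, (2 / r\<^sup>2) *\<^sub>R (c r - c 0)) \<in> cosine_generator X C" for r
  proof -
    have eq: "(1 / t\<^sup>2) *\<^sub>R (F (r + t) + F (r - t) - 2 *\<^sub>R F r) - (1 / t\<^sup>2) *\<^sub>R (F (0 + t) + F (0 - t) - 2 *\<^sub>R F 0)
        = (2 / t\<^sup>2) *\<^sub>R (C t (F r) - F r)" for t
      unfolding shift by (simp add: 0 even algebra_simps flip: scaleR_2)
    have "((\<lambda>t. (2 / t\<^sup>2) *\<^sub>R (C t (F r) - F r)) \<longlongrightarrow> c r - c 0) (at 0)"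
      unfolding eq[symmetric] by (intro tendsto_diff second_difference_tendsto[OF F' Q'])
    then have "((\<lambda>t. (2 / r\<^sup>2) *\<^sub>R ((2 / t\<^sup>2) *\<^sub>R (C t (F r) - F r))) \<longlongrightarrow> (2 / r\<^sup>2) *\<^sub>R (c r - c 0)) (at 0)"
      by (rule tendsto_scaleR[OF tendsto_const])
    moreover have "C t (a *\<^sub>R F r) = a *\<^sub>R C t (F r)" for t a
      using C FX by (simp add: cosine_family_def bounded_linear_in_def)
    ultimately show ?thesis
      using X FX cX by (auto simp: cosine_generator_def subspace_scale subspace_diff
          scaleR_right_diff_distrib mult.commute)
  qed
  have "((\<lambda>r. (1 / r\<^sup>2) *\<^sub>R (F (0 + r) + F (0 - r) - 2 *\<^sub>R F 0)) \<longlongrightarrow> c 0) (at 0)"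
    by (rule second_difference_tendsto[OF F' Q'])
  then have "((\<lambda>r. (2 / r\<^sup>2) *\<^sub>R F r) \<longlongrightarrow> f) (at 0)"
    using cosine_family_0[OF C X f] by (simp add: 0 even c_def flip: scaleR_2)
  then have "\<forall>\<^sub>F r in at 0. dist ((2 / r\<^sup>2) *\<^sub>R F r) f < e"
    using e by (rule tendstoD)
  then obtain r where "dist ((2 / r\<^sup>2) *\<^sub>R F r) f < e"
    using eventually_happens[of _ "at (0::real)"] by auto
  then show ?thesis using gen[of r] by (auto simp: dist_norm)
qed

text \<open>Subtracting from the orbit of \<open>f\<close> the second antiderivative
  \<open>F\<close> of the orbit of \<open>h\<close> makes the second differences tend to 0; the
  scalar lemma, applied for each \<open>x\<close> separately, then gives
  \<open>C t f = f + F t\<close>.\<close>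

lemma cosine_orbit_smooth:
  fixes X :: "csharp set"
  assumes C: "cosine_family X C" and X: "subspace X" and gen: "(f, h) \<in> cosine_generator X C"
  obtains Q where "Q 0 = 0" "\<And>t. ((\<lambda>t. C t f) has_vector_derivative Q t) (at t)"
    "\<And>t. (Q has_vector_derivative C t h) (at t)"
proof -
  have fh: "f \<in> X" "h \<in> X" using gen by (auto simp: cosine_generator_def)
  have cont: "continuous_on UNIV (\<lambda>t. C t f)" "continuous_on UNIV (\<lambda>t. C t h)"
    using C fh by (simp_all add: cosine_family_def)
  define Q where "Q = antideriv (\<lambda>t. C t h)"
  define F where "F = antideriv Q"
  have Q': "(Q has_vector_derivative C t h) (at t)" for t
    unfolding Q_def by (rule has_vector_derivative_antideriv[OF cont(2)])
  have "continuous_on UNIV Q"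
    using has_vector_derivative_continuous[OF Q'] by (simp add: continuous_on_eq_continuous_at)
  then have F': "(F has_vector_derivative Q t) (at t)" for t
    unfolding F_def by (rule has_vector_derivative_antideriv)
  have 0: "F 0 = 0" "Q 0 = 0" by (simp_all add: F_def Q_def)
  have even: "F (- t) = F t" for t
    using even_second_antiderivative[OF F' Q' 0] cosine_family_minus[OF C X fh(2)] by simp
  have F_cont: "continuous_on UNIV F"
    using has_vector_derivative_continuous[OF F'] by (simp add: continuous_on_eq_continuous_at)
  have eq: "C t f = f + F t" for t
  proof (rule csharp_eqI)
    fix x :: real
    define D where "D s = csharp_fun (C s f - F s) x" for s
    have "D t = D 0"
    proof (rule zero_second_difference)
      show "continuous_on UNIV D"
        unfolding D_def
        by (intro continuous_on_compose2[OF linear_continuous_on[OF bounded_linear_csharp_fun]]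
            continuous_on_diff cont F_cont) auto
      show "D (- s) = D s" for s
        using cosine_family_minus[OF C X fh(1)] by (simp add: D_def even)
      fix s
      have "((\<lambda>u. (1 / u\<^sup>2) *\<^sub>R (C (s + u) f + C (s - u) f - 2 *\<^sub>R C s f)
          - (1 / u\<^sup>2) *\<^sub>R (F (s + u) + F (s - u) - 2 *\<^sub>R F s)) \<longlongrightarrow> C s h - C s h) (at 0)"
        by (intro tendsto_diff cosine_generator_orbit[OF C X gen] second_difference_tendsto[OF F' Q'])
      from bounded_linear.tendsto[OF bounded_linear_csharp_fun this, of x]
      show "((\<lambda>u. (D (s + u) + D (s - u) - 2 * D s) / u\<^sup>2) \<longlongrightarrow> 0) (at 0)"
        by (simp add: D_def diff_divide_distrib add_divide_distrib algebra_simps)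
    qed
    then show "csharp_fun (C t f) x = csharp_fun (f + F t) x"
      using cosine_family_0[OF C X fh(1)] by (simp add: D_def 0)
  qed
  have "((\<lambda>t. f + F t) has_vector_derivative Q t) (at t)" for t
    by (auto intro!: derivative_eq_intros F')
  with 0 Q' show thesis
    by (intro that[of Q]) (simp_all add: eq[abs_def])
qed

section \<open>D'Alembert's formula on the half-line\<close>

text \<open>Interpolation: some point of the interval from \<open>x\<close> to \<open>x + 1\<close>
  has slope \<open>w (x + 1) - w x\<close>, and the slope changes by at most \<open>b\<close> on the
  way back to \<open>x\<close>.\<close>

lemma derivative_bound_half_line:
  fixes w p k :: "real \<Rightarrow> real"
  assumes w': "\<And>y. 0 < y \<Longrightarrow> (w has_real_derivative p y) (at y)"
    and p': "\<And>y. 0 < y \<Longrightarrow> (p has_real_derivative k y) (at y)"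
    and a: "\<And>y. 0 < y \<Longrightarrow> \<bar>w y\<bar> \<le> a" and b: "\<And>y. 0 < y \<Longrightarrow> \<bar>k y\<bar> \<le> b" and x: "0 < x"
  shows "\<bar>p x\<bar> \<le> 2 * a + b"
proof -
  obtain \<xi> where \<xi>: "x < \<xi>" "\<xi> < x + 1" "w (x + 1) - w x = p \<xi>"
    using MVT2[of x "x + 1" w p] w' x by auto
  obtain \<eta> where \<eta>: "x < \<eta>" "\<eta> < \<xi>" "p \<xi> - p x = (\<xi> - x) * k \<eta>"
    using MVT2[of x \<xi> p k] p' x \<xi> by auto
  have "\<bar>(\<xi> - x) * k \<eta>\<bar> \<le> 1 * b"
    unfolding abs_mult using \<xi> \<eta> x b[of \<eta>] by (intro mult_mono) auto
  then show ?thesis using \<xi>(3) \<eta>(3) a[of x] a[of "x + 1"] x by linarith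
qed

text \<open>The first derivative is a plain function, not an element of \<open>csharp\<close>: for
  \<open>A_skew\<close> it is given by separate functions on the two half-lines.\<close>

definition derivs :: "csharp \<Rightarrow> (real \<Rightarrow> real) \<Rightarrow> csharp \<Rightarrow> bool" where
  "derivs f g h \<longleftrightarrow> (\<forall>x. x \<noteq> 0 \<longrightarrow>
     (csharp_fun f has_real_derivative g x) (at x) \<and> (g has_real_derivative csharp_fun h x) (at x))"

lemma derivsD:
  assumes "derivs f g h" "x \<noteq> 0"
  shows "(csharp_fun f has_real_derivative g x) (at x)" "(g has_real_derivative csharp_fun h x) (at x)"
  using assms by (simp_all add: derivs_def)

lemma A_op_iff:
  "(f, h) \<in> A_op \<alpha> \<beta> \<longleftrightarrow> (\<exists>g. derivs f (csharp_fun g) h \<and>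
     at0_minus g = \<alpha> * (at0_plus f - at0_minus f) \<and> at0_plus g = \<beta> * (at0_plus f - at0_minus f))"
  by (auto simp: A_op_def derivs_def)

lemma derivs_reflect:
  assumes "derivs f g h"
  shows "derivs (reflect f) (\<lambda>x. - g (- x)) (reflect h)"
  unfolding derivs_def
proof (intro allI impI conjI)
  fix x :: real assume x: "x \<noteq> 0"
  show "(csharp_fun (reflect f) has_real_derivative - g (- x)) (at x)"
    using DERIV_mirror[THEN iffD1, OF derivsD(1)[OF assms]] x by (simp add: csharp_fun_reflect[abs_def])
  show "((\<lambda>x. - g (- x)) has_real_derivative csharp_fun (reflect h) x) (at x)"
    using DERIV_minus[OF DERIV_mirror[THEN iffD1, OF derivsD(2)[OF assms]]] x by simp
qed

lemma derivs_lincomb: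
  assumes "derivs f1 g1 h1" "derivs f2 g2 h2"
  shows "derivs (a *\<^sub>R f1 + b *\<^sub>R f2) (\<lambda>x. a * g1 x + b * g2 x) (a *\<^sub>R h1 + b *\<^sub>R h2)"
proof -
  have "csharp_fun (a *\<^sub>R u + b *\<^sub>R v) = (\<lambda>x. a * csharp_fun u x + b * csharp_fun v x)" for u v by auto
  then show ?thesis
    using assms unfolding derivs_def by (auto intro!: DERIV_add DERIV_cmult)
qed

lemma derivs_bound:
  assumes "derivs f g h" "x \<noteq> 0"
  shows "\<bar>g x\<bar> \<le> 2 * norm f + norm h"
proof -
  have pos: "\<bar>g x\<bar> \<le> 2 * norm f + norm h" if "derivs f g h" "0 < x" for f g h x
    by (rule derivative_bound_half_line[OF derivsD[OF that(1)] _ _ that(2)]) (auto intro: abs_csharp_fun_le_norm)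
  show ?thesis
    using pos[OF assms(1), of x] pos[OF derivs_reflect[OF assms(1)], of "- x"] assms(2)
    by (cases "0 < x") auto
qed

text \<open>A chain rule along lines without total differentiability: the step in \<open>y\<close>
  is made by the mean value theorem, the step in \<open>s\<close> only along \<open>y = y0\<close>.
  Joint continuity of \<open>Fy\<close> is stated along paths, the form in which it is available for
  curves in \<open>csharp\<close>.\<close>

lemma partial_chain:
  fixes F :: "real \<Rightarrow> real \<Rightarrow> real"
  assumes S: "open S" "y0 \<in> S"
    and Fs: "((\<lambda>s. F s y0) has_real_derivative D) (at s0)"
    and Fy: "\<And>s y. y \<in> S \<Longrightarrow> (F s has_real_derivative Fy s y) (at y)"
    and cont: "\<And>\<sigma> \<eta>. (\<sigma> \<longlongrightarrow> s0) (at 0) \<Longrightarrow> (\<eta> \<longlongrightarrow> y0) (at 0) \<Longrightarrow>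
      ((\<lambda>\<tau>::real. Fy (\<sigma> \<tau>) (\<eta> \<tau>)) \<longlongrightarrow> Fy s0 y0) (at 0)"
  shows "((\<lambda>\<tau>. F (s0 + a * \<tau>) (y0 + b * \<tau>)) has_real_derivative a * D + b * Fy s0 y0) (at 0)"
proof -
  obtain d where d: "d > 0" "ball y0 d \<subseteq> S" using S by (metis open_contains_ball)
  have "\<exists>\<xi>. \<bar>\<xi> - y0\<bar> \<le> \<bar>b * \<tau>\<bar> \<and> (\<bar>b * \<tau>\<bar> < d \<longrightarrow>
      F (s0 + a * \<tau>) (y0 + b * \<tau>) - F (s0 + a * \<tau>) y0 = b * \<tau> * Fy (s0 + a * \<tau>) \<xi>)" for \<tau>
  proof (cases "b * \<tau> \<noteq> 0 \<and> \<bar>b * \<tau>\<bar> < d")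
    case True
    define G where "G = F (s0 + a * \<tau>)"
    have G: "(G has_real_derivative Fy (s0 + a * \<tau>) y) (at y)" if "\<bar>y - y0\<bar> \<le> \<bar>b * \<tau>\<bar>" for y
      using that d True unfolding G_def by (intro Fy) (auto simp: dist_real_def abs_minus_commute subset_iff)
    consider "0 < b * \<tau>" | "b * \<tau> < 0" using True by linarith
    then show ?thesis
    proof cases
      case 1
      then obtain \<xi> where "y0 < \<xi>" "\<xi> < y0 + b * \<tau>"
        "G (y0 + b * \<tau>) - G y0 = (y0 + b * \<tau> - y0) * Fy (s0 + a * \<tau>) \<xi>"
        using MVT2[of y0 "y0 + b * \<tau>" G "Fy (s0 + a * \<tau>)"] G by auto
      then show ?thesis by (intro exI[of _ \<xi>]) (auto simp: G_def)
    next
      case 2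
      then obtain \<xi> where "y0 + b * \<tau> < \<xi>" "\<xi> < y0"
        "G y0 - G (y0 + b * \<tau>) = (y0 - (y0 + b * \<tau>)) * Fy (s0 + a * \<tau>) \<xi>"
        using MVT2[of "y0 + b * \<tau>" y0 G "Fy (s0 + a * \<tau>)"] G by auto
      then show ?thesis by (intro exI[of _ \<xi>]) (auto simp: G_def)
    qed
  qed (auto intro!: exI[of _ y0])
  then obtain \<xi> where \<xi>: "\<And>\<tau>. \<bar>\<xi> \<tau> - y0\<bar> \<le> \<bar>b * \<tau>\<bar>"
    "\<And>\<tau>. \<bar>b * \<tau>\<bar> < d \<Longrightarrow>
      F (s0 + a * \<tau>) (y0 + b * \<tau>) - F (s0 + a * \<tau>) y0 = b * \<tau> * Fy (s0 + a * \<tau>) (\<xi> \<tau>)"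
    by metis
  have lin: "((\<lambda>\<tau>. c * \<tau>) \<longlongrightarrow> 0) (at 0)" for c :: real
    by (rule tendsto_eq_intros refl | simp)+
  have "((\<lambda>\<tau>. \<xi> \<tau> - y0) \<longlongrightarrow> 0) (at 0)"
    by (rule Lim_null_comparison[OF _ tendsto_rabs_zero[OF lin[of b]]]) (simp add: \<xi>(1))
  then have "((\<lambda>\<tau>. Fy (s0 + a * \<tau>) (\<xi> \<tau>)) \<longlongrightarrow> Fy s0 y0) (at 0)"
    by (intro cont) (auto intro!: tendsto_eq_intros dest: LIM_zero_cancel)
  then have 1: "((\<lambda>\<tau>. b * Fy (s0 + a * \<tau>) (\<xi> \<tau>)) \<longlongrightarrow> b * Fy s0 y0) (at 0)"
    by (intro tendsto_intros)
  have "((\<lambda>\<tau>. F (s0 + a * \<tau>) y0) has_real_derivative D * a) (at 0)"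
    by (rule DERIV_chain2[where f = "\<lambda>s. F s y0" and g = "\<lambda>\<tau>. s0 + a * \<tau>"])
      (use Fs in \<open>auto intro!: derivative_eq_intros\<close>)
  then have 2: "((\<lambda>\<tau>. (F (s0 + a * \<tau>) y0 - F s0 y0) / \<tau>) \<longlongrightarrow> D * a) (at 0)"
    by (simp add: DERIV_def)
  have "\<forall>\<^sub>F \<tau> in at 0. dist (b * \<tau>) 0 < d"
    by (intro tendstoD lin d)
  moreover have "\<forall>\<^sub>F \<tau> in at 0. \<tau> \<noteq> (0::real)" by (simp add: eventually_at_filter)
  ultimately have "\<forall>\<^sub>F \<tau> in at 0. b * Fy (s0 + a * \<tau>) (\<xi> \<tau>) + (F (s0 + a * \<tau>) y0 - F s0 y0) / \<tau>
      = (F (s0 + a * \<tau>) (y0 + b * \<tau>) - F s0 y0) / \<tau>"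
  proof eventually_elim
    case (elim \<tau>)
    then have "b * Fy (s0 + a * \<tau>) (\<xi> \<tau>) = (F (s0 + a * \<tau>) (y0 + b * \<tau>) - F (s0 + a * \<tau>) y0) / \<tau>"
      using \<xi>(2)[of \<tau>] by (simp add: dist_real_def)
    then show ?case by (simp flip: add_divide_distrib)
  qed
  from Lim_transform_eventually[OF tendsto_add[OF 1 2] this] show ?thesis
    by (simp add: DERIV_def add.commute mult.commute)
qed

lemma bounded_linear_integral_csharp_fun:
  assumes "0 < a" "a \<le> b"
  shows "bounded_linear (\<lambda>f. integral {a..b} (csharp_fun f))"
proof (rule bounded_linear_intro[where K = "b - a"])
  have cont: "continuous_on {a..b} (csharp_fun f)" for f
    using assms by (intro continuous_on_subset[OF csharp_fun_continuous]) auto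
  then have int: "csharp_fun f integrable_on {a..b}" for f
    by (rule integrable_continuous_real)
  show "integral {a..b} (csharp_fun (f + g)) = integral {a..b} (csharp_fun f) + integral {a..b} (csharp_fun g)" for f g
    using integral_add[OF int int, of f g] by (simp add: csharp_fun_add[abs_def])
  show "integral {a..b} (csharp_fun (c *\<^sub>R f)) = c *\<^sub>R integral {a..b} (csharp_fun f)" for c f
    by (simp add: csharp_fun_scaleR[abs_def])
  show "norm (integral {a..b} (csharp_fun f)) \<le> norm f * (b - a)" for f
    using assms abs_csharp_fun_le_norm by (intro integral_bound cont) auto
qed

lemma tendsto_at_right_eqI:
  fixes f g :: "real \<Rightarrow> real"
  assumes "(f \<longlongrightarrow> a) (at_right 0)" "(g \<longlongrightarrow> b) (at_right 0)" "\<forall>\<^sub>F y in at_right 0. f y = g y"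
  shows "a = b"
  using tendsto_unique[OF _ Lim_transform_eventually[OF assms(1,3)] assms(2)] by simp

text \<open>The conjugate \<open>\<Psi>(t,x) = \<integral>\<^sub>0\<^sup>t u\<^sub>x(s,x) ds\<close> satisfies
  \<open>\<Psi>\<^sub>t = u\<^sub>x\<close> and \<open>\<Psi>\<^sub>x = u\<^sub>t\<close>, so \<open>u + \<Psi>\<close> and \<open>u - \<Psi>\<close> are constant along the two families of
  characteristics. In this way mixed second derivatives of \<open>u\<close> are avoided.\<close>

locale half_line_wave =
  fixes U Q K :: "real \<Rightarrow> csharp" and p :: "real \<Rightarrow> real \<Rightarrow> real" and p0 :: "real \<Rightarrow> real"
  assumes U': "\<And>t. (U has_vector_derivative Q t) (at t)"
    and Q': "\<And>t. (Q has_vector_derivative K t) (at t)" and Q0: "Q 0 = 0"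
    and K_cont: "continuous_on UNIV K"
    and U_x: "\<And>t x. 0 < x \<Longrightarrow> (csharp_fun (U t) has_real_derivative p t x) (at x)"
    and p_x: "\<And>t x. 0 < x \<Longrightarrow> (p t has_real_derivative csharp_fun (K t) x) (at x)"
    and p0: "\<And>t. (p t \<longlongrightarrow> p0 t) (at_right 0)"
begin

lemma tendsto_UQK:
  assumes "(\<sigma> \<longlongrightarrow> t) F"
  shows "((\<lambda>\<tau>. U (\<sigma> \<tau>)) \<longlongrightarrow> U t) F" "((\<lambda>\<tau>. Q (\<sigma> \<tau>)) \<longlongrightarrow> Q t) F" "((\<lambda>\<tau>. K (\<sigma> \<tau>)) \<longlongrightarrow> K t) F"
  using isCont_tendsto_compose[OF has_vector_derivative_continuous[OF U'] assms]
    isCont_tendsto_compose[OF has_vector_derivative_continuous[OF Q'] assms]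
    isCont_tendsto_compose[OF _ assms, of K] K_cont
  by (auto simp: continuous_on_eq_continuous_at)

text \<open>Continuity of the slope in time is not assumed; interpolation derives it from that of
  \<open>U\<close> and \<open>K\<close>. The bound is uniform in \<open>x\<close>, so it passes to
  \<open>p0\<close>.\<close>

lemma p_dist_le:
  assumes "0 < x"
  shows "\<bar>p s x - p t x\<bar> \<le> 2 * norm (U s - U t) + norm (K s - K t)"
proof (rule derivative_bound_half_line[OF _ _ _ _ assms, of "csharp_fun (U s - U t)" "\<lambda>x. p s x - p t x" "csharp_fun (K s - K t)"])
  fix y :: real assume y: "0 < y"
  show "(csharp_fun (U s - U t) has_real_derivative p s y - p t y) (at y)"
    using DERIV_diff[OF U_x[OF y] U_x[OF y]] by (simp add: csharp_fun_diff[abs_def])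
  show "((\<lambda>y. p s y - p t y) has_real_derivative csharp_fun (K s - K t) y) (at y)"
    using DERIV_diff[OF p_x[OF y] p_x[OF y]] by simp
qed (rule abs_csharp_fun_le_norm)+

lemma p0_dist_le: "\<bar>p0 s - p0 t\<bar> \<le> 2 * norm (U s - U t) + norm (K s - K t)"
  by (rule tendsto_upperbound[OF tendsto_rabs[OF tendsto_diff[OF p0 p0]]])
    (auto simp: eventually_at_right[of 0 1] intro!: exI[of _ 1] p_dist_le)

lemma continuous_on_dist_le:
  fixes q :: "real \<Rightarrow> real"
  assumes "\<And>s t. \<bar>q s - q t\<bar> \<le> 2 * norm (U s - U t) + norm (K s - K t)"
  shows "continuous_on UNIV q"
proof -
  have "(q \<longlongrightarrow> q t) (at t)" for t
  proof (rule LIM_zero_cancel, rule Lim_null_comparison)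
    show "\<forall>\<^sub>F s in at t. norm (q s - q t) \<le> 2 * norm (U s - U t) + norm (K s - K t)"
      using assms by simp
    have "((\<lambda>s. 2 * norm (U s - U t) + norm (K s - K t)) \<longlongrightarrow> 2 * norm (U t - U t) + norm (K t - K t)) (at t)"
      by (intro tendsto_intros tendsto_UQK)
    then show "((\<lambda>s. 2 * norm (U s - U t) + norm (K s - K t)) \<longlongrightarrow> 0) (at t)" by simp
  qed
  then show ?thesis by (simp add: continuous_on_def)
qed

text \<open>The trace of \<Psi> at \<open>x = 0\<close>, and the only quantity through which the
  boundary condition enters d'Alembert's formula.\<close>

definition "P0 = antideriv p0"
definition "\<Psi> x = antideriv (\<lambda>t. p t x)"

lemma p0_cont: "continuous_on UNIV p0"
  by (rule continuous_on_dist_le[OF p0_dist_le])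

lemma P0': "(P0 has_real_derivative p0 t) (at t)"
  using has_vector_derivative_antideriv[OF p0_cont]
  by (simp add: P0_def has_real_derivative_iff_has_vector_derivative)

lemma \<Psi>_t: "0 < x \<Longrightarrow> (\<Psi> x has_real_derivative p t x) (at t)"
  using has_vector_derivative_antideriv[OF continuous_on_dist_le[OF p_dist_le]]
  by (simp add: \<Psi>_def has_real_derivative_iff_has_vector_derivative)

lemma \<Psi>_0 [simp]: "\<Psi> x 0 = 0" "P0 0 = 0"
  by (simp_all add: \<Psi>_def P0_def)

text \<open>Both sides vanish at \<open>t = 0\<close> because \<open>Q 0 = 0\<close>, and their time
  derivatives agree since \<open>K t\<close> is the \<open>x\<close>-derivative of
  \<open>p t\<close>. This stands in for an interchange of mixed derivatives.\<close>

lemma \<Psi>_diff: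
  assumes "0 < a" "a \<le> b"
  shows "\<Psi> b t - \<Psi> a t = integral {a..b} (csharp_fun (Q t))"
proof -
  let ?L = "\<lambda>f. integral {a..b} (csharp_fun f)"
  define W where "W t = \<Psi> b t - \<Psi> a t - ?L (Q t)" for t
  note L = bounded_linear_integral_csharp_fun[OF assms]
  have "(W has_vector_derivative 0) (at t)" for t
  proof -
    have "(csharp_fun (K t) has_integral (p t b - p t a)) {a..b}"
      using assms by (intro fundamental_theorem_of_calculus)
        (auto intro!: has_field_derivative_at_within p_x simp flip: has_real_derivative_iff_has_vector_derivative)
    then have "?L (K t) = p t b - p t a" by (rule integral_unique)
    moreover have "(W has_vector_derivative (p t b - p t a - ?L (K t))) (at t)"
      unfolding W_def using assms
      by (intro has_vector_derivative_diff bounded_linear.has_vector_derivative[OF L] Q')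
        (auto intro!: \<Psi>_t simp flip: has_real_derivative_iff_has_vector_derivative)
    ultimately show ?thesis by simp
  qed
  from zero_vector_derivative_imp_const[of W, OF this] show ?thesis
    using linear_0[OF bounded_linear.linear[OF L]] by (simp add: W_def Q0)
qed

lemma \<Psi>_x:
  assumes "0 < x"
  shows "((\<lambda>x. \<Psi> x t) has_real_derivative csharp_fun (Q t) x) (at x)"
proof -
  let ?I = "\<lambda>y. \<Psi> (x / 2) t + integral {x / 2..y} (csharp_fun (Q t))"
  have "((\<lambda>y. integral {x / 2..y} (csharp_fun (Q t))) has_real_derivative csharp_fun (Q t) x)
      (at x within {x / 2..x + 1})"
    using assms by (intro integral_has_real_derivative continuous_on_subset[OF csharp_fun_continuous]) auto
  then have "((\<lambda>y. integral {x / 2..y} (csharp_fun (Q t))) has_real_derivative csharp_fun (Q t) x) (at x)"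
    using assms by (simp add: at_within_Icc_at)
  then have "(?I has_real_derivative csharp_fun (Q t) x) (at x)"
    by (auto intro!: derivative_eq_intros)
  then show ?thesis
    by (rule has_field_derivative_transform_within_open[where S = "{x / 2<..}"])
      (use assms in \<open>auto simp flip: \<Psi>_diff\<close>)
qed

text \<open>The two rates are \<open>Q + b p\<close> and \<open>p + b Q\<close>: their sum cancels
  for \<open>b = - 1\<close>, their difference for \<open>b = 1\<close>.\<close>

lemma characteristic_derivative:
  assumes x: "0 < x0 + b * \<tau>"
  shows "((\<lambda>\<tau>. csharp_fun (U (t0 + \<tau>)) (x0 + b * \<tau>)) has_real_derivative
      csharp_fun (Q (t0 + \<tau>)) (x0 + b * \<tau>) + b * p (t0 + \<tau>) (x0 + b * \<tau>)) (at \<tau>)" (is ?U)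
    and "((\<lambda>\<tau>. \<Psi> (x0 + b * \<tau>) (t0 + \<tau>)) has_real_derivative
      p (t0 + \<tau>) (x0 + b * \<tau>) + b * csharp_fun (Q (t0 + \<tau>)) (x0 + b * \<tau>)) (at \<tau>)" (is ?\<Psi>)
proof -
  let ?t = "t0 + \<tau>" and ?x = "x0 + b * \<tau>"
  have "((\<lambda>r. csharp_fun (U (?t + 1 * r)) (?x + b * r)) has_real_derivative
      b * p ?t ?x + 1 * csharp_fun (Q ?t) ?x) (at 0)"
  \<comment> \<open>Here and for \<Psi> below, the variable moved by the mean value theorem is the
    one whose derivative is \<open>Q\<close>: the joint continuity of \<open>Q\<close> is known.
    Time and space change roles between the two applications.\<close>
  proof (rule partial_chain[where F = "\<lambda>x t. csharp_fun (U t) x" and S = UNIV and Fy = "\<lambda>x t. csharp_fun (Q t) x"])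
    show "((\<lambda>t. csharp_fun (U t) y) has_real_derivative csharp_fun (Q s) y) (at s)" for s y
      using bounded_linear.has_vector_derivative[OF bounded_linear_csharp_fun U']
      by (simp add: has_real_derivative_iff_has_vector_derivative)
  qed (use x in \<open>auto intro!: U_x tendsto_csharp_fun tendsto_UQK\<close>)
  then show ?U
    using DERIV_shift[of "\<lambda>\<tau>. csharp_fun (U (t0 + \<tau>)) (x0 + b * \<tau>)" _ 0 \<tau>]
    by (simp add: algebra_simps)
  have "((\<lambda>r. \<Psi> (?x + b * r) (?t + 1 * r)) has_real_derivative
      1 * p ?t ?x + b * csharp_fun (Q ?t) ?x) (at 0)"
  proof (rule partial_chain[where F = "\<lambda>t x. \<Psi> x t" and S = "{0<..}" and Fy = "\<lambda>t x. csharp_fun (Q t) x"])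
  qed (use x in \<open>auto intro!: \<Psi>_x \<Psi>_t tendsto_csharp_fun tendsto_UQK\<close>)
  then show ?\<Psi>
    using DERIV_shift[of "\<lambda>\<tau>. \<Psi> (x0 + b * \<tau>) (t0 + \<tau>)" _ 0 \<tau>]
    by (simp add: algebra_simps)
qed

text \<open>Followed back in time, this characteristic moves away from the boundary and reaches time
  0 at \<open>x + t\<close>, where \<Psi> vanishes.\<close>

lemma left_characteristic:
  assumes x: "0 < x" and t: "0 \<le> t"
  shows "csharp_fun (U t) x + \<Psi> x t = csharp_fun (U 0) (x + t)"
proof -
  define W where "W \<tau> = csharp_fun (U (0 + \<tau>)) (x + t + (- 1) * \<tau>) + \<Psi> (x + t + (- 1) * \<tau>) (0 + \<tau>)" for \<tau>
  have "(W has_real_derivative 0) (at \<tau> within {..<x + t})" if "\<tau> \<in> {..<x + t}" for \<tau>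
    unfolding W_def
    by (rule has_field_derivative_at_within, rule DERIV_cong[OF DERIV_add[OF characteristic_derivative]])
      (use that in auto)
  then obtain c where "\<And>\<tau>. \<tau> \<in> {..<x + t} \<Longrightarrow> W \<tau> = c"
    using has_field_derivative_zero_constant[of "{..<x + t}" W] by auto
  then have "W t = W 0" using x t by auto
  then show ?thesis by (simp add: W_def)
qed

lemma right_characteristic:
  assumes "0 < x" "0 < x + r"
  shows "csharp_fun (U (t + r)) (x + r) - \<Psi> (x + r) (t + r) = csharp_fun (U t) x - \<Psi> x t"
proof -
  define W where "W \<tau> = csharp_fun (U (t + \<tau>)) (x + 1 * \<tau>) - \<Psi> (x + 1 * \<tau>) (t + \<tau>)" for \<tau>
  have "(W has_real_derivative 0) (at \<tau> within {-x<..})" if "\<tau> \<in> {-x<..}" for \<tau>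
    unfolding W_def
    by (rule has_field_derivative_at_within, rule DERIV_cong[OF DERIV_diff[OF characteristic_derivative]])
      (use that in auto)
  then obtain c where "\<And>\<tau>. \<tau> \<in> {-x<..} \<Longrightarrow> W \<tau> = c"
    using has_field_derivative_zero_constant[of "{-x<..}" W] by auto
  then have "W r = W 0" using assms by auto
  then show ?thesis by (simp add: W_def)
qed

lemma p_p0_dist:
  assumes x: "0 < x"
  shows "\<bar>p t x - p0 t\<bar> \<le> norm (K t) * x"
proof (rule tendsto_upperbound[OF tendsto_rabs[OF tendsto_diff[OF tendsto_const p0]]])
  have "\<bar>p t x - p t y\<bar> \<le> norm (K t) * x" if y: "0 < y" "y < x" for y
  proof -
    obtain z where z: "y < z" "z < x" "p t x - p t y = (x - y) * csharp_fun (K t) z"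
      using MVT2[OF y(2), of "p t" "csharp_fun (K t)"] p_x y by auto
    have "\<bar>p t x - p t y\<bar> = \<bar>csharp_fun (K t) z\<bar> * (x - y)"
      using z y by (simp add: abs_mult)
    also have "\<dots> \<le> norm (K t) * x"
      using y by (intro mult_mono abs_csharp_fun_le_norm) auto
    finally show ?thesis .
  qed
  then show "\<forall>\<^sub>F y in at_right 0. \<bar>p t x - p t y\<bar> \<le> norm (K t) * x"
    using x by (auto simp: eventually_at_right[of 0 x] intro!: exI[of _ x])
qed simp

lemma \<Psi>_P0_dist:
  obtains M where "\<And>t x. 0 \<le> t \<Longrightarrow> t \<le> T \<Longrightarrow> 0 < x \<Longrightarrow> \<bar>\<Psi> x t - P0 t\<bar> \<le> M * x"
proof -
  have "compact (K ` {0..T})"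
    by (intro compact_continuous_image continuous_on_subset[OF K_cont]) auto
  then obtain M where M: "\<And>t. t \<in> {0..T} \<Longrightarrow> norm (K t) \<le> M"
    by (metis bounded_iff compact_imp_bounded image_eqI)
  have "\<bar>\<Psi> x t - P0 t\<bar> \<le> M * \<bar>T\<bar> * x" if t: "0 \<le> t" "t \<le> T" and x: "0 < x" for t x
  proof -
    have "norm ((\<Psi> x t - P0 t) - (\<Psi> x 0 - P0 0)) \<le> (M * x) * norm (t - 0)"
    proof (rule field_differentiable_bound[of "{0..T}" "\<lambda>t. \<Psi> x t - P0 t" "\<lambda>t. p t x - p0 t"])
      show "((\<lambda>t. \<Psi> x t - P0 t) has_real_derivative p s x - p0 s) (at s within {0..T})" for s
        by (rule has_field_derivative_at_within) (auto intro!: derivative_intros \<Psi>_t x P0')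
      show "norm (p s x - p0 s) \<le> M * x" if "s \<in> {0..T}" for s
        using order_trans[OF p_p0_dist[OF x, of s] mult_right_mono[OF M[OF that], of x]] x by simp
    qed (use t in auto)
    also have "\<dots> \<le> (M * x) * \<bar>T\<bar>"
      using t x M[of 0] by (intro mult_left_mono) (auto intro!: mult_nonneg_nonneg order_trans[OF norm_ge_zero M])
    finally show ?thesis by (simp add: mult_ac)
  qed
  then show thesis by (rule that)
qed

text \<open>The limit may be taken at a moving time because the trace is attained uniformly on
  compact time intervals. The case \<open>c = 0\<close> serves the incoming characteristic,
  \<open>c = 1\<close> the outgoing one.\<close>

lemma tendsto_\<Psi>:
  assumes t: "0 \<le> t" and "0 \<le> c"
  shows "((\<lambda>y. \<Psi> y (t + c * y)) \<longlongrightarrow> P0 t) (at_right 0)"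
proof -
  obtain M where M: "\<And>s x. 0 \<le> s \<Longrightarrow> s \<le> t + c \<Longrightarrow> 0 < x \<Longrightarrow> \<bar>\<Psi> x s - P0 s\<bar> \<le> M * x"
    using \<Psi>_P0_dist[of "t + c"] by blast
  have arg: "((\<lambda>y. t + c * y) \<longlongrightarrow> t) (at_right 0)"
    by (rule tendsto_eq_intros refl | simp)+
  have "((\<lambda>y. \<Psi> y (t + c * y) - P0 (t + c * y)) \<longlongrightarrow> 0) (at_right 0)"
  proof (rule Lim_null_comparison)
    have "\<bar>\<Psi> y (t + c * y) - P0 (t + c * y)\<bar> \<le> M * y" if "0 < y" "y < 1" for y
      using that t \<open>0 \<le> c\<close> by (intro M) (auto simp: mult_left_le)
    then show "\<forall>\<^sub>F y in at_right 0. norm (\<Psi> y (t + c * y) - P0 (t + c * y)) \<le> M * y"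
      by (auto simp: eventually_at_right[of 0 1] intro!: exI[of _ 1])
    show "((\<lambda>y. M * y) \<longlongrightarrow> 0) (at_right 0)"
      by (rule tendsto_eq_intros refl | simp)+
  qed
  moreover have "((\<lambda>y. P0 (t + c * y)) \<longlongrightarrow> P0 t) (at_right 0)"
    by (rule isCont_tendsto_compose[OF DERIV_isCont[OF P0'] arg])
  ultimately show ?thesis using tendsto_add by fastforce
qed

lemma boundary_left:
  assumes t: "0 < t"
  shows "at0_plus (U t) + P0 t = csharp_fun (U 0) t"
proof -
  have "((\<lambda>y. csharp_fun (U t) y + \<Psi> y (t + 0 * y)) \<longlongrightarrow> at0_plus (U t) + P0 t) (at_right 0)"
    using t by (intro tendsto_add tendsto_at0_plus tendsto_\<Psi>) auto
  moreover have "((\<lambda>y. csharp_fun (U 0) (y + t)) \<longlongrightarrow> csharp_fun (U 0) t) (at_right 0)"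
    by (rule tendsto_csharp_fun) (rule tendsto_eq_intros refl | use t in simp)+
  moreover have "\<forall>\<^sub>F y in at_right 0. csharp_fun (U t) y + \<Psi> y (t + 0 * y) = csharp_fun (U 0) (y + t)"
    using t by (auto simp: eventually_at_right[of 0 1] left_characteristic intro!: exI[of _ 1])
  ultimately show ?thesis
    by (rule tendsto_at_right_eqI)
qed

lemma boundary_right:
  assumes x: "0 < x" "x < t"
  shows "csharp_fun (U t) x - \<Psi> x t = at0_plus (U (t - x)) - P0 (t - x)"
proof -
  have arg: "((\<lambda>y. t - x + 1 * y) \<longlongrightarrow> t - x) (at_right 0)"
    by (rule tendsto_eq_intros refl | simp)+
  have "((\<lambda>y. csharp_fun (U (t - x + 1 * y)) y - \<Psi> y (t - x + 1 * y))
      \<longlongrightarrow> at0_plus (U (t - x)) - P0 (t - x)) (at_right 0)"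
    using x by (intro tendsto_diff tendsto_csharp_fun_at0 tendsto_UQK(1) arg tendsto_\<Psi> filterlim_ident) auto
  moreover have "\<forall>\<^sub>F y in at_right 0. csharp_fun (U (t - x + 1 * y)) y - \<Psi> y (t - x + 1 * y)
      = csharp_fun (U t) x - \<Psi> x t"
    using x right_characteristic[of x "_ - x" t]
    by (auto simp: eventually_at_right[of 0 1] algebra_simps intro!: exI[of _ 1])
  ultimately have "at0_plus (U (t - x)) - P0 (t - x) = csharp_fun (U t) x - \<Psi> x t"
    by (rule tendsto_at_right_eqI[OF _ tendsto_const])
  then show ?thesis by simp
qed

lemma d_Alembert:
  assumes x: "0 < x" "x \<noteq> t" and t: "0 \<le> t"
  shows "csharp_fun (U t) x = (csharp_fun (U 0) (x + t) + csharp_fun (U 0) \<bar>x - t\<bar>) / 2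
    - (if x < t then P0 (t - x) else 0)"
proof (cases "x < t")
  case True
  \<comment> \<open>\<open>boundary_left\<close> at time \<open>t - x\<close> eliminates the
    boundary value from \<open>boundary_right\<close>; \<open>P0 (t - x)\<close> then occurs twice,
    and halving leaves it once.\<close>
  then show ?thesis
    using left_characteristic[OF x(1) t] boundary_right[OF x(1) True] boundary_left[of "t - x"]
    by (simp add: field_simps)
next
  case False
  then show ?thesis
    using left_characteristic[OF x(1) t] right_characteristic[of x "- t" t] x
    by (simp add: field_simps)
qed

end

section \<open>The explicit formula for the cosine family\<close>

definition jump_fun :: "csharp \<Rightarrow> real \<Rightarrow> real" where
  "jump_fun f y = (if 0 < y then csharp_fun f y - csharp_fun f (- y) else at0_plus f - at0_minus f)"

lemma bounded_linear_jump: "bounded_linear (\<lambda>f. at0_plus f - at0_minus f)"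
  by (intro bounded_linear_sub bounded_linear_at0)

lemma bounded_linear_jump_fun: "bounded_linear (\<lambda>f. jump_fun f y)"
  unfolding jump_fun_def
  by (cases "0 < y") (auto intro!: bounded_linear_sub bounded_linear_csharp_fun bounded_linear_at0)

lemma abs_jump_fun_le: "\<bar>jump_fun f y\<bar> \<le> 2 * norm f"
  using abs_csharp_fun_le_norm[of f y] abs_csharp_fun_le_norm[of f "- y"] abs_at0_le[of f]
  unfolding jump_fun_def by auto

lemma continuous_on_jump_fun: "continuous_on UNIV (jump_fun f)"
proof -
  have pos: "jump_fun f y = csharp_fun f y - csharp_fun (reflect f) y" if "0 < y" for y
    using that by (simp add: jump_fun_def)
  have "(jump_fun f \<longlongrightarrow> jump_fun f y) (at y)" for y
  proof (cases y "0 :: real" rule: linorder_cases)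
    case less
    show ?thesis
      by (rule tendsto_eventually, rule eventually_at_in_open'[THEN eventually_mono, of "{..<0}"])
        (use less in \<open>auto simp: jump_fun_def\<close>)
  next
    case greater
    have "((\<lambda>y. csharp_fun f y - csharp_fun (reflect f) y) \<longlongrightarrow> jump_fun f y) (at y)"
      unfolding pos[OF greater]
      using greater csharp_fun_isCont[of y f] csharp_fun_isCont[of y "reflect f"]
      by (intro tendsto_diff) (simp_all add: isCont_def csharp_fun_reflect[abs_def])
    then show ?thesis
      by (rule Lim_transform_eventually, intro eventually_at_in_open'[THEN eventually_mono, of "{0<..}"])
        (use greater in \<open>auto simp: pos\<close>)
  next
    case equal
    have "((\<lambda>y. csharp_fun f y - csharp_fun (reflect f) y) \<longlongrightarrow> jump_fun f y) (at_right y)"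
      using tendsto_diff[OF tendsto_at0_plus[of f] tendsto_at0_plus[of "reflect f"]]
      by (simp add: equal jump_fun_def)
    then have "(jump_fun f \<longlongrightarrow> jump_fun f y) (at_right y)"
      by (rule Lim_transform_eventually) (auto simp: equal eventually_at_filter pos)
    moreover have "(jump_fun f \<longlongrightarrow> jump_fun f y) (at_left y)"
      by (rule tendsto_eventually) (auto simp: equal eventually_at_filter jump_fun_def)
    ultimately show ?thesis by (simp add: filterlim_split_at)
  qed
  then show ?thesis by (simp add: continuous_on_def)
qed

text \<open>The integral in the extensions \<open>f\<^sub>\<ell>\<close> and \<open>f\<^sub>r\<close> of the explicit formula, where \<open>\<kappa> = \<alpha> + \<beta>\<close>. The values of
  \<open>jump_fun\<close> at \<open>y \<le> 0\<close> only serve to make it continuous.\<close>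

definition robin :: "real \<Rightarrow> csharp \<Rightarrow> real \<Rightarrow> real" where
  "robin \<kappa> f t = integral {0..t} (\<lambda>y. exp (- \<kappa> * (t - y)) * jump_fun f y)"

lemma robin_integrable: "(\<lambda>y. exp (- \<kappa> * (t - y)) * jump_fun f y) integrable_on {0..t}"
  by (intro integrable_continuous_real continuous_intros continuous_on_subset[OF continuous_on_jump_fun]) auto

text \<open>Integrating factor: the \<open>y\<close>-derivative of
  \<open>exp (- \<kappa> * (t - y)) * I y\<close> is the integrand of \<open>robin\<close>.\<close>

lemma robin_unique:
  assumes I': "\<And>t. 0 \<le> t \<Longrightarrow> (I has_real_derivative jump_fun f t - \<kappa> * I t) (at t)"
    and I0: "I 0 = 0" and t: "0 \<le> t"
  shows "I t = robin \<kappa> f t"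
proof -
  define G where "G y = exp (- \<kappa> * (t - y)) * I y" for y
  have "((\<lambda>y. exp (- \<kappa> * (t - y)) * jump_fun f y) has_integral (G t - G 0)) {0..t}"
  proof (rule fundamental_theorem_of_calculus[OF t])
    fix y assume "y \<in> {0..t}"
    then have "(G has_real_derivative exp (- \<kappa> * (t - y)) * jump_fun f y) (at y)"
      unfolding G_def by (auto intro!: derivative_eq_intros I' simp: algebra_simps)
    then show "(G has_vector_derivative exp (- \<kappa> * (t - y)) * jump_fun f y) (at y within {0..t})"
      by (simp add: has_real_derivative_iff_has_vector_derivative has_vector_derivative_at_within)
  qed
  then show ?thesis
    unfolding robin_def G_def using I0 by (simp add: integral_unique)
qed

text \<open>One primitive covers all uses: \<open>e\<close> measures the mass of the kernel,
  \<open>1 - exp (- \<kappa> * t)\<close>, and \<open>c\<close> its first moment, at most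
  \<open>1 / \<kappa>\<close>.\<close>

lemma integral_exp_kernel:
  fixes \<kappa> t e c :: real
  assumes "0 < \<kappa>" "0 \<le> t"
  shows "((\<lambda>y. exp (- \<kappa> * (t - y)) * (\<kappa> * (e + c * (t - y)))) has_integral
    (e + c / \<kappa> - exp (- \<kappa> * t) * (e + c * t + c / \<kappa>))) {0..t}"
proof -
  define G where "G y = exp (- \<kappa> * (t - y)) * (e + c * (t - y) + c / \<kappa>)" for y
  have "(G has_real_derivative exp (- \<kappa> * (t - y)) * (\<kappa> * (e + c * (t - y)))) (at y)" for y
    unfolding G_def using assms by (auto intro!: derivative_eq_intros simp: field_simps)
  then have "(G has_vector_derivative exp (- \<kappa> * (t - y)) * (\<kappa> * (e + c * (t - y)))) (at y within {0..t})" for y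
    by (simp add: has_real_derivative_iff_has_vector_derivative has_vector_derivative_at_within)
  then have "((\<lambda>y. exp (- \<kappa> * (t - y)) * (\<kappa> * (e + c * (t - y)))) has_integral (G t - G 0)) {0..t}"
    using assms by (intro fundamental_theorem_of_calculus)
  then show ?thesis by (simp add: G_def)
qed

lemma abs_robin_le:
  assumes "0 < \<kappa>" "0 \<le> t"
  shows "\<kappa> * \<bar>robin \<kappa> f t\<bar> \<le> 2 * norm f"
proof -
  have "norm (integral {0..t} (\<lambda>y. \<kappa> * (exp (- \<kappa> * (t - y)) * jump_fun f y)))
      \<le> integral {0..t} (\<lambda>y. exp (- \<kappa> * (t - y)) * (\<kappa> * (2 * norm f + 0 * (t - y))))"
  proof (rule integral_norm_bound_integral)
    show "(\<lambda>y. \<kappa> * (exp (- \<kappa> * (t - y)) * jump_fun f y)) integrable_on {0..t}"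
      by (intro integrable_on_mult_right robin_integrable)
    show "norm (\<kappa> * (exp (- \<kappa> * (t - y)) * jump_fun f y))
        \<le> exp (- \<kappa> * (t - y)) * (\<kappa> * (2 * norm f + 0 * (t - y)))" for y
      using abs_jump_fun_le[of f y] assms by (simp add: abs_mult)
  qed (use integral_exp_kernel[OF assms] in blast)
  also have "\<dots> = 2 * norm f - exp (- \<kappa> * t) * (2 * norm f)"
    using integral_unique[OF integral_exp_kernel[OF assms, of "2 * norm f" 0]] by simp
  also have "\<dots> \<le> 2 * norm f" by simp
  finally show ?thesis
    using assms by (simp add: robin_def abs_mult)
qed

text \<open>The mass missing from the kernel produces the exponential term; the first moment turns
  the modulus \<open>e + c * (t - y)\<close> into \<open>e + c / \<kappa>\<close>.\<close>

lemma robin_error: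
  assumes \<kappa>: "0 < \<kappa>" and t: "0 \<le> t" and e: "0 \<le> e" "0 \<le> c"
    and close: "\<And>y. 0 \<le> y \<Longrightarrow> y \<le> t \<Longrightarrow> \<bar>jump_fun f y - jump_fun f t\<bar> \<le> e + c * (t - y)"
  shows "\<bar>\<kappa> * robin \<kappa> f t - jump_fun f t\<bar> \<le> e + c / \<kappa> + exp (- \<kappa> * t) * \<bar>jump_fun f t\<bar>"
proof -
  let ?k = "\<lambda>y. exp (- \<kappa> * (t - y))"
  have "((\<lambda>y. \<kappa> * (?k y * jump_fun f y) - ?k y * (\<kappa> * (jump_fun f t + 0 * (t - y)))) has_integral
      \<kappa> * robin \<kappa> f t - (jump_fun f t + 0 / \<kappa> - exp (- \<kappa> * t) * (jump_fun f t + 0 * t + 0 / \<kappa>))) {0..t}"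
    unfolding robin_def
    by (intro has_integral_diff has_integral_mult_right integrable_integral robin_integrable
        integral_exp_kernel \<kappa> t)
  then have int: "((\<lambda>y. ?k y * (\<kappa> * (jump_fun f y - jump_fun f t))) has_integral
      \<kappa> * robin \<kappa> f t - jump_fun f t + exp (- \<kappa> * t) * jump_fun f t) {0..t}"
    by (simp add: algebra_simps)
  have "norm (integral {0..t} (\<lambda>y. ?k y * (\<kappa> * (jump_fun f y - jump_fun f t))))
      \<le> integral {0..t} (\<lambda>y. ?k y * (\<kappa> * (e + c * (t - y))))"
  proof (rule integral_norm_bound_integral)
    show "norm (?k y * (\<kappa> * (jump_fun f y - jump_fun f t))) \<le> ?k y * (\<kappa> * (e + c * (t - y)))"
      if "y \<in> {0..t}" for y
      using close[of y] that \<kappa> by (simp add: abs_mult)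
  qed (use integral_exp_kernel[OF \<kappa> t] int in blast)+
  then have "\<bar>\<kappa> * robin \<kappa> f t - jump_fun f t + exp (- \<kappa> * t) * jump_fun f t\<bar>
      \<le> e + c / \<kappa> - exp (- \<kappa> * t) * (e + c * t + c / \<kappa>)"
    using integral_unique[OF int] integral_unique[OF integral_exp_kernel[OF \<kappa> t, of e c]] by simp
  also have "\<dots> \<le> e + c / \<kappa>"
    using e \<kappa> t by simp
  finally have "\<bar>\<kappa> * robin \<kappa> f t - jump_fun f t + exp (- \<kappa> * t) * jump_fun f t\<bar> \<le> e + c / \<kappa>" .
  moreover have "\<bar>exp (- \<kappa> * t) * jump_fun f t\<bar> = exp (- \<kappa> * t) * \<bar>jump_fun f t\<bar>"
    by (simp add: abs_mult)
  ultimately show ?thesis by linarith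
qed

lemma bounded_linear_robin:
  assumes "0 < \<kappa>" "0 \<le> t"
  shows "bounded_linear (\<lambda>f. robin \<kappa> f t)"
proof (rule bounded_linear_intro[where K = "2 / \<kappa>"])
  note lin = bounded_linear.linear[OF bounded_linear_jump_fun]
  show "robin \<kappa> (f + g) t = robin \<kappa> f t + robin \<kappa> g t" for f g
    using integral_add[OF robin_integrable[of \<kappa> t f] robin_integrable[of \<kappa> t g]]
    by (simp add: robin_def linear_add[OF lin] distrib_left)
  show "robin \<kappa> (a *\<^sub>R f) t = a *\<^sub>R robin \<kappa> f t" for a f
    by (simp add: robin_def linear_scale[OF lin] mult.left_commute)
  show "norm (robin \<kappa> f t) \<le> norm f * (2 / \<kappa>)" for f
    using abs_robin_le[OF assms, of f] assms by (simp add: field_simps)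
qed

section \<open>Orbits of \<open>A_op\<close> in closed form\<close>

lemma has_vector_derivative_imp_continuous_on_UNIV:
  "(\<And>t. (F has_vector_derivative Q t) (at t)) \<Longrightarrow> continuous_on UNIV F"
  by (auto intro!: continuous_at_imp_continuous_on has_vector_derivative_continuous)

lemma half_line_wave_reflect:
  assumes U': "\<And>t. (U has_vector_derivative Q t) (at t)"
    and Q': "\<And>t. (Q has_vector_derivative K t) (at t)" and Q0: "Q 0 = 0"
    and K: "continuous_on UNIV K"
    and d: "\<And>t. derivs (U t) (p t) (K t)"
    and p0: "\<And>t. (p t \<longlongrightarrow> p0 t) (at_left 0)"
  shows "half_line_wave (\<lambda>t. reflect (U t)) (\<lambda>t. reflect (Q t)) (\<lambda>t. reflect (K t))
    (\<lambda>t x. - p t (- x)) (\<lambda>t. - p0 t)"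
proof
  note r = bounded_linear.has_vector_derivative[OF bounded_linear_reflect]
  show "((\<lambda>t. reflect (U t)) has_vector_derivative reflect (Q t)) (at t)"
    "((\<lambda>t. reflect (Q t)) has_vector_derivative reflect (K t)) (at t)" for t
    by (intro r U' Q')+
  show "reflect (Q 0) = 0"
    by (simp add: Q0 linear_0 bounded_linear.linear[OF bounded_linear_reflect])
  show "continuous_on UNIV (\<lambda>t. reflect (K t))"
    by (intro continuous_on_compose2[OF linear_continuous_on[OF bounded_linear_reflect] K]) auto
  show "(csharp_fun (reflect (U t)) has_real_derivative - p t (- x)) (at x)"
    "((\<lambda>x. - p t (- x)) has_real_derivative csharp_fun (reflect (K t)) x) (at x)" if "0 < x" for t x
    using derivsD[OF derivs_reflect[OF d]] that by auto
next
  show "((\<lambda>x. - p t (- x)) \<longlongrightarrow> - p0 t) (at_right 0)" for t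
    using tendsto_minus[OF p0[of t]] by (simp add: filterlim_at_left_to_right)
qed

definition wave :: "csharp \<Rightarrow> real \<Rightarrow> real \<Rightarrow> real" where
  "wave f t x = (csharp_fun f (x + t) + csharp_fun f \<bar>x - t\<bar>) / 2"

lemma bounded_linear_wave: "bounded_linear (\<lambda>f. wave f t x)"
  unfolding wave_def
  by (intro bounded_linear_compose[OF bounded_linear_divide] bounded_linear_add bounded_linear_csharp_fun)

lemma abs_wave_le: "\<bar>wave f t x\<bar> \<le> norm f"
  using abs_csharp_fun_le_norm[of f "x + t"] abs_csharp_fun_le_norm[of f "\<bar>x - t\<bar>"]
  by (simp add: wave_def)

text \<open>d'Alembert's formula on both half-lines, coupled through the jump \<open>J\<close> of
  the orbit at 0: the boundary slopes are multiples of \<open>J\<close>, so its time integral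
  \<open>I\<close> is the only unknown.\<close>

lemma cosine_formula_domain:
  assumes gen: "generates_cosine_family UNIV (A_op \<alpha> \<beta>) C" and fh: "(f, h) \<in> A_op \<alpha> \<beta>"
    and t: "0 \<le> t" and x: "0 < x" "x \<noteq> t"
  shows "csharp_fun (C t f) x = wave f t x - (if x < t then \<beta> * robin (\<alpha> + \<beta>) f (t - x) else 0)"
    and "csharp_fun (C t f) (- x) =
      wave (reflect f) t x + (if x < t then \<alpha> * robin (\<alpha> + \<beta>) f (t - x) else 0)"
proof -
  have C: "cosine_family UNIV C" and A: "cosine_generator UNIV C = A_op \<alpha> \<beta>"
    using gen by (simp_all add: generates_cosine_family_def)
  have fh': "(f, h) \<in> cosine_generator UNIV C" using fh A by simp
  obtain Q where Q: "Q 0 = 0" "\<And>t. ((\<lambda>t. C t f) has_vector_derivative Q t) (at t)"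
    "\<And>t. (Q has_vector_derivative C t h) (at t)"
    using cosine_orbit_smooth[OF C subspace_UNIV fh'] by blast
  define J where "J t = at0_plus (C t f) - at0_minus (C t f)" for t
  define I where "I = antideriv J"
  have "\<forall>t. (C t f, C t h) \<in> A_op \<alpha> \<beta>"
    using cosine_generator_invariant[OF C subspace_UNIV fh'] A by simp
  then have "\<forall>t. \<exists>g. derivs (C t f) (csharp_fun g) (C t h) \<and> at0_minus g = \<alpha> * J t \<and> at0_plus g = \<beta> * J t"
    by (simp add: A_op_iff J_def)
  then obtain g where g: "\<And>t. derivs (C t f) (csharp_fun (g t)) (C t h)"
    "\<And>t. at0_minus (g t) = \<alpha> * J t" "\<And>t. at0_plus (g t) = \<beta> * J t"
    by metis
  have K: "continuous_on UNIV (\<lambda>t. C t h)"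
    using C by (simp add: cosine_family_def)
  interpret R: half_line_wave "\<lambda>t. C t f" Q "\<lambda>t. C t h" "\<lambda>t. csharp_fun (g t)" "\<lambda>t. \<beta> * J t"
    by unfold_locales (auto intro!: Q K derivsD[OF g(1)] simp: tendsto_at0_plus simp flip: g(3))
  interpret L: half_line_wave "\<lambda>t. reflect (C t f)" "\<lambda>t. reflect (Q t)" "\<lambda>t. reflect (C t h)"
    "\<lambda>t x. - csharp_fun (g t) (- x)" "\<lambda>t. - (\<alpha> * J t)"
    by (rule half_line_wave_reflect) (auto intro!: Q K g(1) simp: tendsto_at0_minus simp flip: g(2))
  have P0: "R.P0 t = \<beta> * I t" "L.P0 t = - \<alpha> * I t" for t
    using antideriv_cmult[of \<beta> J t] antideriv_cmult[of "- \<alpha>" J t]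
    unfolding R.P0_def L.P0_def I_def by simp_all
  have C0: "C 0 f = f" using C by (simp add: cosine_family_def)
  have J_cont: "continuous_on UNIV J"
    unfolding J_def
    by (intro continuous_on_compose2[OF linear_continuous_on[OF bounded_linear_jump]]
        has_vector_derivative_imp_continuous_on_UNIV[OF Q(2)]) auto
  \<comment> \<open>The difference of the boundary relations of the two half-lines; it says
    \<open>I' = jump_fun f - (\<alpha> + \<beta>) I\<close>, the equation solved by
    \<open>robin\<close>.\<close>
  have J_eq: "J t = jump_fun f t - (\<alpha> + \<beta>) * I t" if "0 \<le> t" for t
  proof (cases "t = 0")
    case True
    then show ?thesis by (simp add: J_def I_def C0 jump_fun_def)
  next
    case False
    then have "at0_plus (C t f) + \<beta> * I t = csharp_fun f t"
      "at0_minus (C t f) - \<alpha> * I t = csharp_fun f (- t)"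
      using R.boundary_left[of t] L.boundary_left[of t] that by (simp_all add: P0 C0)
    then show ?thesis
      using False that by (simp add: J_def jump_fun_def algebra_simps)
  qed
  have I_eq: "I t = robin (\<alpha> + \<beta>) f t" if "0 \<le> t" for t
  proof (rule robin_unique[OF _ _ that])
    show "(I has_real_derivative jump_fun f t - (\<alpha> + \<beta>) * I t) (at t)" if "0 \<le> t" for t
      using has_vector_derivative_antideriv[OF J_cont, of t]
      by (simp add: I_def[symmetric] J_eq[OF that] has_real_derivative_iff_has_vector_derivative)
  qed (simp add: I_def)
  show "csharp_fun (C t f) x = wave f t x - (if x < t then \<beta> * robin (\<alpha> + \<beta>) f (t - x) else 0)"
    using R.d_Alembert[OF x t] by (simp add: C0 P0 I_eq wave_def)
  show "csharp_fun (C t f) (- x) =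
      wave (reflect f) t x + (if x < t then \<alpha> * robin (\<alpha> + \<beta>) f (t - x) else 0)"
    using L.d_Alembert[OF x t] by (simp add: C0 P0 I_eq wave_def)
qed

lemma bounded_linear_eq_on_dense:
  fixes L1 L2 :: "'a::real_normed_vector \<Rightarrow> real"
  assumes "bounded_linear L1" "bounded_linear L2" "\<And>g. g \<in> S \<Longrightarrow> L1 g = L2 g"
    and dense: "\<And>f e. 0 < e \<Longrightarrow> \<exists>g\<in>S. norm (g - f) < e"
  shows "L1 f = L2 f"
proof -
  have "closed {f. L1 f = L2 f}"
    by (intro closed_Collect_eq linear_continuous_on assms)
  moreover have "f \<in> closure S"
    using dense by (auto simp: closure_approachable dist_norm)
  moreover have "S \<subseteq> {f. L1 f = L2 f}" using assms(3) by auto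
  ultimately show ?thesis
    using closure_minimal by blast
qed

text \<open>A bound \<open>K\<close> of unknown size is part of the hypothesis on \<open>T\<close>;
  approximation from \<open>S\<close> replaces it by \<open>c\<close>.\<close>

lemma bounded_linear_in_bound_on_dense:
  assumes T: "bounded_linear_in X T" and X: "subspace X" and S: "S \<subseteq> X"
    and dense: "\<And>e. 0 < e \<Longrightarrow> \<exists>g\<in>S. norm (g - f) < e" and f: "f \<in> X"
    and bound: "\<And>g. g \<in> S \<Longrightarrow> norm (T g) \<le> c * norm g" and c: "0 \<le> c"
  shows "norm (T f) \<le> c * norm f"
proof (rule field_le_epsilon)
  fix e :: real assume e: "0 < e"
  obtain K where K: "\<And>g. g \<in> X \<Longrightarrow> norm (T g) \<le> K * norm g"
    using T unfolding bounded_linear_in_def by blast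
  define d where "d = e / (c + \<bar>K\<bar> + 1)"
  have d: "0 < d" "(c + \<bar>K\<bar>) * d \<le> e"
    using e c by (auto simp: d_def field_simps)
  obtain g where g: "g \<in> S" "norm (g - f) < d" using dense[OF d(1)] by blast
  have "T f = T g - T (g - f)"
    using bounded_linear_in_diff[OF T X, of g f] g S f by auto
  then have "norm (T f) \<le> norm (T g) + norm (T (g - f))"
    by (simp add: norm_triangle_ineq4)
  also have "\<dots> \<le> c * norm g + \<bar>K\<bar> * norm (g - f)"
  proof (intro add_mono bound g)
    have "g - f \<in> X" using g S f X by (auto intro: subspace_diff)
    then show "norm (T (g - f)) \<le> \<bar>K\<bar> * norm (g - f)"
      using K by (meson abs_ge_self mult_right_mono norm_ge_zero order_trans)
  qed
  also have "\<dots> \<le> c * (norm f + norm (g - f)) + \<bar>K\<bar> * norm (g - f)"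
    using norm_triangle_sub[of g f] c by (intro add_mono mult_left_mono) auto
  also have "\<dots> \<le> c * norm f + (c + \<bar>K\<bar>) * d"
    using mult_left_mono[OF less_imp_le[OF g(2)], of "c + \<bar>K\<bar>"] c by (simp add: algebra_simps)
  finally show "norm (T f) \<le> c * norm f + e" using d(2) by simp
qed

lemma A_op_dense:
  assumes gen: "generates_cosine_family UNIV (A_op \<alpha> \<beta>) C" and e: "0 < e"
  shows "\<exists>g\<in>Domain (A_op \<alpha> \<beta>). norm (g - f) < e"
  using cosine_generator_dense[OF _ subspace_UNIV bounded_linear_ident _ _ _ e, of C f] gen
  by (auto simp: generates_cosine_family_def)

text \<open>For fixed \<open>t\<close> and \<open>x\<close> both sides are bounded linear
  functionals of \<open>f\<close>, so agreement on the dense domain suffices.\<close>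

lemma cosine_formula:
  assumes gen: "generates_cosine_family UNIV (A_op \<alpha> \<beta>) C" and pos: "0 < \<alpha> + \<beta>"
    and t: "0 \<le> t" and x: "0 < x" "x \<noteq> t"
  shows "csharp_fun (C t f) x = wave f t x - (if x < t then \<beta> * robin (\<alpha> + \<beta>) f (t - x) else 0)"
    and "csharp_fun (C t f) (- x) =
      wave (reflect f) t x + (if x < t then \<alpha> * robin (\<alpha> + \<beta>) f (t - x) else 0)"
proof -
  have bl: "bounded_linear (C t)"
    using gen by (simp add: generates_cosine_family_def cosine_family_def bounded_linear_in_UNIV)
  have r: "bounded_linear (\<lambda>f. if x < t then c * robin (\<alpha> + \<beta>) f (t - x) else 0)" for c
    by (cases "x < t") (auto intro!: bounded_linear_const_mult bounded_linear_robin pos bounded_linear_zero)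
  note lin = bounded_linear_compose[OF bounded_linear_csharp_fun bl]
    bounded_linear_compose[OF bounded_linear_wave bounded_linear_reflect] bounded_linear_wave r
  show "csharp_fun (C t f) x = wave f t x - (if x < t then \<beta> * robin (\<alpha> + \<beta>) f (t - x) else 0)"
    by (rule bounded_linear_eq_on_dense[OF _ _ _ A_op_dense[OF gen]])
      (auto intro!: bounded_linear_sub lin simp: cosine_formula_domain[OF gen _ t x])
  show "csharp_fun (C t f) (- x) =
      wave (reflect f) t x + (if x < t then \<alpha> * robin (\<alpha> + \<beta>) f (t - x) else 0)"
    by (rule bounded_linear_eq_on_dense[OF _ _ _ A_op_dense[OF gen]])
      (auto intro!: bounded_linear_add lin simp: cosine_formula_domain[OF gen _ t x])
qed

lemma norm_csharp_le_wave:
  assumes "\<And>x. 0 < x \<Longrightarrow> x \<noteq> t \<Longrightarrow> \<bar>csharp_fun f x\<bar> \<le> b \<and> \<bar>csharp_fun f (- x)\<bar> \<le> b"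
  shows "norm f \<le> b"
proof (rule norm_csharp_le_off)
  show "\<bar>csharp_fun f x\<bar> \<le> b" if "x \<noteq> 0" "\<bar>x\<bar> \<noteq> t" for x
    using assms[of x] assms[of "- x"] that by (cases "0 < x") auto
qed

lemma weight_mult_le:
  fixes w :: real
  assumes "0 \<le> w" "w \<le> \<kappa>" "\<kappa> * \<bar>r\<bar> \<le> b"
  shows "\<bar>w * r\<bar> \<le> b"
  using mult_right_mono[OF assms(2), of "\<bar>r\<bar>"] assms by (simp add: abs_mult)

lemma cosine_norm_le_5:
  assumes gen: "generates_cosine_family UNIV (A_op \<alpha> \<beta>) C"
    and ab: "0 \<le> \<alpha>" "0 \<le> \<beta>" "0 < \<alpha> + \<beta>"
  shows "norm (C t f) \<le> 5 * norm f"
proof -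
  have nonneg: "norm (C t f) \<le> 5 * norm f" if t: "0 \<le> t" for t
  proof (rule norm_csharp_le_wave)
    fix x :: real assume x: "0 < x" "x \<noteq> t"
    \<comment> \<open>Each weight is at most \<open>\<alpha> + \<beta>\<close>, so the integral part
      is at most \<open>2 * norm f\<close>; with the wave part the total is 3 times the
      norm.\<close>
    have r: "\<bar>\<alpha> * robin (\<alpha> + \<beta>) f (t - x)\<bar> \<le> 2 * norm f"
      "\<bar>\<beta> * robin (\<alpha> + \<beta>) f (t - x)\<bar> \<le> 2 * norm f" if "x < t"
      by (rule weight_mult_le[OF _ _ abs_robin_le]; use that ab in simp)+
    show "\<bar>csharp_fun (C t f) x\<bar> \<le> 5 * norm f \<and> \<bar>csharp_fun (C t f) (- x)\<bar> \<le> 5 * norm f"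
      using cosine_formula[OF gen ab(3) t x, of f] r abs_wave_le[of f t x] abs_wave_le[of "reflect f" t x]
      by (auto split: if_splits)
  qed
  show ?thesis
  proof (cases "0 \<le> t")
    case False
    then show ?thesis
      using nonneg[of "- t"] cosine_family_minus[OF _ subspace_UNIV, of C f t] gen
      by (simp add: generates_cosine_family_def)
  qed (rule nonneg)
qed

section \<open>Convergence of the cosine families\<close>

text \<open>A fixed element with unit jump at 0. Subtracting multiples of it yields the bounded
  projection onto \<open>cline\<close> that \<open>cosine_generator_dense\<close> asks for.\<close>

definition step :: csharp where
  "step = Csharp (\<lambda>x. if 0 < x then 1 else 0)"

lemma csharp_fun_step [simp]: "csharp_fun step x = (if 0 < x then 1 else 0)"
proof -
  have "csharp_fun (Csharp (\<lambda>x. if 0 < x then 1 else 0)) = (\<lambda>x. if 0 < x then 1 else 0)"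
  proof (rule csharp_fun_CsharpI)
    fix x :: real assume x: "x \<noteq> 0"
    have "\<forall>\<^sub>F y in nhds x. (if 0 < y then 1 else 0 :: real) = (if 0 < x then 1 else 0)"
    proof (cases "0 < x")
      case True
      then show ?thesis by (intro eventually_nhds_in_open[THEN eventually_mono, of "{0<..}"]) auto
    next
      case False
      with x show ?thesis by (intro eventually_nhds_in_open[THEN eventually_mono, of "{..<0}"]) auto
    qed
    then show "isCont (\<lambda>x. if 0 < x then 1 else 0 :: real) x"
      by (simp add: isCont_cong)
  next
    show "((\<lambda>x::real. if 0 < x then 1 else 0 :: real) \<longlongrightarrow> 0) at_bot"
      by (rule tendsto_eventually) (auto simp: eventually_at_bot_linorder intro!: exI[of _ 0])
    show "((\<lambda>x::real. if 0 < x then 1 else 0 :: real) \<longlongrightarrow> 1) at_top"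
      by (rule tendsto_eventually) (auto simp: eventually_at_top_linorder intro!: exI[of _ 1])
    show "((\<lambda>x::real. if 0 < x then 1 else 0 :: real) \<longlongrightarrow> 0) (at_left 0)"
      by (rule tendsto_eventually) (auto simp: eventually_at_filter)
    show "((\<lambda>x::real. if 0 < x then 1 else 0 :: real) \<longlongrightarrow> 1) (at_right 0)"
      by (rule tendsto_eventually) (auto simp: eventually_at_filter)
  qed simp
  then show ?thesis by (simp add: step_def)
qed

lemma at0_step [simp]: "at0_plus step = 1" "at0_minus step = 0"
  by (auto intro!: at0_eqI tendsto_eventually simp: eventually_at_filter)

definition cline_proj :: "csharp \<Rightarrow> csharp" where
  "cline_proj f = f - (at0_plus f - at0_minus f) *\<^sub>R step"

lemma bounded_linear_cline_proj: "bounded_linear cline_proj"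
  unfolding cline_proj_def
  by (intro bounded_linear_sub bounded_linear_ident bounded_linear_scaleR_const bounded_linear_at0)

lemma cline_proj_in: "cline_proj f \<in> cline"
  using bounded_linear_at0[THEN bounded_linear.linear]
  by (simp add: cline_proj_def cline_def linear_diff linear_scale)

lemma cline_proj_eq: "f \<in> cline \<Longrightarrow> cline_proj f = f"
  by (simp add: cline_proj_def cline_def)

lemma A_skew_dense:
  assumes gen: "generates_cosine_family cline (A_skew \<alpha> \<beta>) C" and f: "f \<in> cline" and e: "0 < e"
  shows "\<exists>g\<in>Domain (A_skew \<alpha> \<beta>). norm (g - f) < e"
  using cosine_generator_dense[OF _ subspace_cline bounded_linear_cline_proj cline_proj_in cline_proj_eq f e, of C] gen
  by (auto simp: generates_cosine_family_def)

text \<open>Off 0 the derivatives within a half-line are two-sided, and differentiability of the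
  first derivatives at 0 gives the one-sided limits of the glued function.\<close>

lemma A_skewE:
  assumes "(f, h) \<in> A_skew \<alpha> \<beta>"
  obtains g a b where
    "derivs f g h"
    "(g \<longlongrightarrow> a) (at_left 0)" "(g \<longlongrightarrow> b) (at_right 0)" "\<alpha> * b = \<beta> * a"
proof -
  obtain g1 g2 where
    l: "\<And>x. x \<le> 0 \<Longrightarrow> (cline_fun f has_real_derivative g1 x) (at x within {..0})"
     "\<And>x. x \<le> 0 \<Longrightarrow> (g1 has_real_derivative cline_fun h x) (at x within {..0})"
    and r: "\<And>x. 0 \<le> x \<Longrightarrow> (cline_fun f has_real_derivative g2 x) (at x within {0..})"
     "\<And>x. 0 \<le> x \<Longrightarrow> (g2 has_real_derivative cline_fun h x) (at x within {0..})"
    and bc: "\<alpha> * g2 0 = \<beta> * g1 0"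
    using assms unfolding A_skew_def by auto
  define g where "g x = (if x \<le> 0 then g1 x else g2 x)" for x
  have neg: "at x within {..0} = at x" if "x < 0" for x :: real
    using that by (intro at_within_interior) auto
  have pos: "at x within {0..} = at x" if "0 < x" for x :: real
    using that by (intro at_within_interior) auto
  have tr: "(F has_real_derivative D) (at x)"
    if "(G has_real_derivative D) (at x)" "x \<in> S" "open S" "\<And>y. y \<in> S \<Longrightarrow> G y = F y"
    for F G D and x :: real and S
    using has_field_derivative_transform_within_open[of G D x S F] that by auto
  have cl: "cline_fun u x = csharp_fun u x" if "x \<noteq> 0" for u x
    using that by (simp add: cline_fun_def)
  have "(csharp_fun f has_real_derivative g x) (at x) \<and> (g has_real_derivative csharp_fun h x) (at x)"
    if x: "x \<noteq> 0" for x
  proof (cases "x < 0")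
    case True
    have "(csharp_fun f has_real_derivative g1 x) (at x)"
      by (rule tr[of "cline_fun f" _ _ "{..<0}"]) (use l(1)[of x] neg[of x] True in \<open>auto simp: cl\<close>)
    moreover have "(g has_real_derivative csharp_fun h x) (at x)"
      by (rule tr[of g1 _ _ "{..<0}"]) (use l(2)[of x] neg[of x] True in \<open>auto simp: cl g_def\<close>)
    ultimately show ?thesis using True by (simp add: g_def)
  next
    case False
    with x have pos': "0 < x" by simp
    have "(csharp_fun f has_real_derivative g2 x) (at x)"
      by (rule tr[of "cline_fun f" _ _ "{0<..}"]) (use r(1)[of x] pos[of x] pos' in \<open>auto simp: cl\<close>)
    moreover have "(g has_real_derivative csharp_fun h x) (at x)"
      by (rule tr[of g2 _ _ "{0<..}"]) (use r(2)[of x] pos[of x] pos' in \<open>auto simp: cl g_def\<close>)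
    ultimately show ?thesis using pos' by (simp add: g_def)
  qed
  moreover have "(g \<longlongrightarrow> g1 0) (at_left 0)"
  proof -
    have "(g1 \<longlongrightarrow> g1 0) (at 0 within {..0})"
      using DERIV_continuous[OF l(2)[of 0]] by (simp add: continuous_within)
    then have "(g1 \<longlongrightarrow> g1 0) (at_left 0)"
      by (rule tendsto_within_subset) auto
    then show ?thesis
      by (rule Lim_transform_eventually) (auto simp: eventually_at_filter g_def)
  qed
  moreover have "(g \<longlongrightarrow> g2 0) (at_right 0)"
  proof -
    have "(g2 \<longlongrightarrow> g2 0) (at 0 within {0..})"
      using DERIV_continuous[OF r(2)[of 0]] by (simp add: continuous_within)
    then have "(g2 \<longlongrightarrow> g2 0) (at_right 0)"
      by (rule tendsto_within_subset) auto
    then show ?thesis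
      by (rule Lim_transform_eventually) (auto simp: eventually_at_filter g_def)
  qed
  ultimately show thesis using bc by (intro that[of g "g1 0" "g2 0"]) (auto simp: derivs_def)
qed

text \<open>No differential equation arises: continuity of the orbit at 0 gives the difference of
  the two traces, the flux relation integrated in time gives a second linear equation, and together
  they determine both.\<close>

lemma skew_formula_domain:
  assumes gen: "generates_cosine_family cline (A_skew \<alpha> \<beta>) C" and fh: "(f, h) \<in> A_skew \<alpha> \<beta>"
    and pos: "0 < \<alpha> + \<beta>" and t: "0 \<le> t" and x: "0 < x" "x \<noteq> t"
  shows "csharp_fun (C t f) x = wave f t x - (if x < t then \<beta> / (\<alpha> + \<beta>) * jump_fun f (t - x) else 0)"
    and "csharp_fun (C t f) (- x) =
      wave (reflect f) t x + (if x < t then \<alpha> / (\<alpha> + \<beta>) * jump_fun f (t - x) else 0)"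
proof -
  have C: "cosine_family cline C" and A: "cosine_generator cline C = A_skew \<alpha> \<beta>"
    using gen by (simp_all add: generates_cosine_family_def)
  have fh': "(f, h) \<in> cosine_generator cline C" using fh A by simp
  have cl: "f \<in> cline" "h \<in> cline" using fh by (auto simp: A_skew_def)
  obtain Q where Q: "Q 0 = 0" "\<And>t. ((\<lambda>t. C t f) has_vector_derivative Q t) (at t)"
    "\<And>t. (Q has_vector_derivative C t h) (at t)"
    using cosine_orbit_smooth[OF C subspace_cline fh'] by blast
  have "(C t f, C t h) \<in> A_skew \<alpha> \<beta>" for t
    using cosine_generator_invariant[OF C subspace_cline fh'] A by simp
  have "\<exists>g a b. derivs (C t f) g (C t h) \<and>
     (g \<longlongrightarrow> a) (at_left 0) \<and> (g \<longlongrightarrow> b) (at_right 0) \<and> \<alpha> * b = \<beta> * a" for t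
    using A_skewE[OF \<open>(C t f, C t h) \<in> A_skew \<alpha> \<beta>\<close>] by metis
  then obtain g a b where g: "\<And>t. derivs (C t f) (g t) (C t h)"
    "\<And>t. (g t \<longlongrightarrow> a t) (at_left 0)" "\<And>t. (g t \<longlongrightarrow> b t) (at_right 0)" "\<And>t. \<alpha> * b t = \<beta> * a t"
    by metis
  have K: "continuous_on UNIV (\<lambda>t. C t h)"
    using C cl by (simp add: cosine_family_def)
  interpret R: half_line_wave "\<lambda>t. C t f" Q "\<lambda>t. C t h" g b
    by unfold_locales (auto intro!: Q K g derivsD[OF g(1)])
  interpret L: half_line_wave "\<lambda>t. reflect (C t f)" "\<lambda>t. reflect (Q t)" "\<lambda>t. reflect (C t h)"
    "\<lambda>t x. - g t (- x)" "\<lambda>t. - a t"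
    by (rule half_line_wave_reflect) (auto intro!: Q g K)
  have C0: "C 0 f = f" using C cl by (simp add: cosine_family_def)
  have "\<alpha> * R.P0 t = - \<beta> * L.P0 t" for t
    using antideriv_cmult[of \<alpha> b t] antideriv_cmult[of "- \<beta>" "\<lambda>t. - a t" t]
    by (simp add: R.P0_def L.P0_def g(4))
  note bc = this[of "t - x"]
  have "R.P0 (t - x) - L.P0 (t - x) = jump_fun f (t - x)" if "x < t"
  proof -
    have "C (t - x) f \<in> cline" using cosine_family_in[OF C subspace_cline cl(1)] .
    then show ?thesis
      using R.boundary_left[of "t - x"] L.boundary_left[of "t - x"] that
      by (simp add: C0 jump_fun_def cline_def)
  qed
  then have P0: "R.P0 (t - x) = \<beta> / (\<alpha> + \<beta>) * jump_fun f (t - x)"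
      "L.P0 (t - x) = - (\<alpha> / (\<alpha> + \<beta>) * jump_fun f (t - x))" if "x < t"
    using that bc pos by (auto simp: field_simps)
  show "csharp_fun (C t f) x = wave f t x - (if x < t then \<beta> / (\<alpha> + \<beta>) * jump_fun f (t - x) else 0)"
    using R.d_Alembert[OF x t] P0 by (auto simp: C0 wave_def)
  show "csharp_fun (C t f) (- x) =
      wave (reflect f) t x + (if x < t then \<alpha> / (\<alpha> + \<beta>) * jump_fun f (t - x) else 0)"
    using L.d_Alembert[OF x t] P0 by (auto simp: C0 wave_def)
qed

lemma skew_cosine_bound:
  assumes gen: "generates_cosine_family cline (A_skew \<alpha> \<beta>) C"
    and ab: "0 \<le> \<alpha>" "0 \<le> \<beta>" "0 < \<alpha> + \<beta>" and t: "0 \<le> t" and f: "f \<in> cline"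
  shows "norm (C t f) \<le> 3 * norm f"
proof (rule bounded_linear_in_bound_on_dense[OF _ subspace_cline _ A_skew_dense[OF gen f] f])
  show "bounded_linear_in cline (C t)"
    using gen by (simp add: generates_cosine_family_def cosine_family_def)
  show "Domain (A_skew \<alpha> \<beta>) \<subseteq> cline" by (auto simp: A_skew_def)
  fix g assume "g \<in> Domain (A_skew \<alpha> \<beta>)"
  then obtain h where g: "(g, h) \<in> A_skew \<alpha> \<beta>" by blast
  show "norm (C t g) \<le> 3 * norm g"
  proof (rule norm_csharp_le_wave)
    fix x :: real assume x: "0 < x" "x \<noteq> t"
    define A B where "A = \<alpha> / (\<alpha> + \<beta>) * jump_fun g (t - x)" and "B = \<beta> / (\<alpha> + \<beta>) * jump_fun g (t - x)"
    have "\<bar>w / (\<alpha> + \<beta>) * jump_fun g (t - x)\<bar> \<le> 2 * norm g" if "w = \<alpha> \<or> w = \<beta>" for w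
      using that ab abs_jump_fun_le[of g "t - x"] by (intro weight_mult_le[of _ 1]) (auto simp: field_simps)
    then have "\<bar>A\<bar> \<le> 2 * norm g" "\<bar>B\<bar> \<le> 2 * norm g"
      unfolding A_def B_def by blast+
    then show "\<bar>csharp_fun (C t g) x\<bar> \<le> 3 * norm g \<and> \<bar>csharp_fun (C t g) (- x)\<bar> \<le> 3 * norm g"
      using skew_formula_domain[OF gen g ab(3) t x, folded A_def B_def]
        abs_wave_le[of g t x] abs_wave_le[of "reflect g" t x]
      by (auto split: if_splits)
  qed
qed simp_all

text \<open>The jump function has derivative \<open>g y + g (- y)\<close>, which interpolation
  bounds by \<open>L\<close>, and it vanishes at 0 because \<open>f\<close> is continuous
  there.\<close>

lemma A_skew_jump_fun_lipschitz:
  assumes fh: "(f, h) \<in> A_skew \<alpha> \<beta>"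
  defines "L \<equiv> 2 * (2 * norm f + norm h)"
  shows "0 \<le> s \<Longrightarrow> s \<le> t \<Longrightarrow> \<bar>jump_fun f s - jump_fun f t\<bar> \<le> L * (t - s)"
    and "0 \<le> t \<Longrightarrow> \<bar>jump_fun f t\<bar> \<le> L * t"
proof -
  obtain g where g: "derivs f g h" using A_skewE[OF fh] by metis
  have lip: "\<bar>jump_fun f s - jump_fun f t\<bar> \<le> L * (t - s)" if st: "0 < s" "s \<le> t" for s t
  proof (cases "s = t")
    case False
    have "((\<lambda>y. csharp_fun f y - csharp_fun f (- y)) has_real_derivative g y + g (- y)) (at y)" if "0 < y" for y
      using DERIV_diff[OF derivsD(1)[OF g] DERIV_mirror[THEN iffD1, OF derivsD(1)[OF g]], of y] that by simp
    then obtain z where z: "s < z" "z < t"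
      "(csharp_fun f t - csharp_fun f (- t)) - (csharp_fun f s - csharp_fun f (- s)) = (t - s) * (g z + g (- z))"
      using MVT2[of s t "\<lambda>y. csharp_fun f y - csharp_fun f (- y)" "\<lambda>y. g y + g (- y)"] st False by auto
    have "jump_fun f t - jump_fun f s = (t - s) * (g z + g (- z))"
      using z st by (simp add: jump_fun_def)
    then have "\<bar>jump_fun f s - jump_fun f t\<bar> = \<bar>g z + g (- z)\<bar> * (t - s)"
      using st by (simp add: abs_minus_commute[of "jump_fun f s"] abs_mult mult.commute)
    also have "\<dots> \<le> L * (t - s)"
      using derivs_bound[OF g, of z] derivs_bound[OF g, of "- z"] z st by (intro mult_right_mono) (auto simp: L_def)
    finally show ?thesis .
  qed simp
  have lip0: "\<bar>jump_fun f 0 - jump_fun f t\<bar> \<le> L * (t - 0)" if t: "0 < t" for t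
  proof (rule tendsto_le[OF trivial_limit_at_right_real])
    have "(jump_fun f \<longlongrightarrow> jump_fun f 0) (at_right 0)"
      using continuous_on_jump_fun[of f] by (auto simp: continuous_on_def intro: tendsto_within_subset)
    then show "((\<lambda>s. \<bar>jump_fun f s - jump_fun f t\<bar>) \<longlongrightarrow> \<bar>jump_fun f 0 - jump_fun f t\<bar>) (at_right 0)"
      by (intro tendsto_intros)
    show "((\<lambda>s. L * (t - s)) \<longlongrightarrow> L * (t - 0)) (at_right 0)" by (intro tendsto_intros)
    show "\<forall>\<^sub>F s in at_right 0. \<bar>jump_fun f s - jump_fun f t\<bar> \<le> L * (t - s)"
      using lip t by (auto simp: eventually_at_right[of 0 t] intro!: exI[of _ t])
  qed
  show *: "\<bar>jump_fun f s - jump_fun f t\<bar> \<le> L * (t - s)" if "0 \<le> s" "s \<le> t" for s t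
    using lip[of s t] lip0[of t] that by (cases "s = 0"; cases "t = 0") auto
  have "jump_fun f 0 = 0"
    using fh by (auto simp: A_skew_def jump_fun_def cline_def)
  then show "\<bar>jump_fun f t\<bar> \<le> L * t" if "0 \<le> t" for t
    using *[of 0 t] that by simp
qed

lemma mult_exp_minus_le: "0 < m \<Longrightarrow> exp (- m * t) * t \<le> 1 / m" for m t :: real
proof -
  assume "0 < m"
  have "m * t \<le> exp (m * t)" using exp_ge_add_one_self[of "m * t"] by linarith
  with \<open>0 < m\<close> show ?thesis by (simp add: exp_minus field_simps)
qed

text \<open>\<open>robin_error\<close> with \<open>e = 0\<close> and \<open>c = L\<close>. For small
  times the kernel lacks mass, but there the jump function is itself small:
  \<open>exp (- \<kappa> * \<tau>) * (L * \<tau>) \<le> L / \<kappa>\<close>. Hence the bound does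
  not depend on \<open>t\<close>.\<close>

lemma cosine_error_domain:
  assumes gen: "generates_cosine_family UNIV (A_op (m * \<alpha>) (m * \<beta>)) C"
    and gen_skew: "generates_cosine_family cline (A_skew \<alpha> \<beta>) C'"
    and m: "0 < m" and ab: "0 \<le> \<alpha>" "0 \<le> \<beta>" "0 < \<alpha> + \<beta>" and t: "0 \<le> t"
    and fh: "(f, h) \<in> A_skew \<alpha> \<beta>"
  shows "norm (C t f - C' t f) \<le> 4 * (2 * norm f + norm h) / (m * (\<alpha> + \<beta>))" (is "_ \<le> ?b")
proof (rule norm_csharp_le_wave)
  fix x :: real assume x: "0 < x" "x \<noteq> t"
  define L where "L = 2 * (2 * norm f + norm h)"
  define \<kappa> where "\<kappa> = m * (\<alpha> + \<beta>)"
  have \<kappa>: "0 < \<kappa>" "m * \<alpha> + m * \<beta> = \<kappa>"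
    using mult_pos_pos[OF m ab(3)] by (simp_all add: \<kappa>_def distrib_left)
  have L: "0 \<le> L" by (simp add: L_def)
  have err: "\<bar>w / (\<alpha> + \<beta>) * (\<kappa> * robin \<kappa> f \<tau> - jump_fun f \<tau>)\<bar> \<le> 2 * L / \<kappa>"
    if \<tau>: "0 \<le> \<tau>" and w: "w = \<alpha> \<or> w = \<beta>" for w \<tau>
  proof (rule weight_mult_le[of _ 1])
    have "\<bar>\<kappa> * robin \<kappa> f \<tau> - jump_fun f \<tau>\<bar> \<le> 0 + L / \<kappa> + exp (- \<kappa> * \<tau>) * \<bar>jump_fun f \<tau>\<bar>"
      using A_skew_jump_fun_lipschitz(1)[OF fh] L by (intro robin_error \<kappa> \<tau>) (auto simp: L_def)
    also have "\<dots> \<le> 0 + L / \<kappa> + exp (- \<kappa> * \<tau>) * (L * \<tau>)"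
      using A_skew_jump_fun_lipschitz(2)[OF fh \<tau>] by (simp add: L_def)
    also have "exp (- \<kappa> * \<tau>) * (L * \<tau>) \<le> L / \<kappa>"
      using mult_left_mono[OF mult_exp_minus_le[OF \<kappa>(1), of \<tau>] L] by (simp add: mult_ac)
    finally show "1 * \<bar>\<kappa> * robin \<kappa> f \<tau> - jump_fun f \<tau>\<bar> \<le> 2 * L / \<kappa>" by simp
  qed (use w ab in auto)
  have scale: "m * w * r = w / (\<alpha> + \<beta>) * (\<kappa> * r)" for w r
    using ab by (simp add: \<kappa>_def)
  have bound: "?b = 2 * L / \<kappa>"
    by (simp add: L_def \<kappa>_def)
  have b0: "0 \<le> 2 * L / \<kappa>" using L \<kappa> by simp
  have "csharp_fun (C t f - C' t f) x =
      (if x < t then - (\<beta> / (\<alpha> + \<beta>) * (\<kappa> * robin \<kappa> f (t - x) - jump_fun f (t - x))) else 0)"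
    using cosine_formula(1)[OF gen _ t x, of f] skew_formula_domain(1)[OF gen_skew fh ab(3) t x]
    by (simp add: \<kappa> scale right_diff_distrib)
  moreover have "csharp_fun (C t f - C' t f) (- x) =
      (if x < t then \<alpha> / (\<alpha> + \<beta>) * (\<kappa> * robin \<kappa> f (t - x) - jump_fun f (t - x)) else 0)"
    using cosine_formula(2)[OF gen _ t x, of f] skew_formula_domain(2)[OF gen_skew fh ab(3) t x]
    by (simp add: \<kappa> scale right_diff_distrib)
  ultimately show "\<bar>csharp_fun (C t f - C' t f) x\<bar> \<le> ?b \<and> \<bar>csharp_fun (C t f - C' t f) (- x)\<bar> \<le> ?b"
    unfolding bound using err[of "t - x" \<alpha>] err[of "t - x" \<beta>] b0
    by (auto simp del: csharp_fun_diff)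
qed

lemma cosine_convergence:
  fixes Cos :: "nat \<Rightarrow> real \<Rightarrow> csharp \<Rightarrow> csharp"
  assumes ab: "0 \<le> \<alpha>" "0 \<le> \<beta>" "0 < \<alpha> + \<beta>"
    and gen: "\<And>n. 1 \<le> n \<Longrightarrow> generates_cosine_family UNIV (A_op (real n * \<alpha>) (real n * \<beta>)) (Cos n)"
    and gen_skew: "generates_cosine_family cline (A_skew \<alpha> \<beta>) C'"
    and f: "f \<in> cline"
  shows "(\<lambda>n. SUP t\<in>{0..}. ennreal (norm (Cos n t f - C' t f))) \<longlonglongrightarrow> 0"
proof -
  have main: "\<forall>\<^sub>F n in sequentially. \<forall>t\<ge>0. norm (Cos n t f - C' t f) \<le> e" if e: "0 < e" for e
  proof -
    \<comment> \<open>The bounds 5 and 3 of the two families cost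
      \<open>(5 + 3) * e / 16 = e / 2\<close>; the other half is left for the error at
      \<open>g\<close>.\<close>
    obtain g h where gh: "(g, h) \<in> A_skew \<alpha> \<beta>" and g: "norm (g - f) < e / 16"
      using A_skew_dense[OF gen_skew f, of "e / 16"] e by auto
    define b where "b = 4 * (2 * norm g + norm h) / (\<alpha> + \<beta>)"
    have "(\<lambda>n. b * (1 / real n)) \<longlonglongrightarrow> 0"
      by (rule tendsto_mult_right_zero[OF lim_1_over_n])
    then have "\<forall>\<^sub>F n in sequentially. b * (1 / real n) < e / 2"
      using e by (intro order_tendstoD) auto
    then show ?thesis
      using eventually_ge_at_top[of 1]
    proof eventually_elim
      case (elim n)
      show ?case
      proof (intro allI impI)
        fix t :: real assume t: "0 \<le> t"
        have gC: "g \<in> cline" using gh by (auto simp: A_skew_def)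
        have bl: "bounded_linear_in UNIV (Cos n t)" and bl': "bounded_linear_in cline (C' t)"
          using gen[OF elim(2)] gen_skew by (auto simp: generates_cosine_family_def cosine_family_def)
        have "norm (Cos n t f - Cos n t g) \<le> 5 * norm (f - g)"
          using cosine_norm_le_5[OF gen[OF elim(2)], of t "f - g"] ab elim(2)
            bounded_linear_in_diff[OF bl subspace_UNIV, of f g]
          by (simp flip: distrib_left)
        moreover have "norm (C' t f - C' t g) \<le> 3 * norm (f - g)"
          using skew_cosine_bound[OF gen_skew ab t, of "f - g"] f gC
            bounded_linear_in_diff[OF bl' subspace_cline f gC]
          by (simp add: subspace_diff[OF subspace_cline])
        moreover have "norm (Cos n t g - C' t g) \<le> b * (1 / real n)"
          using cosine_error_domain[OF gen[OF elim(2)] gen_skew _ ab t gh] elim(2)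
          by (simp add: b_def mult.commute)
        moreover have "norm (Cos n t f - C' t f)
            \<le> norm (Cos n t f - Cos n t g) + norm (Cos n t g - C' t g) + norm (C' t f - C' t g)"
          using norm_triangle_ineq4[of "(Cos n t f - Cos n t g) + (Cos n t g - C' t g)" "C' t f - C' t g"]
            norm_triangle_ineq[of "Cos n t f - Cos n t g" "Cos n t g - C' t g"]
          by simp
        ultimately show "norm (Cos n t f - C' t f) \<le> e"
          using elim(1) g norm_minus_commute[of f g] by linarith
      qed
    qed
  qed
  show ?thesis
  proof (rule order_tendstoI)
    fix a :: ennreal assume "0 < a"
    then obtain b where b: "0 < b" "b < a" using dense by blast
    then obtain r where "b = ennreal r" by (cases b) auto
    with b have r: "0 < r" "ennreal r < a" by auto
    show "\<forall>\<^sub>F n in sequentially. (SUP t\<in>{0..}. ennreal (norm (Cos n t f - C' t f))) < a"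
      using main[OF r(1)]
    proof eventually_elim
      case (elim n)
      then have "(SUP t\<in>{0..}. ennreal (norm (Cos n t f - C' t f))) \<le> ennreal r"
        by (intro SUP_least ennreal_leI) auto
      with r(2) show ?case by simp
    qed
  qed simp
qed

text \<open>Here \<open>f\<close> is arbitrary, so the jump function need not be small near 0;
  instead the fixed \<open>t > 0\<close> makes the missing mass tend to 0.\<close>

lemma robin_tendsto:
  assumes \<kappa>: "0 < \<kappa>" and t: "0 < t"
  shows "(\<lambda>n. real n * \<kappa> * robin (real n * \<kappa>) f t) \<longlonglongrightarrow> jump_fun f t"
proof (rule LIM_zero_cancel, rule LIMSEQ_I)
  fix e :: real assume e: "0 < e"
  obtain d where d: "0 < d" "\<And>y. \<bar>y - t\<bar> < d \<Longrightarrow> \<bar>jump_fun f y - jump_fun f t\<bar> < e / 2"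
  proof -
    have "isCont (jump_fun f) t"
      using continuous_on_jump_fun[of f] by (simp add: continuous_on_eq_continuous_at)
    then obtain d where "0 < d" "\<forall>y. dist y t < d \<longrightarrow> dist (jump_fun f y) (jump_fun f t) < e / 2"
      unfolding continuous_at_eps_delta using half_gt_zero[OF e] by blast
    then show thesis by (intro that[of d]) (simp_all add: dist_real_def)
  qed
  \<comment> \<open>At distance at least \<open>d\<close> from \<open>t\<close> the oscillation is
    at most \<open>4 * norm f = c * d\<close>, so one affine modulus covers the whole
    interval.\<close>
  define c where "c = 4 * norm f / d"
  have c: "0 \<le> c" using d by (simp add: c_def)
  have close: "\<bar>jump_fun f y - jump_fun f t\<bar> \<le> e / 2 + c * (t - y)" if "0 \<le> y" "y \<le> t" for y
  proof (cases "\<bar>y - t\<bar> < d")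
    case True
    then show ?thesis using d(2)[of y] mult_nonneg_nonneg[OF c, of "t - y"] that by simp
  next
    case False
    then have "4 * norm f \<le> c * (t - y)"
      using d mult_left_mono[of d "t - y" "4 * norm f / d"] that by (simp add: c_def)
    then show ?thesis using abs_jump_fun_le[of f y] abs_jump_fun_le[of f t] e by linarith
  qed
  have "(\<lambda>n. c / \<kappa> * (1 / real n) + \<bar>jump_fun f t\<bar> / (t * \<kappa>) * (1 / real n)) \<longlonglongrightarrow> 0 + 0"
    by (intro tendsto_add tendsto_mult_right_zero[OF lim_1_over_n])
  then have "\<forall>\<^sub>F n in sequentially. c / \<kappa> * (1 / real n) + \<bar>jump_fun f t\<bar> / (t * \<kappa>) * (1 / real n) < e / 2"
    using e by (intro order_tendstoD) auto
  then have "\<forall>\<^sub>F n in sequentially. norm (real n * \<kappa> * robin (real n * \<kappa>) f t - jump_fun f t - 0) < e"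
    using eventually_gt_at_top[of 0]
  proof eventually_elim
    case (elim n)
    then have n\<kappa>: "0 < real n * \<kappa>" using \<kappa> by simp
    have "\<bar>real n * \<kappa> * robin (real n * \<kappa>) f t - jump_fun f t\<bar>
        \<le> e / 2 + c / (real n * \<kappa>) + exp (- (real n * \<kappa>) * t) * \<bar>jump_fun f t\<bar>"
      using t e c close by (intro robin_error n\<kappa>) auto
    moreover have "exp (- (real n * \<kappa>) * t) * \<bar>jump_fun f t\<bar> \<le> 1 / (real n * \<kappa>) / t * \<bar>jump_fun f t\<bar>"
    proof (rule mult_right_mono)
      show "exp (- (real n * \<kappa>) * t) \<le> 1 / (real n * \<kappa>) / t"
        using mult_exp_minus_le[OF n\<kappa>, of t] unfolding pos_le_divide_eq[OF t] .
    qed simp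
    moreover have "c / (real n * \<kappa>) = c / \<kappa> * (1 / real n)"
      "1 / (real n * \<kappa>) / t * \<bar>jump_fun f t\<bar> = \<bar>jump_fun f t\<bar> / (t * \<kappa>) * (1 / real n)"
      by (simp_all add: mult_ac)
    ultimately show ?case using elim(1) unfolding real_norm_def by linarith
  qed
  then show "\<exists>no. \<forall>n\<ge>no. norm (real n * \<kappa> * robin (real n * \<kappa>) f t - jump_fun f t - 0) < e"
    by (simp add: eventually_sequentially)
qed

text \<open>At time \<open>1\<close> the pointwise limit has at \<open>\<plusminus>1\<close> a jump proportional to that of \<open>f\<close> at \<open>0\<close>.\<close>

lemma cosine_convergent_imp_cline:
  fixes Cos :: "nat \<Rightarrow> real \<Rightarrow> csharp \<Rightarrow> csharp"
  assumes ab: "0 \<le> \<alpha>" "0 \<le> \<beta>" "0 < \<alpha> + \<beta>"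
    and gen: "\<And>n. 1 \<le> n \<Longrightarrow> generates_cosine_family UNIV (A_op (real n * \<alpha>) (real n * \<beta>)) (Cos n)"
    and conv: "convergent (\<lambda>n. Cos n 1 f)"
  shows "f \<in> cline"
proof -
  obtain G where G: "(\<lambda>n. Cos n 1 f) \<longlonglongrightarrow> G" using conv by (auto simp: convergent_def)
  have lim: "(\<lambda>n. csharp_fun (Cos n 1 f) x) \<longlonglongrightarrow> csharp_fun G x" for x
    by (rule bounded_linear.tendsto[OF bounded_linear_csharp_fun G])
  have rob: "(\<lambda>n. real n * w * robin (real n * \<alpha> + real n * \<beta>) f y) \<longlonglongrightarrow> w / (\<alpha> + \<beta>) * jump_fun f y" if "0 < y" for w y
  proof -
    have eq: "w / (\<alpha> + \<beta>) * (real n * (\<alpha> + \<beta>) * robin (real n * (\<alpha> + \<beta>)) f y)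
        = real n * w * robin (real n * \<alpha> + real n * \<beta>) f y" for n
      using ab(3) by (simp flip: distrib_left)
    show ?thesis
      using tendsto_mult_left[OF robin_tendsto[OF ab(3) that, of f], of "w / (\<alpha> + \<beta>)"] unfolding eq .
  qed
  have inner: "csharp_fun G (1 - y) = wave f 1 (1 - y) - \<beta> / (\<alpha> + \<beta>) * jump_fun f y"
      "csharp_fun G (- (1 - y)) = wave (reflect f) 1 (1 - y) + \<alpha> / (\<alpha> + \<beta>) * jump_fun f y"
    if y: "0 < y" "y < 1" for y
  proof -
    have ev: "\<forall>\<^sub>F n in sequentially. wave f 1 (1 - y) - real n * \<beta> * robin (real n * \<alpha> + real n * \<beta>) f y
        = csharp_fun (Cos n 1 f) (1 - y)"
      "\<forall>\<^sub>F n in sequentially. wave (reflect f) 1 (1 - y) + real n * \<alpha> * robin (real n * \<alpha> + real n * \<beta>) f y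
        = csharp_fun (Cos n 1 f) (- (1 - y))"
      using y ab cosine_formula[OF gen, of _ 1 "1 - y" f]
      by (auto intro!: eventually_sequentiallyI[of 1] simp flip: distrib_left)
    show "csharp_fun G (1 - y) = wave f 1 (1 - y) - \<beta> / (\<alpha> + \<beta>) * jump_fun f y"
      by (rule LIMSEQ_unique[OF lim Lim_transform_eventually[OF _ ev(1)]]) (intro tendsto_intros rob y)
    show "csharp_fun G (- (1 - y)) = wave (reflect f) 1 (1 - y) + \<alpha> / (\<alpha> + \<beta>) * jump_fun f y"
      by (rule LIMSEQ_unique[OF lim Lim_transform_eventually[OF _ ev(2)]]) (intro tendsto_intros rob y)
  qed
  have outer: "csharp_fun G (1 + y) = wave f 1 (1 + y)"
      "csharp_fun G (- (1 + y)) = wave (reflect f) 1 (1 + y)" if y: "0 < y" for y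
  proof -
    have ev: "\<forall>\<^sub>F n in sequentially. wave f 1 (1 + y) = csharp_fun (Cos n 1 f) (1 + y)"
      "\<forall>\<^sub>F n in sequentially. wave (reflect f) 1 (1 + y) = csharp_fun (Cos n 1 f) (- (1 + y))"
      using y ab cosine_formula[OF gen, of _ 1 "1 + y" f]
      by (auto intro!: eventually_sequentiallyI[of 1] simp flip: distrib_left)
    show "csharp_fun G (1 + y) = wave f 1 (1 + y)"
      by (rule LIMSEQ_unique[OF lim Lim_transform_eventually[OF tendsto_const ev(1)]])
    show "csharp_fun G (- (1 + y)) = wave (reflect f) 1 (1 + y)"
      by (rule LIMSEQ_unique[OF lim Lim_transform_eventually[OF tendsto_const ev(2)]])
  qed
  \<comment> \<open>The free wave shows no jump at 1: \<open>\<bar>x - 1\<bar>\<close> equals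
    \<open>y\<close> at both \<open>1 - y\<close> and \<open>1 + y\<close>, so the terms singular at
    0 cancel before the limit.\<close>
  have zero: "((\<lambda>y. csharp_fun u (1 - y) - csharp_fun u (1 + y)) \<longlongrightarrow> 0) (at_right 0)"
    "((\<lambda>y. wave v 1 (1 - y) - wave v 1 (1 + y)) \<longlongrightarrow> 0) (at_right 0)" for u v
  proof -
    have "((\<lambda>y. csharp_fun u (1 - y) - csharp_fun u (1 + y)) \<longlongrightarrow> csharp_fun u 1 - csharp_fun u 1) (at_right 0)"
      by (intro tendsto_diff isCont_tendsto_compose[OF csharp_fun_isCont]) (auto intro!: tendsto_eq_intros)
    then show "((\<lambda>y. csharp_fun u (1 - y) - csharp_fun u (1 + y)) \<longlongrightarrow> 0) (at_right 0)" by simp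
    have eq: "wave v 1 (1 - y) - wave v 1 (1 + y) = (csharp_fun v (2 - y) - csharp_fun v (2 + y)) / 2" for y
      by (simp add: wave_def field_simps)
    have "((\<lambda>y. (csharp_fun v (2 - y) - csharp_fun v (2 + y)) / 2) \<longlongrightarrow> (csharp_fun v 2 - csharp_fun v 2) / 2) (at_right 0)"
      by (intro tendsto_divide tendsto_diff isCont_tendsto_compose[OF csharp_fun_isCont]) (auto intro!: tendsto_eq_intros)
    then show "((\<lambda>y. wave v 1 (1 - y) - wave v 1 (1 + y)) \<longlongrightarrow> 0) (at_right 0)"
      unfolding eq by simp
  qed
  have jump: "((\<lambda>y. w * jump_fun f y) \<longlongrightarrow> w * jump_fun f 0) (at_right 0)" for w
    using continuous_on_jump_fun[of f]
    by (intro tendsto_intros) (auto simp: continuous_on_def intro: tendsto_within_subset)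
  have "0 + \<beta> / (\<alpha> + \<beta>) * jump_fun f 0 = 0"
  proof (rule tendsto_at_right_eqI[OF tendsto_add[OF zero(1)[of G] jump] zero(2)[of f]])
    show "\<forall>\<^sub>F y in at_right 0. csharp_fun G (1 - y) - csharp_fun G (1 + y) + \<beta> / (\<alpha> + \<beta>) * jump_fun f y
        = wave f 1 (1 - y) - wave f 1 (1 + y)"
      by (auto simp: eventually_at_right[of 0 1] inner(1) outer(1) intro!: exI[of _ 1])
  qed
  moreover have "0 + (- \<alpha> / (\<alpha> + \<beta>)) * jump_fun f 0 = 0"
  proof (rule tendsto_at_right_eqI[OF tendsto_add[OF zero(1)[of "reflect G"] jump] zero(2)[of "reflect f"]])
    show "\<forall>\<^sub>F y in at_right 0. csharp_fun (reflect G) (1 - y) - csharp_fun (reflect G) (1 + y)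
        + (- \<alpha> / (\<alpha> + \<beta>)) * jump_fun f y = wave (reflect f) 1 (1 - y) - wave (reflect f) 1 (1 + y)"
      using inner(2) outer(2)
      by (auto simp: eventually_at_right[of 0 1] simp del: minus_diff_eq minus_add_distrib intro!: exI[of _ 1])
  qed
  \<comment> \<open>At least one of the weights is nonzero, so one of the two fronts detects the
    jump.\<close>
  ultimately have "jump_fun f 0 = 0" using ab by (auto simp: divide_simps split: if_splits)
  then show "f \<in> cline" by (simp add: jump_fun_def cline_def)
qed

section \<open>Convergence of the semigroups on continuous functions\<close>

context
  fixes T :: "real \<Rightarrow> 'a::banach \<Rightarrow> 'a"
  assumes T: "strongly_continuous_semigroup UNIV T"
begin

lemma semigroup_bounded_linear: "0 \<le> t \<Longrightarrow> bounded_linear (T t)"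
  using T by (simp add: strongly_continuous_semigroup_def bounded_linear_in_UNIV)

lemma semigroup_0: "T 0 f = f"
  using T by (simp add: strongly_continuous_semigroup_def)

lemma semigroup_add: "0 \<le> t \<Longrightarrow> 0 \<le> s \<Longrightarrow> T (t + s) f = T t (T s f)"
  using T by (simp add: strongly_continuous_semigroup_def)

lemma semigroup_continuous: "continuous_on {0..} (\<lambda>t. T t f)"
  using T by (simp add: strongly_continuous_semigroup_def)

lemma semigroup_orbit_derivative:
  assumes gen: "(f, h) \<in> semigroup_generator UNIV T" and t: "0 \<le> t"
  shows "((\<lambda>s. (1 / s) *\<^sub>R (T (t + s) f - T t f)) \<longlongrightarrow> T t h) (at_right 0)"
proof -
  note lin = bounded_linear.linear[OF semigroup_bounded_linear[OF t]]
  have "((\<lambda>s. T t ((1 / s) *\<^sub>R (T s f - f))) \<longlongrightarrow> T t h) (at_right 0)"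
    using gen by (intro bounded_linear.tendsto[OF semigroup_bounded_linear[OF t]])
      (simp add: semigroup_generator_def)
  then show ?thesis
    by (rule Lim_transform_eventually)
      (simp add: eventually_at_filter semigroup_add t linear_scale[OF lin] linear_diff[OF lin])
qed

lemma semigroup_generator_invariant:
  assumes gen: "(f, h) \<in> semigroup_generator UNIV T" and t: "0 \<le> t"
  shows "(T t f, T t h) \<in> semigroup_generator UNIV T"
proof -
  have "((\<lambda>s. (1 / s) *\<^sub>R (T s (T t f) - T t f)) \<longlongrightarrow> T t h) (at_right 0)"
    using semigroup_orbit_derivative[OF assms]
    by (rule Lim_transform_eventually)
      (simp add: eventually_at_filter semigroup_add[symmetric] t add.commute)
  then show ?thesis by (simp add: semigroup_generator_def)
qed

text \<open>The time averages \<open>(1 / r) *\<^sub>R P r\<close> of the orbit lie in the domain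
  and tend to \<open>f\<close>.\<close>

lemma semigroup_generator_dense:
  assumes e: "0 < e"
  shows "\<exists>g h. (g, h) \<in> semigroup_generator UNIV T \<and> norm (g - f) < e"
proof -
  \<comment> \<open>The even extension of the orbit makes its primitive differentiable at 0 as
    well.\<close>
  define c where "c s = T \<bar>s\<bar> f" for s
  define P where "P = antideriv c"
  have "continuous_on UNIV c"
    unfolding c_def by (intro continuous_on_compose2[OF semigroup_continuous]) (auto intro!: continuous_intros)
  then have P': "(P has_vector_derivative c t) (at t)" for t
    unfolding P_def by (rule has_vector_derivative_antideriv)
  have P0: "P 0 = 0" by (simp add: P_def)
  have quot: "((\<lambda>h. (1 / h) *\<^sub>R (P (r + h) - P r)) \<longlongrightarrow> c r) (at_right 0)" for r
  proof -
    have "((\<lambda>h. norm (P (r + h) - P r - h *\<^sub>R c r) / norm h) \<longlongrightarrow> 0) (at 0)"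
      using P'[of r] by (simp add: has_vector_derivative_def has_derivative_at)
    then have "((\<lambda>h. norm ((1 / h) *\<^sub>R (P (r + h) - P r) - c r)) \<longlongrightarrow> 0) (at 0)"
    proof (rule Lim_transform_eventually)
      have "norm (P (r + h) - P r - h *\<^sub>R c r) / norm h = norm ((1 / h) *\<^sub>R (P (r + h) - P r) - c r)"
        if "h \<noteq> 0" for h
      proof -
        have "(1 / h) *\<^sub>R (P (r + h) - P r) - c r = (1 / h) *\<^sub>R (P (r + h) - P r - h *\<^sub>R c r)"
          using that by (simp add: scaleR_right_diff_distrib)
        then show ?thesis by (simp only: norm_scaleR) (simp add: divide_inverse abs_inverse)
      qed
      then show "\<forall>\<^sub>F h in at 0. norm (P (r + h) - P r - h *\<^sub>R c r) / norm h
          = norm ((1 / h) *\<^sub>R (P (r + h) - P r) - c r)"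
        by (simp add: eventually_at_filter)
    qed
    then have "((\<lambda>h. (1 / h) *\<^sub>R (P (r + h) - P r)) \<longlongrightarrow> c r) (at 0)"
      by (simp add: tendsto_norm_zero_iff LIM_zero_iff)
    then show ?thesis by (auto intro: tendsto_within_subset)
  qed
  have shift: "T h (P r) = P (r + h) - P h" if h: "0 \<le> h" and r: "0 \<le> r" for h r
  proof -
    let ?W = "\<lambda>r. T h (P r) - (P (r + h) - P h)"
    have "(?W has_vector_derivative 0) (at s within {0..})" if s: "s \<in> {0..}" for s
    proof -
      have "(?W has_vector_derivative (T h (c s) - (c (s + h) - 0))) (at s within {0..})"
        by (intro has_vector_derivative_diff has_vector_derivative_const
            bounded_linear.has_vector_derivative[OF semigroup_bounded_linear[OF h]]
            has_vector_derivative_at_within[OF P']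
            has_vector_derivative_at_within[OF has_vector_derivative_shift_reflect(2)[OF P']])
      moreover have "T h (c s) = c (s + h)"
        using semigroup_add[OF h, of s f] s h by (simp add: c_def add.commute)
      ultimately show ?thesis by simp
    qed
    then obtain k where "\<And>s. s \<in> {0..} \<Longrightarrow> ?W s = k"
      using has_vector_derivative_zero_constant[of "{0..}" ?W] by auto
    from this[of r] this[of 0] show ?thesis
      using r linear_0[OF bounded_linear.linear[OF semigroup_bounded_linear[OF h]]] by (simp add: P0)
  qed
  have gen: "(P r, c r - c 0) \<in> semigroup_generator UNIV T" if r: "0 \<le> r" for r
  proof -
    have "((\<lambda>h. (1 / h) *\<^sub>R (P (r + h) - P r) - (1 / h) *\<^sub>R (P (0 + h) - P 0)) \<longlongrightarrow> c r - c 0) (at_right 0)"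
      by (intro tendsto_diff quot)
    then have "((\<lambda>h. (1 / h) *\<^sub>R (T h (P r) - P r)) \<longlongrightarrow> c r - c 0) (at_right 0)"
      by (rule Lim_transform_eventually)
        (simp add: eventually_at_filter shift r P0 scaleR_right_diff_distrib)
    then show ?thesis by (simp add: semigroup_generator_def)
  qed
  have gen': "((1 / r) *\<^sub>R P r, (1 / r) *\<^sub>R (c r - c 0)) \<in> semigroup_generator UNIV T" if r: "0 \<le> r" for r
  proof -
    have "((\<lambda>h. (1 / r) *\<^sub>R ((1 / h) *\<^sub>R (T h (P r) - P r))) \<longlongrightarrow> (1 / r) *\<^sub>R (c r - c 0)) (at_right 0)"
      using gen[OF r] by (intro tendsto_scaleR tendsto_const) (simp add: semigroup_generator_def)
    then have "((\<lambda>h. (1 / h) *\<^sub>R (T h ((1 / r) *\<^sub>R P r) - (1 / r) *\<^sub>R P r)) \<longlongrightarrow> (1 / r) *\<^sub>R (c r - c 0)) (at_right 0)"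
      by (rule Lim_transform_eventually)
        (simp add: eventually_at_filter linear_scale[OF bounded_linear.linear[OF semigroup_bounded_linear]]
          scaleR_right_diff_distrib mult.commute)
    then show ?thesis by (simp add: semigroup_generator_def)
  qed
  have "((\<lambda>h. (1 / h) *\<^sub>R (P (0 + h) - P 0)) \<longlongrightarrow> c 0) (at_right 0)" by (rule quot)
  then have "((\<lambda>h. (1 / h) *\<^sub>R P h) \<longlongrightarrow> f) (at_right 0)"
    by (simp add: P0 c_def semigroup_0)
  then have "\<forall>\<^sub>F h in at_right 0. dist ((1 / h) *\<^sub>R P h) f < e \<and> 0 < h"
    using e by (intro eventually_conj tendstoD) (auto simp: eventually_at_right_less)
  then obtain r where "dist ((1 / r) *\<^sub>R P r) f < e" "0 < r"
    using eventually_at_right_0_ex by blast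
  then show ?thesis using gen'[of r] by (auto simp: dist_norm)
qed

end

section \<open>Maximum principle for \<open>A_op\<close> and contractivity of its semigroups\<close>

lemma A_op_lincomb:
  assumes "(f1, h1) \<in> A_op \<alpha> \<beta>" "(f2, h2) \<in> A_op \<alpha> \<beta>"
  shows "(a *\<^sub>R f1 + b *\<^sub>R f2, a *\<^sub>R h1 + b *\<^sub>R h2) \<in> A_op \<alpha> \<beta>"
proof -
  have at0: "at0_plus (a *\<^sub>R f + b *\<^sub>R g) = a * at0_plus f + b * at0_plus g"
    "at0_minus (a *\<^sub>R f + b *\<^sub>R g) = a * at0_minus f + b * at0_minus g" for f g
    using bounded_linear_at0[THEN bounded_linear.linear] by (simp_all add: linear_add linear_scale)
  obtain g1 where g1: "derivs f1 (csharp_fun g1) h1"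
     "at0_minus g1 = \<alpha> * (at0_plus f1 - at0_minus f1)" "at0_plus g1 = \<beta> * (at0_plus f1 - at0_minus f1)"
    using assms(1) by (auto simp: A_op_iff)
  obtain g2 where g2: "derivs f2 (csharp_fun g2) h2"
     "at0_minus g2 = \<alpha> * (at0_plus f2 - at0_minus f2)" "at0_plus g2 = \<beta> * (at0_plus f2 - at0_minus f2)"
    using assms(2) by (auto simp: A_op_iff)
  have "csharp_fun (a *\<^sub>R g1 + b *\<^sub>R g2) = (\<lambda>x. a * csharp_fun g1 x + b * csharp_fun g2 x)" by auto
  with derivs_lincomb[OF g1(1) g2(1), of a b] show ?thesis
    unfolding A_op_iff
    by (intro exI[of _ "a *\<^sub>R g1 + b *\<^sub>R g2"]) (simp add: at0 g1(2,3) g2(2,3) algebra_simps)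
qed

lemma A_op_diff:
  "(f1, h1) \<in> A_op \<alpha> \<beta> \<Longrightarrow> (f2, h2) \<in> A_op \<alpha> \<beta> \<Longrightarrow> (f1 - f2, h1 - h2) \<in> A_op \<alpha> \<beta>"
  using A_op_lincomb[of f1 h1 \<alpha> \<beta> f2 h2 1 "-1"] by simp

lemma A_op_scaleR: "(f, h) \<in> A_op \<alpha> \<beta> \<Longrightarrow> (c *\<^sub>R f, c *\<^sub>R h) \<in> A_op \<alpha> \<beta>"
  using A_op_lincomb[of f h \<alpha> \<beta> f h c 0] by simp

lemma derivs_maximum:
  assumes d: "derivs f g h" and p0: "(g \<longlongrightarrow> p0) (at_right 0)" and s: "0 < s"
    and B: "norm (f - s *\<^sub>R h) \<le> B" and x: "0 < x" "B < csharp_fun f x"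
  shows "p0 < 0" "B < at0_plus f"
proof -
  have "p0 < 0 \<and> csharp_fun f x \<le> at0_plus f"
    using half_line_maximum[of "csharp_fun f" g "csharp_fun h" "norm f" "at0_plus f" p0 s B x]
      derivsD[OF d] abs_le_D1[OF abs_csharp_fun_le_norm[of f]]
      order_trans[OF abs_le_D1[OF abs_csharp_fun_le_norm[of "f - s *\<^sub>R h"]] B]
      tendsto_at0_plus[of f] p0 s x by simp
  with x show "p0 < 0" "B < at0_plus f" by auto
qed

text \<open>A value above \<open>B\<close> on the right forces \<open>\<beta> * J < 0\<close>, so
  the boundary value on the left is larger still and exceeds \<open>B\<close>; on the left, however,
  a value above \<open>B\<close> forces \<open>J > 0\<close>.\<close>

lemma A_op_maximum:
  assumes fh: "(f, h) \<in> A_op \<alpha> \<beta>" and ab: "0 \<le> \<alpha>" "0 \<le> \<beta>" and s: "0 < s" and x: "x \<noteq> 0"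
  shows "csharp_fun f x \<le> norm (f - s *\<^sub>R h)"
proof -
  define B where "B = norm (f - s *\<^sub>R h)"
  define J where "J = at0_plus f - at0_minus f"
  obtain g where g: "derivs f (csharp_fun g) h" "at0_minus g = \<alpha> * J" "at0_plus g = \<beta> * J"
    using fh by (auto simp: A_op_iff J_def)
  have right: "\<beta> * J < 0 \<and> B < at0_plus f" if "0 < y" "B < csharp_fun f y" for y
    using derivs_maximum[OF g(1) tendsto_at0_plus s _ that] by (simp add: B_def g(3))
  have left: "- (\<alpha> * J) < 0 \<and> B < at0_minus f" if "0 < y" "B < csharp_fun f (- y)" for y
  proof -
    have "((\<lambda>y. - csharp_fun g (- y)) \<longlongrightarrow> - (\<alpha> * J)) (at_right 0)"
      using tendsto_minus[OF tendsto_at0_minus[of g]] by (simp add: g(2) filterlim_at_left_to_right)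
    moreover have "reflect f - s *\<^sub>R reflect h = reflect (f - s *\<^sub>R h)" by (rule csharp_eqI) simp
    ultimately show ?thesis
      using derivs_maximum[OF derivs_reflect[OF g(1)] _ s, of "- (\<alpha> * J)" B y] that by (simp add: B_def)
  qed
  have exR: "\<exists>y>0. B < csharp_fun f y" if "B < at0_plus f"
  proof -
    have "\<forall>\<^sub>F y in at_right 0. B < csharp_fun f y \<and> 0 < y"
      using order_tendstoD(1)[OF tendsto_at0_plus that] by (simp add: eventually_conj eventually_at_right_less)
    then show ?thesis
      using eventually_at_right_0_ex by blast
  qed
  have exL: "\<exists>y>0. B < csharp_fun f (- y)" if "B < at0_minus f"
  proof -
    have "((\<lambda>y. csharp_fun f (- y)) \<longlongrightarrow> at0_minus f) (at_right 0)"
      using tendsto_at0_minus[of f] by (simp add: filterlim_at_left_to_right)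
    from order_tendstoD(1)[OF this that]
    have "\<forall>\<^sub>F y in at_right 0. B < csharp_fun f (- y) \<and> 0 < y"
      by (simp add: eventually_conj eventually_at_right_less)
    then show ?thesis
      using eventually_at_right_0_ex by blast
  qed
  have sgn: "w * J < 0 \<Longrightarrow> J < 0" "- (w * J) < 0 \<Longrightarrow> 0 < J" if "0 \<le> w" for w
    using that by (auto simp: mult_less_0_iff zero_less_mult_iff)
  have no_right: False if y: "0 < y" "B < csharp_fun f y" for y
  proof -
    have "J < 0" "B < at0_minus f" using right[OF y] sgn(1)[OF ab(2)] y by (auto simp: J_def)
    then obtain z where "0 < z" "B < csharp_fun f (- z)" using exL by blast
    then have "0 < J" using left sgn(2)[OF ab(1)] by blast
    with \<open>J < 0\<close> show False by simp
  qed
  have no_left: False if y: "0 < y" "B < csharp_fun f (- y)" for y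
  proof -
    have "0 < J" "B < at0_plus f" using left[OF y] sgn(2)[OF ab(1)] y by (auto simp: J_def)
    then show False using exR no_right by blast
  qed
  show ?thesis
    using no_right[of x] no_left[of "- x"] x by (cases "0 < x") (force simp: B_def)+
qed

lemma A_op_dissipative:
  assumes fh: "(f, h) \<in> A_op \<alpha> \<beta>" and ab: "0 \<le> \<alpha>" "0 \<le> \<beta>" and s: "0 < s"
  shows "norm f \<le> norm (f - s *\<^sub>R h)"
proof (rule norm_csharp_le)
  fix x :: real assume x: "x \<noteq> 0"
  have "(- f, - h) \<in> A_op \<alpha> \<beta>" using A_op_scaleR[OF fh, of "-1"] by simp
  from A_op_maximum[OF this ab s x] have "- csharp_fun f x \<le> norm (f - s *\<^sub>R h)"
    using norm_minus_commute[of f "s *\<^sub>R h"] by simp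
  with A_op_maximum[OF fh ab s x] show "\<bar>csharp_fun f x\<bar> \<le> norm (f - s *\<^sub>R h)" by simp
qed

context
  fixes T :: "real \<Rightarrow> csharp \<Rightarrow> csharp" and \<alpha> \<beta> :: real
  assumes gen: "generates_semigroup UNIV (A_op \<alpha> \<beta>) T" and ab: "0 \<le> \<alpha>" "0 \<le> \<beta>"
begin

lemma T_semigroup: "strongly_continuous_semigroup UNIV T"
  and T_generator: "semigroup_generator UNIV T = A_op \<alpha> \<beta>"
  using gen by (simp_all add: generates_semigroup_def)

lemma T_contraction:
  assumes t: "0 \<le> t"
  shows "norm (T t f) \<le> norm f"
proof -
  have "norm (T t f) \<le> 1 * norm f"
  proof (rule bounded_linear_in_bound_on_dense[OF _ subspace_UNIV, where S = "Domain (A_op \<alpha> \<beta>)"])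
    show "bounded_linear_in UNIV (T t)"
      using semigroup_bounded_linear[OF T_semigroup t] by (simp add: bounded_linear_in_UNIV)
    show "\<exists>g\<in>Domain (A_op \<alpha> \<beta>). norm (g - f) < e" if "0 < e" for e
      using semigroup_generator_dense[OF T_semigroup that, of f] by (auto simp: T_generator)
    fix g assume "g \<in> Domain (A_op \<alpha> \<beta>)"
    then obtain h where h: "(g, h) \<in> A_op \<alpha> \<beta>" by blast
    then have h': "(g, h) \<in> semigroup_generator UNIV T" by (simp add: T_generator)
    have "norm (T t g) \<le> max (norm (T 0 g)) 0"
    proof (rule dissipative_norm_bound[OF _ _ _ _ t])
      show "norm (T r g) \<le> norm (T r g - s *\<^sub>R T r h)" if "0 < r" "0 < s" for r s
        using semigroup_generator_invariant[OF T_semigroup h', of r] that ab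
        by (intro A_op_dissipative[where \<alpha> = \<alpha> and \<beta> = \<beta>]) (auto simp: T_generator)
    qed (use semigroup_continuous[OF T_semigroup] semigroup_orbit_derivative[OF T_semigroup h'] in auto)
    then show "norm (T t g) \<le> 1 * norm g" by (simp add: semigroup_0[OF T_semigroup])
  qed auto
  then show ?thesis by simp
qed

text \<open>The difference from the orbit of \<open>u 0\<close> starts at 0 and cannot grow, by
  dissipativity. This identifies explicitly known orbits.\<close>

lemma T_unique:
  assumes u: "continuous_on {0..} u" and B: "continuous_on {0..} B"
    and deriv: "\<And>t. 0 \<le> t \<Longrightarrow> ((\<lambda>h. (1 / h) *\<^sub>R (u (t + h) - u t)) \<longlongrightarrow> B t) (at_right 0)"
    and dom: "\<And>t. 0 \<le> t \<Longrightarrow> (u t, B t) \<in> A_op \<alpha> \<beta>" and t: "0 \<le> t"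
  shows "T t (u 0) = u t"
proof -
  have h': "(u 0, B 0) \<in> semigroup_generator UNIV T" using dom[of 0] by (simp add: T_generator)
  have "norm (u t - T t (u 0)) \<le> max (norm (u 0 - T 0 (u 0))) 0"
  proof (rule dissipative_norm_bound[OF _ _ _ _ t, where B = "\<lambda>t. B t - T t (B 0)"])
    show "((\<lambda>h. (1 / h) *\<^sub>R ((u (t + h) - T (t + h) (u 0)) - (u t - T t (u 0)))) \<longlongrightarrow> B t - T t (B 0)) (at_right 0)"
      if "0 \<le> t" for t
      using tendsto_diff[OF deriv[OF that] semigroup_orbit_derivative[OF T_semigroup h' that]]
      by (simp add: algebra_simps)
    show "norm (u r - T r (u 0)) \<le> norm (u r - T r (u 0) - s *\<^sub>R (B r - T r (B 0)))" if "0 < r" "0 < s" for r s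
      using semigroup_generator_invariant[OF T_semigroup h', of r] dom[of r] that ab
      by (intro A_op_dissipative[where \<alpha> = \<alpha> and \<beta> = \<beta>] A_op_diff) (auto simp: T_generator)
  qed (intro continuous_on_diff u B semigroup_continuous[OF T_semigroup])+
  then show ?thesis by (simp add: semigroup_0[OF T_semigroup])
qed

end

text \<open>The slopes at 0 are the jump times \<open>\<alpha>\<close> and \<open>\<beta>\<close>,
  and interpolation bounds them. For parameters \<open>r * \<alpha>\<close>,
  \<open>r * \<beta>\<close> the jump is thus of order \<open>1 / r\<close>.\<close>

lemma A_op_jump_bound:
  assumes fh: "(f, h) \<in> A_op \<alpha> \<beta>" and ab: "0 \<le> \<alpha>" "0 \<le> \<beta>"
  shows "(\<alpha> + \<beta>) * \<bar>at0_plus f - at0_minus f\<bar> \<le> 2 * (2 * norm f + norm h)"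
proof -
  obtain g where g: "derivs f (csharp_fun g) h"
     "at0_minus g = \<alpha> * (at0_plus f - at0_minus f)" "at0_plus g = \<beta> * (at0_plus f - at0_minus f)"
    using fh by (auto simp: A_op_iff)
  have "norm g \<le> 2 * norm f + norm h"
    by (rule norm_csharp_le) (rule derivs_bound[OF g(1)])
  then have "\<bar>at0_plus g\<bar> + \<bar>at0_minus g\<bar> \<le> 2 * (2 * norm f + norm h)"
    using abs_at0_le[of g] by simp
  moreover have "\<bar>at0_plus g\<bar> = \<beta> * \<bar>at0_plus f - at0_minus f\<bar>"
    "\<bar>at0_minus g\<bar> = \<alpha> * \<bar>at0_plus f - at0_minus f\<bar>"
    unfolding g(2,3) abs_mult using ab by simp_all
  ultimately show ?thesis by (simp add: distrib_right)
qed

text \<open>Without a jump and with zero slopes at 0 the transmission conditions hold for all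
  parameters; such elements are initial values common to all the generators.\<close>

lemma A_op_0_cline:
  assumes "(f, h) \<in> A_op 0 0" "f \<in> cline"
  shows "(f, h) \<in> A_op \<alpha> \<beta>"
  using assms by (simp add: A_op_def cline_def)

lemma A_op_0_dense:
  assumes gen: "generates_semigroup UNIV (A_op \<alpha> \<beta>) T" and f: "f \<in> cline" and e: "0 < e"
  shows "\<exists>g h. (g, h) \<in> A_op 0 0 \<and> g \<in> cline \<and> norm (g - f) < e"
proof -
  have T: "strongly_continuous_semigroup UNIV T" and A: "semigroup_generator UNIV T = A_op \<alpha> \<beta>"
    using gen by (simp_all add: generates_semigroup_def)
  define J where "J u = at0_plus u - at0_minus u" for u
  have J_lin: "bounded_linear J" unfolding J_def by (rule bounded_linear_jump)
  note J = linear_diff[OF bounded_linear.linear[OF J_lin]] linear_scale[OF bounded_linear.linear[OF J_lin]]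
  have flat: "(u, v) \<in> A_op 0 0 \<and> u \<in> cline" if "(u, v) \<in> A_op \<alpha> \<beta>" "J u = 0" for u v
    using that by (simp add: A_op_def cline_def J_def)
  \<comment> \<open>\<open>b\<close> is normalised to unit jump, so that
    \<open>u - J u *\<^sub>R b\<close> has none; if no element of the domain has a jump, any
    \<open>b\<close> will do.\<close>
  have "\<exists>b d. (b, d) \<in> A_op \<alpha> \<beta> \<and> (\<forall>u v. (u, v) \<in> A_op \<alpha> \<beta> \<longrightarrow> J (u - J u *\<^sub>R b) = 0)"
  proof (cases "\<exists>b d. (b, d) \<in> A_op \<alpha> \<beta> \<and> J b \<noteq> 0")
    case True
    then obtain b d where "(b, d) \<in> A_op \<alpha> \<beta>" "J b \<noteq> 0" by blast
    then show ?thesis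
      by (intro exI[of _ "(1 / J b) *\<^sub>R b"] exI[of _ "(1 / J b) *\<^sub>R d"]) (simp add: A_op_scaleR J)
  next
    case False
    obtain g h where "(g, h) \<in> A_op \<alpha> \<beta>" using semigroup_generator_dense[OF T e] A by blast
    with False show ?thesis by (intro exI[of _ g] exI[of _ h]) (auto simp: J)
  qed
  then obtain b d where b: "(b, d) \<in> A_op \<alpha> \<beta>"
    "\<And>u v. (u, v) \<in> A_op \<alpha> \<beta> \<Longrightarrow> J (u - J u *\<^sub>R b) = 0" by blast
  \<comment> \<open>Since \<open>J f = 0\<close>, an approximant \<open>g\<close> within \<eta> of
    \<open>f\<close> has jump at most \<open>2 * \<eta>\<close>, whose removal costs
    \<open>2 * \<eta> * norm b\<close>.\<close>
  define \<eta> where "\<eta> = e / (1 + 2 * norm b)"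
  have \<eta>: "0 < \<eta>" "\<eta> + 2 * \<eta> * norm b = e"
  proof -
    have p: "0 < 1 + 2 * norm b" by (simp add: add_pos_nonneg)
    then show "0 < \<eta>" using e by (simp add: \<eta>_def)
    have "\<eta> * (1 + 2 * norm b) = e" using p by (simp add: \<eta>_def)
    then show "\<eta> + 2 * \<eta> * norm b = e" by (simp add: algebra_simps)
  qed
  obtain g h where g: "(g, h) \<in> A_op \<alpha> \<beta>" "norm (g - f) < \<eta>"
    using semigroup_generator_dense[OF T \<eta>(1), of f] A by auto
  have "J g = J (g - f)" using f by (simp add: J(1)) (simp add: J_def cline_def)
  then have "\<bar>J g\<bar> \<le> 2 * \<eta>"
    using abs_at0_le[of "g - f"] g(2) by (simp add: J_def)
  then have "norm (g - f) + \<bar>J g\<bar> * norm b < \<eta> + 2 * \<eta> * norm b"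
    using g(2) by (intro add_less_le_mono mult_right_mono) auto
  then have "norm (g - J g *\<^sub>R b - f) < e"
    using norm_triangle_ineq4[of "g - f" "J g *\<^sub>R b"] \<eta>(2) by (simp add: algebra_simps)
  moreover have "(g - J g *\<^sub>R b, h - J g *\<^sub>R d) \<in> A_op \<alpha> \<beta>"
    by (intro A_op_diff A_op_scaleR g b)
  ultimately show ?thesis using flat b(2)[OF g(1)] by blast
qed

text \<open>A value exceeding \<open>B\<close> and \<open>c\<close> in modulus would, by
  \<open>half_line_maximum\<close> applied to \<open>w\<close> times its sign there, force both a
  nonzero boundary slope and a boundary value at least as large; \<open>bc\<close> excludes one of
  them.\<close>

lemma even_dissipative:
  fixes w k :: csharp and p :: "real \<Rightarrow> real"
  assumes even: "\<And>x. csharp_fun w x = csharp_fun w \<bar>x\<bar>"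
    and w': "\<And>x. 0 < x \<Longrightarrow> (csharp_fun w has_real_derivative p x) (at x)"
    and p': "\<And>x. 0 < x \<Longrightarrow> (p has_real_derivative csharp_fun k x) (at x)"
    and p0: "(p \<longlongrightarrow> p0) (at_right 0)"
    and bc: "p0 = 0 \<or> \<bar>at0_plus w\<bar> \<le> c" and c: "c < norm w" and s: "0 < s"
  shows "norm w \<le> norm (w - s *\<^sub>R k)"
proof (rule ccontr)
  define B where "B = norm (w - s *\<^sub>R k)"
  assume "\<not> norm w \<le> norm (w - s *\<^sub>R k)"
  with c have lt: "max B c < norm w" by (simp add: B_def)
  then obtain x0 where x0: "x0 \<noteq> 0" "max B c < \<bar>csharp_fun w x0\<bar>"
    using norm_csharp_le[of w "max B c"] by force
  define x where "x = \<bar>x0\<bar>"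
  have x: "0 < x" "max B c < \<bar>csharp_fun w x\<bar>" using x0 even[of x0] by (auto simp: x_def)
  define \<sigma> where "\<sigma> = sgn (csharp_fun w x)"
  have \<sigma>: "\<sigma> * csharp_fun w x = \<bar>csharp_fun w x\<bar>" "\<bar>\<sigma>\<bar> \<le> 1"
    by (auto simp: \<sigma>_def mult.commute mult_sgn_abs abs_sgn_eq sgn_mult_abs intro: abs_sgn[symmetric])
  have \<sigma>_le: "\<sigma> * y \<le> b" if "\<bar>y\<bar> \<le> b" for y b :: real
  proof -
    have "\<sigma> * y \<le> \<bar>\<sigma>\<bar> * \<bar>y\<bar>" by (metis abs_ge_self abs_mult)
    also have "\<dots> \<le> 1 * b" using that \<sigma>(2) by (intro mult_mono) auto
    finally show ?thesis by simp
  qed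
  have B_le: "\<sigma> * csharp_fun w y - s * (\<sigma> * csharp_fun k y) \<le> B" for y
    using \<sigma>_le[OF abs_csharp_fun_le_norm[of "w - s *\<^sub>R k" y]] by (simp add: B_def algebra_simps)
  have "\<sigma> * p0 < 0 \<and> \<sigma> * csharp_fun w x \<le> \<sigma> * at0_plus w"
    by (intro conjI; rule half_line_maximum[of "\<lambda>x. \<sigma> * csharp_fun w x" "\<lambda>x. \<sigma> * p x"
          "\<lambda>x. \<sigma> * csharp_fun k x" "norm w" "\<sigma> * at0_plus w" "\<sigma> * p0" s B x])
      (use x s \<sigma> B_le in \<open>auto intro!: DERIV_cmult w' p' tendsto_mult_left tendsto_at0_plus p0 \<sigma>_le
        abs_csharp_fun_le_norm\<close>)
  moreover have "\<sigma> * at0_plus w \<le> \<bar>at0_plus w\<bar>" by (rule \<sigma>_le) simp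
  ultimately show False using bc x \<sigma> by auto
qed

text \<open>The factor \<open>r\<close> cancels when the two transmission conditions are compared,
  leaving a flux relation shared by all the generators.\<close>

lemma A_op_derivative:
  assumes "(f, h) \<in> A_op (r * \<alpha>) (r * \<beta>)"
  shows "\<exists>q. derivs f (csharp_fun q) h \<and> \<alpha> * at0_plus q = \<beta> * at0_minus q"
  using assms unfolding A_op_iff by (metis mult.assoc mult.left_commute)

text \<open>In terms of \<open>d(x)\<close> and \<open>d(-x)\<close> for \<open>x > 0\<close>, the difference \<open>d\<close> of two orbits splits into
  \<open>\<alpha> d(x) + \<beta> d(-x)\<close>, which satisfies the Neumann condition and hence vanishes, and
  \<open>d(x) - d(-x)\<close>, whose boundary value is small.\<close>

lemma semigroup_difference:
  assumes ab: "0 \<le> \<alpha>" "0 \<le> \<beta>" "0 < \<alpha> + \<beta>" and mn: "0 < m" "0 < n"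
    and gen1: "generates_semigroup UNIV (A_op (m * \<alpha>) (m * \<beta>)) T1"
    and gen2: "generates_semigroup UNIV (A_op (n * \<alpha>) (n * \<beta>)) T2"
    and gh: "(g, h) \<in> A_op 0 0" "g \<in> cline" and t: "0 \<le> t"
  shows "norm (T1 t g - T2 t g) \<le> 2 * (2 * norm g + norm h) / (\<alpha> + \<beta>) * (1 / m + 1 / n)"
proof -
  define c where "c = 2 * (2 * norm g + norm h) / (\<alpha> + \<beta>)"
  define \<epsilon> where "\<epsilon> = c * (1 / m + 1 / n)"
  have \<epsilon>: "0 \<le> \<epsilon>" using ab mn by (simp add: \<epsilon>_def c_def)
  have ab': "0 \<le> m * \<alpha>" "0 \<le> m * \<beta>" "0 \<le> n * \<alpha>" "0 \<le> n * \<beta>" using ab mn by simp_all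
  \<comment> \<open>\<open>A_op_jump_bound\<close> at time \<open>t\<close>; contraction keeps the
    norms of \<open>T t g\<close> and \<open>T t h\<close> below those of \<open>g\<close> and
    \<open>h\<close>, so the bound is uniform in time.\<close>
  have jump: "\<bar>at0_plus (T t g) - at0_minus (T t g)\<bar> \<le> c * (1 / r)"
    if gen: "generates_semigroup UNIV (A_op (r * \<alpha>) (r * \<beta>)) T" and r: "0 < r" and t: "0 \<le> t" for T r t
  proof -
    have gen': "strongly_continuous_semigroup UNIV T" "semigroup_generator UNIV T = A_op (r * \<alpha>) (r * \<beta>)"
      using gen by (simp_all add: generates_semigroup_def)
    have "(T t g, T t h) \<in> A_op (r * \<alpha>) (r * \<beta>)"
      using semigroup_generator_invariant[OF gen'(1) _ t, of g h] A_op_0_cline[OF gh] gen'(2) by simp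
    then have "(r * \<alpha> + r * \<beta>) * \<bar>at0_plus (T t g) - at0_minus (T t g)\<bar> \<le> 2 * (2 * norm (T t g) + norm (T t h))"
      using ab r by (intro A_op_jump_bound) auto
    also have "\<dots> \<le> 2 * (2 * norm g + norm h)"
      using T_contraction[OF gen _ _ t, of g] T_contraction[OF gen _ _ t, of h] ab r by simp
    finally have "(\<alpha> + \<beta>) * r * \<bar>at0_plus (T t g) - at0_minus (T t g)\<bar> \<le> 2 * (2 * norm g + norm h)"
      by (simp add: algebra_simps)
    moreover have "0 < (\<alpha> + \<beta>) * r" using ab r by simp
    ultimately have "\<bar>at0_plus (T t g) - at0_minus (T t g)\<bar> \<le> 2 * (2 * norm g + norm h) / ((\<alpha> + \<beta>) * r)"
      by (simp only: pos_le_divide_eq mult.commute)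
    then show ?thesis by (simp add: c_def)
  qed
  have sg: "strongly_continuous_semigroup UNIV T1" "strongly_continuous_semigroup UNIV T2"
    and sgen: "semigroup_generator UNIV T1 = A_op (m * \<alpha>) (m * \<beta>)" "semigroup_generator UNIV T2 = A_op (n * \<alpha>) (n * \<beta>)"
    using gen1 gen2 by (simp_all add: generates_semigroup_def)
  define d k where "d t = T1 t g - T2 t g" and "k t = T1 t h - T2 t h" for t
  have d_cont: "continuous_on {0..} d" "continuous_on {0..} k"
    unfolding d_def k_def by (intro continuous_on_diff semigroup_continuous sg)+
  have d_deriv: "((\<lambda>s. (1 / s) *\<^sub>R (d (t + s) - d t)) \<longlongrightarrow> k t) (at_right 0)" if "0 \<le> t" for t
    using tendsto_diff[OF semigroup_orbit_derivative[OF sg(1) _ that, of g h] semigroup_orbit_derivative[OF sg(2) _ that, of g h]]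
      A_op_0_cline[OF gh] by (simp add: sgen d_def k_def algebra_simps)
  have d0: "d 0 = 0" by (simp add: d_def semigroup_0[OF sg(1)] semigroup_0[OF sg(2)])
  have d_jump: "\<bar>at0_plus (d t) - at0_minus (d t)\<bar> \<le> \<epsilon>" if "0 \<le> t" for t
    using jump[OF gen1 mn(1) that] jump[OF gen2 mn(2) that] bounded_linear_at0[THEN bounded_linear.linear]
    by (simp add: d_def linear_diff \<epsilon>_def distrib_left)
  have d_dom: "\<exists>q. derivs (d t) (csharp_fun q) (k t) \<and> \<alpha> * at0_plus q = \<beta> * at0_minus q" if t: "0 \<le> t" for t
  proof -
    have "(T1 t g, T1 t h) \<in> A_op (m * \<alpha>) (m * \<beta>)" "(T2 t g, T2 t h) \<in> A_op (n * \<alpha>) (n * \<beta>)"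
      using semigroup_generator_invariant[OF sg(1) _ t, of g h] semigroup_generator_invariant[OF sg(2) _ t, of g h]
        A_op_0_cline[OF gh] by (simp_all add: sgen)
    from A_op_derivative[OF this(1)] A_op_derivative[OF this(2)] obtain q1 q2 where q:
      "derivs (T1 t g) (csharp_fun q1) (T1 t h)" "\<alpha> * at0_plus q1 = \<beta> * at0_minus q1"
      "derivs (T2 t g) (csharp_fun q2) (T2 t h)" "\<alpha> * at0_plus q2 = \<beta> * at0_minus q2"
      by blast
    have "csharp_fun (q1 - q2) = (\<lambda>x. csharp_fun q1 x - csharp_fun q2 x)" by auto
    with derivs_lincomb[OF q(1,3), of 1 "-1"] q(2,4) show ?thesis
      using bounded_linear_at0[THEN bounded_linear.linear]
      by (intro exI[of _ "q1 - q2"]) (auto simp: d_def k_def linear_diff right_diff_distrib)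
  qed
  have main: "norm (a *\<^sub>R even_ext (d t) + b *\<^sub>R even_ext (reflect (d t))) \<le> e"
    if ab': "(a = \<alpha> \<and> b = \<beta> \<and> e = 0) \<or> (a = 1 \<and> b = -1 \<and> e = \<epsilon>)" and t: "0 \<le> t" for a b e t
  proof -
    define L where "L u = a *\<^sub>R even_ext u + b *\<^sub>R even_ext (reflect u)" for u
    have L: "bounded_linear L"
      unfolding L_def
      by (intro bounded_linear_add bounded_linear_const_scaleR bounded_linear_even_ext
          bounded_linear_compose[OF bounded_linear_even_ext bounded_linear_reflect])
    note lin = bounded_linear.linear[OF L]
    have "norm (L (d t)) \<le> max (norm (L (d 0))) e"
    proof (rule dissipative_norm_bound[OF _ _ _ _ t, where B = "\<lambda>t. L (k t)"])
      show "continuous_on {0..} (\<lambda>t. L (d t))" "continuous_on {0..} (\<lambda>t. L (k t))"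
        by (intro continuous_on_compose2[OF linear_continuous_on[OF L, of UNIV]] d_cont; simp)+
      show "((\<lambda>h. (1 / h) *\<^sub>R (L (d (r + h)) - L (d r))) \<longlongrightarrow> L (k r)) (at_right 0)" if "0 \<le> r" for r
        using bounded_linear.tendsto[OF L d_deriv[OF that]] by (simp add: linear_scale[OF lin] linear_diff[OF lin])
      fix r s :: real assume r: "0 < r" and s: "0 < s" and gt: "e < norm (L (d r))"
      obtain q where q: "derivs (d r) (csharp_fun q) (k r)" "\<alpha> * at0_plus q = \<beta> * at0_minus q"
        using d_dom[of r] r by auto
      have L_fun: "csharp_fun (L u) x = a * csharp_fun u \<bar>x\<bar> + b * csharp_fun u (- \<bar>x\<bar>)" for u x
        by (simp add: L_def)
      define p where "p x = a * csharp_fun q x - b * csharp_fun q (- x)" for x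
      show "norm (L (d r)) \<le> norm (L (d r) - s *\<^sub>R L (k r))"
      proof (rule even_dissipative[OF _ _ _ _ _ gt s, where p = p])
        show "csharp_fun (L (d r)) x = csharp_fun (L (d r)) \<bar>x\<bar>" for x by (simp add: L_fun)
      next
        fix x :: real assume x: "0 < x"
        have "((\<lambda>x. a * csharp_fun (d r) x + b * csharp_fun (d r) (- x)) has_real_derivative p x) (at x)"
          using DERIV_add[OF DERIV_cmult[OF derivsD(1)[OF q(1)], of x a]
            DERIV_cmult[OF DERIV_mirror[THEN iffD1, OF derivsD(1)[OF q(1)]], of x b]] x
          by (simp add: p_def)
        then show "(csharp_fun (L (d r)) has_real_derivative p x) (at x)"
          by (rule has_field_derivative_transform_within_open[where S = "{0<..}"]) (use x in \<open>auto simp: L_fun\<close>)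
        show "(p has_real_derivative csharp_fun (L (k r)) x) (at x)"
          unfolding p_def
          using DERIV_diff[OF DERIV_cmult[OF derivsD(2)[OF q(1)], of x a]
            DERIV_cmult[OF DERIV_mirror[THEN iffD1, OF derivsD(2)[OF q(1)]], of x b]] x
          by (simp add: L_fun)
      next
        show "(p \<longlongrightarrow> a * at0_plus q - b * at0_minus q) (at_right 0)"
          unfolding p_def using tendsto_at0_minus[of q]
          by (intro tendsto_intros tendsto_at0_plus) (simp add: filterlim_at_left_to_right)
        have "at0_plus (L (d r)) = a * at0_plus (d r) + b * at0_minus (d r)"
        proof (rule at0_eqI(1))
          have "((\<lambda>x. a * csharp_fun (d r) x + b * csharp_fun (d r) (- x)) \<longlongrightarrow> a * at0_plus (d r) + b * at0_minus (d r)) (at_right 0)"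
            using tendsto_at0_minus[of "d r"]
            by (intro tendsto_intros tendsto_at0_plus) (simp add: filterlim_at_left_to_right)
          then show "(csharp_fun (L (d r)) \<longlongrightarrow> a * at0_plus (d r) + b * at0_minus (d r)) (at_right 0)"
            by (rule Lim_transform_eventually) (simp add: eventually_at_filter L_fun)
        qed
        then show "a * at0_plus q - b * at0_minus q = 0 \<or> \<bar>at0_plus (L (d r))\<bar> \<le> e"
          using ab' q(2) d_jump[of r] r by auto
      qed
    qed
    then show ?thesis
      using linear_0[OF lin] ab' \<epsilon> by (auto simp: d0 L_def)
  qed
  have E: "\<alpha> * csharp_fun (d t) x + \<beta> * csharp_fun (d t) (- x) = 0"
    and V: "\<bar>csharp_fun (d t) x - csharp_fun (d t) (- x)\<bar> \<le> \<epsilon>" if x: "0 < x" for x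
    using order_trans[OF abs_csharp_fun_le_norm main[of \<alpha> \<beta> 0 t], of x]
      order_trans[OF abs_csharp_fun_le_norm main[of 1 "-1" \<epsilon> t], of x] t x by simp_all
  have "norm (d t) \<le> \<epsilon>"
  proof (rule norm_csharp_le_wave[where t = 0])
    fix x :: real assume x: "0 < x"
    define v where "v = csharp_fun (d t) x - csharp_fun (d t) (- x)"
    have "\<bar>\<beta> / (\<alpha> + \<beta>) * v\<bar> \<le> \<epsilon>" "\<bar>\<alpha> / (\<alpha> + \<beta>) * v\<bar> \<le> \<epsilon>"
      using V[OF x] ab by (auto intro!: weight_mult_le[of _ 1] simp: v_def simp del: abs_mult times_divide_eq_left)
    moreover have "csharp_fun (d t) x = \<beta> / (\<alpha> + \<beta>) * v" "csharp_fun (d t) (- x) = - (\<alpha> / (\<alpha> + \<beta>) * v)"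
      using E[OF x] ab by (simp_all add: v_def field_simps)
    ultimately show "\<bar>csharp_fun (d t) x\<bar> \<le> \<epsilon> \<and> \<bar>csharp_fun (d t) (- x)\<bar> \<le> \<epsilon>"
      by (simp only: abs_minus_cancel)
  qed
  then show ?thesis by (simp add: d_def \<epsilon>_def c_def)
qed

section \<open>Convergence of the semigroups on the whole space\<close>

definition puncture :: "(real \<Rightarrow> real) \<Rightarrow> csharp" where
  "puncture \<phi> = Csharp (\<lambda>x. if x = 0 then 0 else \<phi> x)"

lemma puncture:
  assumes cont: "continuous_on UNIV \<phi>" and lim: "(\<phi> \<longlongrightarrow> a) at_bot" "(\<phi> \<longlongrightarrow> b) at_top"
  shows "csharp_fun (puncture \<phi>) x = (if x = 0 then 0 else \<phi> x)"
    and "at0_plus (puncture \<phi>) = \<phi> 0" "at0_minus (puncture \<phi>) = \<phi> 0"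
proof -
  let ?\<psi> = "\<lambda>x. if x = 0 then 0 else \<phi> x"
  have c: "isCont \<phi> x" for x using cont by (simp add: continuous_on_eq_continuous_at)
  have at0: "(?\<psi> \<longlongrightarrow> \<phi> 0) (at 0)"
    using c[of 0] unfolding isCont_def
    by (rule Lim_transform_eventually) (simp add: eventually_at_filter)
  then have at0': "(?\<psi> \<longlongrightarrow> \<phi> 0) (at_left 0)" "(?\<psi> \<longlongrightarrow> \<phi> 0) (at_right 0)"
    by (auto intro: tendsto_within_subset)
  have "csharp_fun (Csharp ?\<psi>) = ?\<psi>"
  proof (rule csharp_fun_CsharpI[OF _ _ at0'])
    fix x :: real assume x: "x \<noteq> 0"
    have "\<forall>\<^sub>F y in nhds x. ?\<psi> y = \<phi> y"
      using x by (intro eventually_nhds_in_open[THEN eventually_mono, of "- {0}"]) auto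
    then show "isCont ?\<psi> x" using c[of x] by (simp add: isCont_cong)
  next
    show "(?\<psi> \<longlongrightarrow> a) at_bot"
      by (rule Lim_transform_eventually[OF lim(1)], rule eventually_mono[OF eventually_le_at_bot[of "-1"]]) auto
    show "(?\<psi> \<longlongrightarrow> b) at_top"
      by (rule Lim_transform_eventually[OF lim(2)], rule eventually_mono[OF eventually_ge_at_top[of 1]]) auto
  qed simp
  then have eq: "csharp_fun (puncture \<phi>) = ?\<psi>" by (simp add: puncture_def)
  then show "csharp_fun (puncture \<phi>) x = ?\<psi> x" by simp
  show "at0_plus (puncture \<phi>) = \<phi> 0" "at0_minus (puncture \<phi>) = \<phi> 0"
    by (rule at0_eqI; simp add: eq at0')+
qed

lemma puncture_A_op:
  assumes \<phi>': "\<And>x. (\<phi> has_real_derivative \<phi>' x) (at x)" and \<phi>'': "\<And>x. (\<phi>' has_real_derivative \<phi>'' x) (at x)"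
    and cont: "continuous_on UNIV \<phi>''" and 0: "\<phi>' 0 = 0"
    and lim: "(\<phi> \<longlongrightarrow> a) at_bot" "(\<phi> \<longlongrightarrow> b) at_top" "(\<phi>' \<longlongrightarrow> a') at_bot" "(\<phi>' \<longlongrightarrow> b') at_top"
      "(\<phi>'' \<longlongrightarrow> a'') at_bot" "(\<phi>'' \<longlongrightarrow> b'') at_top"
  shows "(puncture \<phi>, puncture \<phi>'') \<in> A_op \<alpha> \<beta>"
proof -
  have "continuous_on UNIV \<phi>" "continuous_on UNIV \<phi>'"
    using DERIV_isCont[OF \<phi>'] DERIV_isCont[OF \<phi>''] by (auto intro: continuous_at_imp_continuous_on)
  note f = puncture[OF this(1) lim(1,2)] and g = puncture[OF this(2) lim(3,4)] and h = puncture[OF cont lim(5,6)]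
  have tr: "(csharp_fun u has_real_derivative d) (at x)"
    if "(\<psi> has_real_derivative d) (at x)" "\<And>y. csharp_fun u y = (if y = 0 then 0 else \<psi> y)" "x \<noteq> 0" for u \<psi> d x
    by (rule has_field_derivative_transform_within_open[OF that(1), of "- {0}"]) (use that(2,3) in auto)
  show ?thesis
    unfolding A_op_iff derivs_def
  proof (intro exI[of _ "puncture \<phi>'"] conjI allI impI)
    fix x :: real assume x: "x \<noteq> 0"
    show "(csharp_fun (puncture \<phi>) has_real_derivative csharp_fun (puncture \<phi>') x) (at x)"
      using tr[OF \<phi>' f(1) x] x by (simp add: g(1))
    show "(csharp_fun (puncture \<phi>') has_real_derivative csharp_fun (puncture \<phi>'') x) (at x)"
      using tr[OF \<phi>'' g(1) x] x by (simp add: h(1))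
  qed (simp_all add: f g 0)
qed

text \<open>Constants are invariant. For nonnegative \<open>f\<close>,
  \<open>norm f *\<^sub>R one - f\<close> has norm at most \<open>norm f\<close>; contraction
  preserves this for \<open>T t f\<close>, whose values therefore cannot be negative.\<close>

lemma semigroup_positive:
  assumes gen: "generates_semigroup UNIV (A_op \<alpha> \<beta>) T" and ab: "0 \<le> \<alpha>" "0 \<le> \<beta>" and t: "0 \<le> t"
    and f: "\<And>x. 0 \<le> csharp_fun f x"
  shows "0 \<le> csharp_fun (T t f) x"
proof (cases "x = 0")
  case False
  define one where "one = puncture (\<lambda>_. 1)"
  have one: "csharp_fun one x = (if x = 0 then 0 else 1)" for x
    unfolding one_def by (rule puncture) (auto intro: tendsto_const)
  have "puncture (\<lambda>_. 0) = 0" by (simp add: puncture_def zero_csharp_def)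
  moreover have "(one, puncture (\<lambda>_. 0)) \<in> A_op \<alpha> \<beta>"
    unfolding one_def by (rule puncture_A_op[where \<phi>' = "\<lambda>_. 0"]) (auto intro: tendsto_const)
  ultimately have "(one, 0) \<in> A_op \<alpha> \<beta>" by simp
  then have T1: "T t one = one"
    by (intro T_unique[OF gen ab _ _ _ _ t, of "\<lambda>_. one" "\<lambda>_. 0"]) auto
  have lin: "linear (T t)"
    using semigroup_bounded_linear[OF T_semigroup[OF gen ab] t] by (rule bounded_linear.linear)
  have "norm (norm f *\<^sub>R one - f) \<le> norm f"
  proof (rule norm_csharp_le)
    show "\<bar>csharp_fun (norm f *\<^sub>R one - f) y\<bar> \<le> norm f" if "y \<noteq> 0" for y
      using f[of y] abs_csharp_fun_le_norm[of f y] that by (simp add: one)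
  qed
  then have "norm (norm f *\<^sub>R one - T t f) \<le> norm f"
    using T_contraction[OF gen ab t, of "norm f *\<^sub>R one - f"]
    by (simp add: linear_diff[OF lin] linear_scale[OF lin] T1)
  then have "\<bar>norm f - csharp_fun (T t f) x\<bar> \<le> norm f"
    using abs_csharp_fun_le_norm[of "norm f *\<^sub>R one - T t f" x] False by (simp add: one)
  then show ?thesis by simp
qed simp

text \<open>Up to the factor \<open>\<surd>(4 \<pi>)\<close>, the heat kernel at time \<open>\<tau>\<close>. It is even and smooth, and so in the
  domain of \<open>A_op \<alpha> \<beta>\<close> for all \<open>\<alpha>\<close>, \<open>\<beta>\<close>.\<close>

definition heat :: "real \<Rightarrow> real \<Rightarrow> real" where
  "heat \<tau> x = exp (- (x\<^sup>2 / (4 * \<tau>))) / sqrt \<tau>"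

text \<open>The second \<open>x\<close>-derivative of \<open>heat\<close>, and by the heat equation
  also its \<tau>-derivative.\<close>

definition heat2 :: "real \<Rightarrow> real \<Rightarrow> real" where
  "heat2 \<tau> x = (x\<^sup>2 / (4 * \<tau>\<^sup>2) - 1 / (2 * \<tau>)) * heat \<tau> x"

text \<open>The \<tau>-derivative of \<open>heat2\<close>, that is, the fourth
  \<open>x\<close>-derivative of \<open>heat\<close>.\<close>

definition heat4 :: "real \<Rightarrow> real \<Rightarrow> real" where
  "heat4 \<tau> x = ((x\<^sup>2 / (4 * \<tau>\<^sup>2) - 1 / (2 * \<tau>))\<^sup>2 - x\<^sup>2 / (2 * \<tau> ^ 3) + 1 / (2 * \<tau>\<^sup>2)) * heat \<tau> x"

lemma heat_x:
  assumes "0 < \<tau>"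
  shows "(heat \<tau> has_real_derivative - x / (2 * \<tau>) * heat \<tau> x) (at x)"
    and "((\<lambda>x. - x / (2 * \<tau>) * heat \<tau> x) has_real_derivative heat2 \<tau> x) (at x)"
  using assms unfolding heat2_def heat_def
  by (auto intro!: derivative_eq_intros simp: field_simps power2_eq_square)

lemma heat_\<tau>:
  assumes "0 < \<tau>"
  shows "((\<lambda>\<tau>. heat \<tau> x) has_real_derivative heat2 \<tau> x) (at \<tau>)"
proof -
  have "sqrt \<tau> * sqrt \<tau> = \<tau>" using assms by simp
  then show ?thesis
    using assms unfolding heat2_def heat_def
    by (auto intro!: derivative_eq_intros simp: field_simps power2_eq_square)
qed

lemma heat2_\<tau>:
  assumes "0 < \<tau>"
  shows "((\<lambda>\<tau>. heat2 \<tau> x) has_real_derivative heat4 \<tau> x) (at \<tau>)"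
proof -
  have "((\<lambda>\<tau>. x\<^sup>2 / (4 * \<tau>\<^sup>2) - 1 / (2 * \<tau>)) has_real_derivative - x\<^sup>2 / (2 * \<tau> ^ 3) + 1 / (2 * \<tau>\<^sup>2)) (at \<tau>)"
    using assms by (auto intro!: derivative_eq_intros simp: field_simps power2_eq_square power3_eq_cube)
  from DERIV_mult[OF this heat_\<tau>[OF assms, of x]] show ?thesis
    unfolding heat2_def[of _ x, abs_def] heat4_def
    by (rule DERIV_cong) (simp add: heat2_def power2_eq_square algebra_simps)
qed

text \<open>In the variable \<open>y = x\<^sup>2 / (4 * \<tau>)\<close> both functions are a
  polynomial times \<open>exp (- y)\<close> over a power of \<open>sqrt \<tau>\<close>; the
  quadratic Taylor bound for \<open>exp y\<close> gives the constants 6 and 2.\<close>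

lemma heat4_bound:
  assumes "0 < \<delta>" "\<delta> \<le> \<tau>"
  shows "\<bar>heat4 \<tau> x\<bar> \<le> 6 / (\<delta>\<^sup>2 * sqrt \<delta>)" and "\<bar>heat2 \<tau> x\<bar> \<le> 2 / (\<delta> * sqrt \<delta>)"
proof -
  define y where "y = x\<^sup>2 / (4 * \<tau>)"
  have \<tau>: "0 < \<tau>" using assms by simp
  have y: "0 \<le> y" using \<tau> by (simp add: y_def)
  have e: "1 + y + y\<^sup>2 / 2 \<le> exp y" using exp_lower_Taylor_quadratic[OF y] .
  have "y\<^sup>2 + 3 * y + 3 / 4 \<le> 6 * exp y" "y + 1 / 2 \<le> 2 * exp y"
    using e y zero_le_power2[of y] by linarith+
  then have e1: "(y\<^sup>2 + 3 * y + 3 / 4) * exp (- y) \<le> 6" "(y + 1 / 2) * exp (- y) \<le> 2"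
    by (simp_all add: exp_minus pos_divide_le_eq flip: divide_inverse)
  have h: "heat \<tau> x = exp (- y) / sqrt \<tau>" by (simp add: heat_def y_def)
  have eq4: "heat4 \<tau> x = (y\<^sup>2 - 3 * y + 3 / 4) * exp (- y) / (\<tau>\<^sup>2 * sqrt \<tau>)"
    unfolding heat4_def h using \<tau> by (simp add: y_def field_simps power2_eq_square power3_eq_cube)
  have eq2: "heat2 \<tau> x = (y - 1 / 2) * exp (- y) / (\<tau> * sqrt \<tau>)"
    unfolding heat2_def h using \<tau> by (simp add: y_def field_simps power2_eq_square)
  have "\<bar>(y\<^sup>2 - 3 * y + 3 / 4) * exp (- y)\<bar> \<le> (y\<^sup>2 + 3 * y + 3 / 4) * exp (- y)"
    unfolding abs_mult using y by (intro mult_mono) (auto simp: abs_le_iff)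
  then have "\<bar>heat4 \<tau> x\<bar> \<le> 6 / (\<tau>\<^sup>2 * sqrt \<tau>)"
    unfolding eq4 abs_divide using e1(1) \<tau> by (simp add: divide_right_mono)
  also have "\<dots> \<le> 6 / (\<delta>\<^sup>2 * sqrt \<delta>)"
    using assms by (intro divide_left_mono mult_mono power_mono) auto
  finally show "\<bar>heat4 \<tau> x\<bar> \<le> 6 / (\<delta>\<^sup>2 * sqrt \<delta>)" .
  have "\<bar>(y - 1 / 2) * exp (- y)\<bar> \<le> (y + 1 / 2) * exp (- y)"
    unfolding abs_mult using y by (intro mult_mono) (auto simp: abs_le_iff)
  then have "\<bar>heat2 \<tau> x\<bar> \<le> 2 / (\<tau> * sqrt \<tau>)"
    unfolding eq2 abs_divide using e1(2) \<tau> by (simp add: divide_right_mono)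
  also have "\<dots> \<le> 2 / (\<delta> * sqrt \<delta>)"
    using assms by (intro divide_left_mono mult_mono) auto
  finally show "\<bar>heat2 \<tau> x\<bar> \<le> 2 / (\<delta> * sqrt \<delta>)" .
qed

lemma heat_limits:
  assumes "0 < \<tau>"
  shows "(heat \<tau> \<longlongrightarrow> 0) at_bot" "(heat \<tau> \<longlongrightarrow> 0) at_top"
    "((\<lambda>x. - x / (2 * \<tau>) * heat \<tau> x) \<longlongrightarrow> 0) at_bot" "((\<lambda>x. - x / (2 * \<tau>) * heat \<tau> x) \<longlongrightarrow> 0) at_top"
    "(heat2 \<tau> \<longlongrightarrow> 0) at_bot" "(heat2 \<tau> \<longlongrightarrow> 0) at_top"
  using assms unfolding heat2_def[abs_def] heat_def[abs_def] by real_asymp+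

lemma heat_continuous:
  assumes "0 < \<tau>" shows "continuous_on UNIV (heat \<tau>)" "continuous_on UNIV (heat2 \<tau>)"
  using assms unfolding heat2_def[abs_def] heat_def[abs_def] by (auto intro!: continuous_intros)

lemma csharp_fun_heat:
  assumes "0 < \<tau>"
  shows "csharp_fun (puncture (heat \<tau>)) x = (if x = 0 then 0 else heat \<tau> x)"
    and "csharp_fun (puncture (heat2 \<tau>)) x = (if x = 0 then 0 else heat2 \<tau> x)"
    and "at0_plus (puncture (heat \<tau>)) = 1 / sqrt \<tau>" "at0_minus (puncture (heat \<tau>)) = 1 / sqrt \<tau>"
  using puncture[OF heat_continuous(1)[OF assms] heat_limits(1,2)[OF assms]]
    puncture[OF heat_continuous(2)[OF assms] heat_limits(5,6)[OF assms]]
  by (simp_all add: heat_def)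

text \<open>Starting at \<delta> > 0 keeps away from the singular time; bounds on the time
  derivatives uniform in \<open>x\<close> make the kernel differentiable in norm, and
  \<open>T_unique\<close> applies.\<close>

lemma semigroup_heat:
  assumes gen: "generates_semigroup UNIV (A_op \<alpha> \<beta>) T" and ab: "0 \<le> \<alpha>" "0 \<le> \<beta>"
    and \<delta>: "0 < \<delta>" and t: "0 \<le> t"
  shows "T t (puncture (heat \<delta>)) = puncture (heat (\<delta> + t))"
proof -
  define C where "C = 6 / (\<delta>\<^sup>2 * sqrt \<delta>)"
  define C' where "C' = 2 / (\<delta> * sqrt \<delta>)"
  have C: "0 \<le> C" "0 \<le> C'" using \<delta> by (simp_all add: C_def C'_def)
  have lip: "\<bar>u s - u r\<bar> \<le> K * \<bar>s - r\<bar>"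
    if "\<And>s. 0 \<le> s \<Longrightarrow> (u has_real_derivative v s) (at s)" "\<And>s. 0 \<le> s \<Longrightarrow> \<bar>v s\<bar> \<le> K" "0 \<le> s" "0 \<le> r"
    for u v :: "real \<Rightarrow> real" and s r K
    using field_differentiable_bound[of "{0..}" u v K s r] that
    by (auto intro: has_field_derivative_at_within)
  have d: "((\<lambda>t. heat (\<delta> + t) x) has_real_derivative heat2 (\<delta> + s) x) (at s)"
    "((\<lambda>t. heat2 (\<delta> + t) x) has_real_derivative heat4 (\<delta> + s) x) (at s)" if "0 \<le> s" for s x
    using DERIV_shift[of "\<lambda>\<tau>. heat \<tau> x" _ s \<delta>] DERIV_shift[of "\<lambda>\<tau>. heat2 \<tau> x" _ s \<delta>]
      heat_\<tau>[of "s + \<delta>" x] heat2_\<tau>[of "s + \<delta>" x] that \<delta> by (simp_all add: add.commute)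
  have b: "\<bar>heat2 (\<delta> + s) x\<bar> \<le> C'" "\<bar>heat4 (\<delta> + s) x\<bar> \<le> C" if "0 \<le> s" for s x
    using heat4_bound[OF \<delta>, of "\<delta> + s" x] that by (simp_all add: C_def C'_def)
  have lip1: "\<bar>heat (\<delta> + s) x - heat (\<delta> + r) x\<bar> \<le> C' * \<bar>s - r\<bar>"
    and lip2: "\<bar>heat2 (\<delta> + s) x - heat2 (\<delta> + r) x\<bar> \<le> C * \<bar>s - r\<bar>" if "0 \<le> s" "0 \<le> r" for s r x
    using lip[OF d(1) b(1) that] lip[OF d(2) b(2) that] by simp_all
  define Z W where "Z s = puncture (heat (\<delta> + s))" and "W s = puncture (heat2 (\<delta> + s))" for s
  have ZW: "csharp_fun (Z s) x = (if x = 0 then 0 else heat (\<delta> + s) x)"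
    "csharp_fun (W s) x = (if x = 0 then 0 else heat2 (\<delta> + s) x)" if "0 \<le> s" for s x
    using that \<delta> by (simp_all add: Z_def W_def csharp_fun_heat)
  have "T t (Z 0) = Z t"
  proof (rule T_unique[OF gen ab _ _ _ _ t, of Z W])
    have l1: "norm (Z s - Z r) \<le> C' * \<bar>s - r\<bar>"
      and l2: "norm (W s - W r) \<le> C * \<bar>s - r\<bar>" if "0 \<le> s" "0 \<le> r" for s r
      using lip1[OF that] lip2[OF that] that by (auto intro!: norm_csharp_le simp: ZW)
    show "continuous_on {0..} Z"
      using l1 C by (intro lipschitz_on_continuous_on[of C'] lipschitz_onI) (auto simp: dist_norm)
    show "continuous_on {0..} W"
      using l2 C by (intro lipschitz_on_continuous_on[of C] lipschitz_onI) (auto simp: dist_norm)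
    show "(Z s, W s) \<in> A_op \<alpha> \<beta>" if "0 \<le> s" for s
      unfolding Z_def W_def using that \<delta>
      by (intro puncture_A_op[OF heat_x(1,2) heat_continuous(2) _ heat_limits]) auto
    fix s :: real assume s: "0 \<le> s"
    have "norm ((1 / r) *\<^sub>R (Z (s + r) - Z s) - W s) \<le> C * r"
      if r: "0 < r" for r
    proof (rule norm_csharp_le)
      fix x :: real assume x: "x \<noteq> 0"
      obtain q where q: "s < q" "q < s + r"
        "heat (\<delta> + (s + r)) x - heat (\<delta> + s) x = (s + r - s) * heat2 (\<delta> + q) x"
        using MVT2[of s "s + r" "\<lambda>t. heat (\<delta> + t) x" "\<lambda>q. heat2 (\<delta> + q) x", OF _ d(1)] r s by auto
      have "(1 / r) * (heat (\<delta> + (s + r)) x - heat (\<delta> + s) x) - heat2 (\<delta> + s) x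
          = heat2 (\<delta> + q) x - heat2 (\<delta> + s) x"
        using q(3) r by simp
      also have "\<bar>\<dots>\<bar> \<le> C * \<bar>q - s\<bar>" using q s by (intro lip2) auto
      also have "\<dots> \<le> C * r" using q C by (intro mult_left_mono) auto
      finally show "\<bar>csharp_fun ((1 / r) *\<^sub>R (Z (s + r) - Z s) - W s) x\<bar> \<le> C * r"
        using x s r by (simp add: ZW)
    qed
    then have "\<forall>\<^sub>F r in at_right 0. norm ((1 / r) *\<^sub>R (Z (s + r) - Z s) - W s) \<le> C * r"
      by (simp add: eventually_at_filter)
    moreover have "((\<lambda>r. C * r) \<longlongrightarrow> 0) (at_right 0)"
      by (rule tendsto_eq_intros refl | simp)+
    ultimately have "((\<lambda>r. (1 / r) *\<^sub>R (Z (s + r) - Z s)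
        - W s) \<longlongrightarrow> 0) (at_right 0)"
      by (rule Lim_null_comparison)
    then show "((\<lambda>r. (1 / r) *\<^sub>R (Z (s + r) - Z s))
        \<longlongrightarrow> W s) (at_right 0)"
      by (rule LIM_zero_cancel)
  qed
  then show ?thesis by (simp add: Z_def)
qed

definition csharp_mult :: "csharp \<Rightarrow> csharp \<Rightarrow> csharp" where
  "csharp_mult f g = Csharp (\<lambda>x. csharp_fun f x * csharp_fun g x)"

lemma csharp_fun_mult [simp]: "csharp_fun (csharp_mult f g) x = csharp_fun f x * csharp_fun g x"
proof -
  have "csharp_fun (csharp_mult f g) = (\<lambda>x. csharp_fun f x * csharp_fun g x)"
    unfolding csharp_mult_def
  proof (rule csharp_fun_Csharp)
    show "continuous_on (- {0}) (\<lambda>x. csharp_fun f x * csharp_fun g x)"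
      by (intro continuous_intros csharp_fun_continuous)
    show "\<exists>l. ((\<lambda>x. csharp_fun f x * csharp_fun g x) \<longlongrightarrow> l) F" if "F \<in> sharp_ends" for F
      using csharp_fun_limits[OF that, of f] csharp_fun_limits[OF that, of g] tendsto_mult by blast
  qed simp
  then show ?thesis by simp
qed

lemma at0_mult: "at0_plus (csharp_mult f g) = at0_plus f * at0_plus g"
  "at0_minus (csharp_mult f g) = at0_minus f * at0_minus g"
  using tendsto_mult[OF tendsto_at0_plus[of f] tendsto_at0_plus[of g]]
    tendsto_mult[OF tendsto_at0_minus[of f] tendsto_at0_minus[of g]]
  by (auto intro!: at0_eqI simp: csharp_fun_mult[abs_def])

text \<open>Multiplication by a narrow bump splits off the jump of \<open>f\<close>; by positivity the orbit of the bump,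
  which does not depend on \<open>\<alpha>\<close> and \<open>\<beta>\<close>, bounds the orbit of that part.\<close>

lemma split_jump:
  assumes a: "0 < a" and e: "0 < e"
  obtains g where "f - g \<in> cline"
    "\<And>\<alpha> \<beta> T t. generates_semigroup UNIV (A_op \<alpha> \<beta>) T \<Longrightarrow> 0 \<le> \<alpha> \<Longrightarrow> 0 \<le> \<beta> \<Longrightarrow> a \<le> t \<Longrightarrow>
      norm (T t g) \<le> e"
proof -
  define r where "r = e / (norm f + 1)"
  have r: "0 < r" "norm f * r \<le> e"
  proof -
    have p: "0 < norm f + 1" by (simp add: add_nonneg_pos)
    then show "0 < r" using e by (simp add: r_def)
    have "norm f * r + r = e" using p by (simp add: r_def add_divide_distrib[symmetric] field_simps)
    with \<open>0 < r\<close> show "norm f * r \<le> e" by simp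
  qed
  \<comment> \<open>From time \<open>a\<close> on, the bump has height at most
    \<open>sqrt \<delta> / sqrt a = r\<close>.\<close>
  define \<delta> where "\<delta> = a * r\<^sup>2"
  have \<delta>: "0 < \<delta>" "sqrt \<delta> = sqrt a * r" using a r by (simp_all add: \<delta>_def real_sqrt_mult)
  \<comment> \<open>Scaled to the value 1 at 0, so that \<open>f - g\<close> has boundary value 0
    from both sides.\<close>
  define p where "p = sqrt \<delta> *\<^sub>R puncture (heat \<delta>)"
  define g where "g = csharp_mult f p"
  have p0: "0 \<le> csharp_fun p x" for x
    using \<delta> by (simp add: p_def csharp_fun_heat heat_def)
  have at0p: "at0_plus p = 1" "at0_minus p = 1"
    using \<delta> a r bounded_linear_at0[THEN bounded_linear.linear]
    by (simp_all add: p_def linear_scale csharp_fun_heat)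
  have "f - g \<in> cline"
    using bounded_linear_at0[THEN bounded_linear.linear]
    by (simp add: cline_def g_def linear_diff at0_mult at0p)
  moreover have "norm (T t g) \<le> e"
    if gen: "generates_semigroup UNIV (A_op \<alpha> \<beta>) T" and ab: "0 \<le> \<alpha>" "0 \<le> \<beta>" and t: "a \<le> t" for \<alpha> \<beta> T t
  proof (rule norm_csharp_le)
    fix x :: real assume x: "x \<noteq> 0"
    have t0: "0 \<le> t" using a t by simp
    have lin: "linear (T t)"
      using semigroup_bounded_linear[OF T_semigroup[OF gen ab] t0] by (rule bounded_linear.linear)
    have "0 \<le> csharp_fun (T t (norm f *\<^sub>R p - g)) x"
    proof (rule semigroup_positive[OF gen ab t0])
      show "0 \<le> csharp_fun (norm f *\<^sub>R p - g) y" for y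
        using mult_right_mono[OF abs_le_D1[OF abs_csharp_fun_le_norm[of f y]] p0[of y]] by (simp add: g_def)
    qed
    moreover have "0 \<le> csharp_fun (T t (norm f *\<^sub>R p + g)) x"
    proof (rule semigroup_positive[OF gen ab t0])
      show "0 \<le> csharp_fun (norm f *\<^sub>R p + g) y" for y
        using mult_right_mono[OF abs_le_D2[OF abs_csharp_fun_le_norm[of f y]] p0[of y]] by (simp add: g_def)
    qed
    ultimately have "\<bar>csharp_fun (T t g) x\<bar> \<le> norm f * csharp_fun (T t p) x"
      by (simp add: linear_diff[OF lin] linear_add[OF lin] linear_scale[OF lin] abs_le_iff)
    also have "csharp_fun (T t p) x \<le> r"
    proof -
      have "csharp_fun (T t p) x = sqrt \<delta> * heat (\<delta> + t) x"
        using semigroup_heat[OF gen ab \<delta>(1) t0] \<delta> t0 x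
        by (simp add: p_def linear_scale[OF lin] csharp_fun_heat)
      also have "\<dots> \<le> sqrt \<delta> * (1 / sqrt a)"
        unfolding heat_def using \<delta> a r t by (intro mult_left_mono frac_le) auto
      finally show ?thesis using a \<delta> by simp
    qed
    then have "norm f * csharp_fun (T t p) x \<le> norm f * r" by (simp add: mult_left_mono)
    finally show "\<bar>csharp_fun (T t g) x\<bar> \<le> e" using r by simp
  qed
  ultimately show thesis by (rule that)
qed

text \<open>The splitting \<open>f = q + (f - g - q) + g\<close>: the orbits of \<open>q\<close> are
  Cauchy with a rate, the second term is small in norm and stays so by contraction, and
  \<open>g\<close> becomes small by time \<open>a\<close>.\<close>

lemma semigroup_convergence:
  fixes T :: "nat \<Rightarrow> real \<Rightarrow> csharp \<Rightarrow> csharp"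
  assumes ab: "0 \<le> \<alpha>" "0 \<le> \<beta>" "0 < \<alpha> + \<beta>"
    and gen: "\<And>n. 1 \<le> n \<Longrightarrow> generates_semigroup UNIV (A_op (real n * \<alpha>) (real n * \<beta>)) (T n)"
    and a: "0 < a"
  shows "uniformly_convergent_on {a..b} (\<lambda>n t. T n t f)"
proof (rule Cauchy_uniformly_convergent)
  show "uniformly_Cauchy_on {a..b} (\<lambda>n t. T n t f)"
    unfolding uniformly_Cauchy_on_def
  proof (intro allI impI)
    fix e :: real assume e: "0 < e"
    obtain g where g: "f - g \<in> cline"
      and g_le: "\<And>\<alpha> \<beta> T t. generates_semigroup UNIV (A_op \<alpha> \<beta>) T \<Longrightarrow> 0 \<le> \<alpha> \<Longrightarrow> 0 \<le> \<beta> \<Longrightarrow> a \<le> t \<Longrightarrow>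
        norm (T t g) \<le> e / 8"
      using split_jump[OF a, of "e / 8" f] e by auto
    \<comment> \<open>Density follows from one of the semigroups, here \<open>n = 1\<close>, but the
      dense set is independent of \<open>n\<close>, so a single \<open>q\<close> serves all of
      them.\<close>
    obtain q h where qh: "(q, h) \<in> A_op 0 0" "q \<in> cline" and q: "norm (q - (f - g)) < e / 8"
      using A_op_0_dense[OF gen[of 1] g, of "e / 8"] e by auto
    define c where "c = 2 * (2 * norm q + norm h) / (\<alpha> + \<beta>)"
    have "(\<lambda>n. c * (1 / real n)) \<longlonglongrightarrow> 0" by (rule tendsto_mult_right_zero[OF lim_1_over_n])
    then have "\<forall>\<^sub>F n in sequentially. c * (1 / real n) < e / 8"
      using e by (intro order_tendstoD) auto
    then obtain N where N: "\<And>n. N \<le> n \<Longrightarrow> c * (1 / real n) < e / 8"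
      by (auto simp: eventually_sequentially)
    show "\<exists>M. \<forall>t\<in>{a..b}. \<forall>m\<ge>M. \<forall>n\<ge>M. dist (T m t f) (T n t f) < e"
    proof (intro exI[of _ "max 1 N"] ballI allI impI)
      fix t m n assume t: "t \<in> {a..b}" and m: "max 1 N \<le> m" and n: "max 1 N \<le> n"
      have t0: "0 \<le> t" "a \<le> t" using t a by auto
      have split: "\<exists>r. T k t f = T k t q + r \<and> norm r \<le> e / 4" if k: "max 1 N \<le> k" for k
      proof -
        have gk: "generates_semigroup UNIV (A_op (real k * \<alpha>) (real k * \<beta>)) (T k)"
          and abk: "0 \<le> real k * \<alpha>" "0 \<le> real k * \<beta>"
          using gen[of k] k ab by auto
        have lin: "linear (T k t)"
          using semigroup_bounded_linear[OF T_semigroup[OF gk abk] t0(1)] by (rule bounded_linear.linear)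
        have "norm (T k t (f - g - q)) \<le> e / 8"
          using T_contraction[OF gk abk t0(1), of "f - g - q"] q norm_minus_commute[of q "f - g"] by simp
        then have "norm (T k t (f - g - q) + T k t g) \<le> e / 4"
          using g_le[OF gk abk t0(2)] norm_triangle_ineq[of "T k t (f - g - q)" "T k t g"] by simp
        then show ?thesis
          by (intro exI[of _ "T k t (f - g - q) + T k t g"]) (simp add: linear_diff[OF lin])
      qed
      obtain r1 r2 where r: "T m t f = T m t q + r1" "norm r1 \<le> e / 4" "T n t f = T n t q + r2" "norm r2 \<le> e / 4"
        using split[OF m] split[OF n] by blast
      have "norm (T m t q - T n t q) \<le> c * (1 / real m + 1 / real n)"
        using semigroup_difference[OF ab _ _ gen gen qh t0(1), of m n] m n by (simp add: c_def)
      also have "c * (1 / real m + 1 / real n) < e / 4"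
      proof -
        have "c * (1 / real m) < e / 8" by (rule N) (use m in simp)
        moreover have "c * (1 / real n) < e / 8" by (rule N) (use n in simp)
        ultimately show ?thesis unfolding distrib_left by linarith
      qed
      finally have "norm (T m t q - T n t q) < e / 4" .
      moreover have "T m t f - T n t f = (T m t q - T n t q) + (r1 - r2)" using r by simp
      ultimately have "norm (T m t f - T n t f) < e"
        using r(2,4) norm_triangle_ineq[of "T m t q - T n t q" "r1 - r2"] norm_triangle_ineq4[of r1 r2] e
        by simp
      then show "dist (T m t f) (T n t f) < e" by (simp add: dist_norm)
    qed
  qed
qed

theorem theorem5p1:
  shows
    "(\<forall>\<alpha> \<beta> Cos. 0 \<le> \<alpha> \<longrightarrow> 0 \<le> \<beta> \<longrightarrow> 0 < \<alpha> + \<beta> \<longrightarrow>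
        generates_cosine_family UNIV (A_op \<alpha> \<beta>) Cos \<longrightarrow> (\<forall>t. onorm (Cos t) \<le> 5)) \<and>
     (\<forall>\<alpha> \<beta>. 0 \<le> \<alpha> \<longrightarrow> 0 \<le> \<beta> \<longrightarrow> 0 < \<alpha> + \<beta> \<longrightarrow>
        (\<forall>Cos :: nat \<Rightarrow> real \<Rightarrow> csharp \<Rightarrow> csharp.
           (\<forall>n\<ge>1. generates_cosine_family UNIV (A_op (real n * \<alpha>) (real n * \<beta>)) (Cos n)) \<longrightarrow>
           (\<forall>Cos_skew. generates_cosine_family cline (A_skew \<alpha> \<beta>) Cos_skew \<longrightarrow>
              (\<forall>f\<in>cline.
                 (\<lambda>n. SUP t\<in>{0..}. ennreal (norm (Cos n t f - Cos_skew t f))) \<longlonglongrightarrow> 0)) \<and>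
           (\<forall>f. f \<notin> cline \<longrightarrow> (\<exists>t. t \<noteq> 0 \<and> \<not> convergent (\<lambda>n. Cos n t f)))) \<and>
        (\<forall>T :: nat \<Rightarrow> real \<Rightarrow> csharp \<Rightarrow> csharp.
           (\<forall>n\<ge>1. generates_semigroup UNIV (A_op (real n * \<alpha>) (real n * \<beta>)) (T n)) \<longrightarrow>
           (\<forall>t>0. \<forall>f. convergent (\<lambda>n. T n t f)) \<and>
           (\<forall>f. f \<notin> cline \<longrightarrow>
              (\<forall>a b. 0 < a \<longrightarrow> a \<le> b \<longrightarrow> uniformly_convergent_on {a..b} (\<lambda>n t. T n t f)))))"
proof (intro conjI allI impI ballI)
  show "onorm (Cos t) \<le> 5"
    if "0 \<le> \<alpha>" "0 \<le> \<beta>" "0 < \<alpha> + \<beta>" "generates_cosine_family UNIV (A_op \<alpha> \<beta>) Cos" for \<alpha> \<beta> Cos t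
    using cosine_norm_le_5[OF that(4,1-3)] by (intro onorm_bound) auto
next
  fix \<alpha> \<beta> :: real and Cos :: "nat \<Rightarrow> real \<Rightarrow> csharp \<Rightarrow> csharp"
  assume ab: "0 \<le> \<alpha>" "0 \<le> \<beta>" "0 < \<alpha> + \<beta>"
    and gen: "\<forall>n\<ge>1. generates_cosine_family UNIV (A_op (real n * \<alpha>) (real n * \<beta>)) (Cos n)"
  show "(\<lambda>n. SUP t\<in>{0..}. ennreal (norm (Cos n t f - C t f))) \<longlonglongrightarrow> 0"
    if "generates_cosine_family cline (A_skew \<alpha> \<beta>) C" "f \<in> cline" for C f
    using gen by (intro cosine_convergence[OF ab _ that]) blast
  show "\<exists>t. t \<noteq> 0 \<and> \<not> convergent (\<lambda>n. Cos n t f)" if "f \<notin> cline" for f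
    using cosine_convergent_imp_cline[OF ab, of Cos f] gen that by (intro exI[of _ 1]) auto
next
  fix \<alpha> \<beta> :: real and T :: "nat \<Rightarrow> real \<Rightarrow> csharp \<Rightarrow> csharp"
  assume ab: "0 \<le> \<alpha>" "0 \<le> \<beta>" "0 < \<alpha> + \<beta>"
    and gen: "\<forall>n\<ge>1. generates_semigroup UNIV (A_op (real n * \<alpha>) (real n * \<beta>)) (T n)"
  have unif: "uniformly_convergent_on {a..b} (\<lambda>n t. T n t f)" if "0 < a" for a b f
    using gen by (intro semigroup_convergence[OF ab _ that]) blast
  show "convergent (\<lambda>n. T n t f)" if "0 < t" for t f
    using uniformly_convergent_imp_convergent[OF unif[OF that, of t]] by auto
  show "uniformly_convergent_on {a..b} (\<lambda>n t. T n t f)" if "0 < a" for a b f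
    by (rule unif[OF that])
qed

end
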